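(* Let $\beta>0$ be fixed. Let $m\ge 1$ be an integer and $a_1,a_2>\frac{\beta}{2}(m-1)$ be real numbers, where $m$ and $a_1$ may depend on $a_2$, and put $a:=a_1+a_2$. Let $\mu=(\mu_1,\dots,\mu_m)$ be a beta-Laguerre ensemble with density $f_{\beta,a_1}$ and let $\lambda=(\lambda_1,\dots,\lambda_m)$ be a beta-Jacobi ensemble with density $f_{\beta,a_1,a_2}$. Let $d\big(\mathcal{L}(2a\lambda),\mathcal{L}(\mu)\big)$ denote either the total variation distance $\|\mathcal{L}(2a\lambda)-\mathcal{L}(\mu)\|_{\rm TV}$ or the Kullback-Leibler distance $D_{\rm KL}\big(\mathcal{L}(2a\lambda)\,\|\,\mathcal{L}(\mu)\big)$ between the probability distributions of $2a\lambda$ and $\mu$. Then, for each of the two choices of $d$: (i) $\lim_{a_2\to\infty} d\big(\mathcal{L}(2a\lambda),\mathcal{L}(\mu)\big)=0$ if $a_1m=o(a_2)$ as $a_2\to\infty$; (ii) $\liminf_{a_2\to\infty} d\big(\mathcal{L}(2a\lambda),\mathcal{L}(\mu)\big)>0$ if $\lim_{a_2\to\infty}\frac{a_1m}{a_2}=\sigma$ for some $\sigma>0$.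
   Context: $\mathcal{L}(X)$ denotes the distribution of a random vector $X$. For probability measures $P,Q$ on $\mathbb{R}^n$ with Lebesgue densities $f,g$: $\|P-Q\|_{\rm TV}=2\sup_{A}|P(A)-Q(A)|=\int|f-g|\,dx$ (supremum over Borel sets $A$), and $D_{\rm KL}(P\|Q)=\int \frac{dP}{dQ}\log\frac{dP}{dQ}\,dQ$. Set $r:=1+\frac{\beta}{2}(m-1)$. The beta-Jacobi density with parameters $a_1,a_2>\frac{\beta}{2}(m-1)$ is, on $[0,1]^m$, $$f_{\beta,a_1,a_2}(x_1,\dots,x_m)=C_{\rm J}^{\beta,a_1,a_2}\prod_{1\le i<j\le m}|x_i-x_j|^{\beta}\prod_{i=1}^m x_i^{a_1-r}(1-x_i)^{a_2-r},$$ $$C_{\rm J}^{\beta,a_1,a_2}=\prod_{j=1}^m\frac{\Gamma(1+\beta/2)\,\Gamma(a_1+a_2-\beta(m-j)/2)}{\Gamma(1+\beta j/2)\,\Gamma(a_1-\beta(m-j)/2)\,\Gamma(a_2-\beta(m-j)/2)}.$$ The beta-Laguerre density with parameter $a_1>\frac{\beta}{2}(m-1)$ is, on $[0,\infty)^m$, $$f_{\beta,a_1}(x_1,\dots,x_m)=C_{\rm L}^{\beta,a_1}\prod_{1\le i<j\le m}|x_i-x_j|^{\beta}\prod_{i=1}^m x_i^{a_1-r}\,e^{-\frac12\sum_{i=1}^m x_i},$$ $$C_{\rm L}^{\beta,a_1}=2^{-ma_1}\prod_{j=1}^m\frac{\Gamma(1+\beta/2)}{\Gamma(1+\beta j/2)\,\Gamma(a_1-\beta(m-j)/2)}.$$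 *)

theory Defs
  imports "HOL-Probability.Probability" "HOL-Library.Landau_Symbols"
begin

text \<open>Vectors in \<open>\<real>\<^sup>m\<close> with varying \<open>m\<close> are extensional functions on \<open>{1..m}\<close>; the
  \<open>\<sigma>\<close>-algebra of the product measure below is the Borel \<open>\<sigma>\<close>-algebra of \<open>\<real>\<^sup>m\<close>.\<close>

abbreviation lborel_vec :: "nat \<Rightarrow> (nat \<Rightarrow> real) measure" where
  "lborel_vec m \<equiv> PiM {1..m} (\<lambda>_. lborel)"

definition law :: "nat \<Rightarrow> 'w measure \<Rightarrow> ('w \<Rightarrow> nat \<Rightarrow> real) \<Rightarrow> (nat \<Rightarrow> real) measure" where
  "law m M X = distr M (lborel_vec m) X"

definition scale_vec :: "nat \<Rightarrow> real \<Rightarrow> (nat \<Rightarrow> real) \<Rightarrow> nat \<Rightarrow> real" where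
  "scale_vec m c x = (\<lambda>i\<in>{1..m}. c * x i)"

definition jacobi_const :: "real \<Rightarrow> nat \<Rightarrow> real \<Rightarrow> real \<Rightarrow> real" where
  "jacobi_const \<beta> m a1 a2 =
     (\<Prod>j=1..m. (Gamma (1 + \<beta> / 2) * Gamma (a1 + a2 - \<beta> * (real m - real j) / 2)) /
        (Gamma (1 + \<beta> * real j / 2) * Gamma (a1 - \<beta> * (real m - real j) / 2)
           * Gamma (a2 - \<beta> * (real m - real j) / 2)))"

definition laguerre_const :: "real \<Rightarrow> nat \<Rightarrow> real \<Rightarrow> real" where
  "laguerre_const \<beta> m a1 = 2 powr (- (real m * a1)) *
     (\<Prod>j=1..m. Gamma (1 + \<beta> / 2) /
        (Gamma (1 + \<beta> * real j / 2) * Gamma (a1 - \<beta> * (real m - real j) / 2)))"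

definition jacobi_density :: "real \<Rightarrow> nat \<Rightarrow> real \<Rightarrow> real \<Rightarrow> (nat \<Rightarrow> real) \<Rightarrow> real" where
  "jacobi_density \<beta> m a1 a2 x =
     (let r = 1 + \<beta> / 2 * (real m - 1) in
      if \<forall>i\<in>{1..m}. 0 \<le> x i \<and> x i \<le> 1
      then jacobi_const \<beta> m a1 a2
        * (\<Prod>(i, j) \<in> {(i, j). 1 \<le> i \<and> i < j \<and> j \<le> m}. \<bar>x i - x j\<bar> powr \<beta>)
        * (\<Prod>i=1..m. x i powr (a1 - r) * (1 - x i) powr (a2 - r))
      else 0)"

definition laguerre_density :: "real \<Rightarrow> nat \<Rightarrow> real \<Rightarrow> (nat \<Rightarrow> real) \<Rightarrow> real" where
  "laguerre_density \<beta> m a1 x =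
     (let r = 1 + \<beta> / 2 * (real m - 1) in
      if \<forall>i\<in>{1..m}. 0 \<le> x i
      then laguerre_const \<beta> m a1
        * (\<Prod>(i, j) \<in> {(i, j). 1 \<le> i \<and> i < j \<and> j \<le> m}. \<bar>x i - x j\<bar> powr \<beta>)
        * (\<Prod>i=1..m. x i powr (a1 - r))
        * exp (- (\<Sum>i=1..m. x i) / 2)
      else 0)"

definition jacobi_ensemble ::
    "real \<Rightarrow> nat \<Rightarrow> real \<Rightarrow> real \<Rightarrow> 'w measure \<Rightarrow> ('w \<Rightarrow> nat \<Rightarrow> real) \<Rightarrow> bool" where
  "jacobi_ensemble \<beta> m a1 a2 M X \<longleftrightarrow>
     prob_space M \<and> distributed M (lborel_vec m) X (\<lambda>x. ennreal (jacobi_density \<beta> m a1 a2 x))"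

definition laguerre_ensemble ::
    "real \<Rightarrow> nat \<Rightarrow> real \<Rightarrow> 'w measure \<Rightarrow> ('w \<Rightarrow> nat \<Rightarrow> real) \<Rightarrow> bool" where
  "laguerre_ensemble \<beta> m a1 M X \<longleftrightarrow>
     prob_space M \<and> distributed M (lborel_vec m) X (\<lambda>x. ennreal (laguerre_density \<beta> m a1 x))"

text \<open>Both distances are only meant for probability measures on the same \<open>\<sigma>\<close>-algebra.
  The total variation distance carries the factor 2, so it takes values in \<open>[0, 2]\<close>.\<close>

definition tv_distance :: "'a measure \<Rightarrow> 'a measure \<Rightarrow> ereal" where
  "tv_distance P Q = 2 * (SUP A\<in>sets P. ereal \<bar>measure P A - measure Q A\<bar>)"

text \<open>The library's \<^const>\<open>KL_divergence\<close> takes the reference measure first, and its Bochner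
  integral would be 0 for a non-integrable integrand. For probability measures with
  \<open>P \<lless> Q\<close> the negative part of \<open>log (dP/dQ)\<close> is always \<open>P\<close>-integrable, so that
  non-integrability means that the divergence is infinite.\<close>

definition kl_distance :: "'a measure \<Rightarrow> 'a measure \<Rightarrow> ereal" where
  "kl_distance P Q =
     (if absolutely_continuous Q P \<and> integrable P (entropy_density (exp 1) Q P)
      then ereal (KL_divergence (exp 1) Q P) else \<infinity>)"

lemma KL_divergence_eq_integral_RN_deriv:
  assumes "sigma_finite_measure Q" "finite_measure P" "sets P = sets Q"
    and "absolutely_continuous Q P"
  shows "KL_divergence (exp 1) Q P =
    (\<integral>x. enn2real (RN_deriv Q P x) * ln (enn2real (RN_deriv Q P x)) \<partial>Q)"
proof -
  interpret Q: sigma_finite_measure Q by fact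
  interpret P: finite_measure P by fact
  have ac: "density Q (RN_deriv Q P) = P"
    using assms by (intro Q.density_RN_deriv) auto
  have fin: "AE x in Q. RN_deriv Q P x \<noteq> \<infinity>"
    using Q.RN_deriv_finite[OF P.sigma_finite_measure_axioms assms(4,3)] .
  have eq: "P = density Q (\<lambda>x. ennreal (enn2real (RN_deriv Q P x)))"
    by (subst ac[symmetric], rule density_cong) (use fin in \<open>auto simp: top.not_eq_extremum\<close>)
  have "KL_divergence (exp 1) Q P = (\<integral>x. ln (enn2real (RN_deriv Q P x)) \<partial>P)"
    unfolding KL_divergence_def entropy_density_def by (simp add: log_def comp_def)
  also have "\<dots> = (\<integral>x. ln (enn2real (RN_deriv Q P x))
      \<partial>(density Q (\<lambda>x. ennreal (enn2real (RN_deriv Q P x)))))"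
    using eq by simp
  also have "\<dots> = (\<integral>x. enn2real (RN_deriv Q P x) * ln (enn2real (RN_deriv Q P x)) \<partial>Q)"
    by (subst integral_real_density) auto
  finally show ?thesis .
qed

end

theory Submission imports Defs begin

text \<open>
  Write \<open>S\<^sub>k = \<Sum> x\<^sub>i\<^sup>k\<close>, \<open>a = a\<^sub>1 + a\<^sub>2\<close>, \<open>p = a\<^sub>1 / a\<close>, and let \<open>\<rho>\<close> be the density of the law of \<open>2 a \<lambda>\<close> with
  respect to the law of \<open>\<mu>\<close>. The normalising constants are only known to be correct at the given
  parameters, so moments are not computed from Selberg integrals at shifted parameters. Instead,
  pushing a log-gas density forward along the coordinatewise flow \<open>x \<mapsto> x + t \<phi>(x)\<close> and letting
  \<open>t \<down> 0\<close> gives loop equations: \<open>\<phi> = x\<^sup>k\<^sup>+\<^sup>1 (1 - x)\<close> in the Jacobi case and \<open>\<phi> = x\<^sup>k\<^sup>+\<^sup>1\<close> in the Laguerre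
  case relate expectations of polynomials in \<open>S\<^sub>1, S\<^sub>2, S\<^sub>3, S\<^sub>4\<close>. The flow keeps the repulsion
  \<open>\<bar>x\<^sub>i - x\<^sub>j\<bar>\<^sup>\<beta>\<close> under control because it only enters through divided differences of \<open>\<phi>\<close>.

  (i) Convexity of \<open>ln \<Gamma>\<close> bounds the constant in \<open>ln \<rho>\<close>, and
  \<open>ln (1 - x) \<le> ln (1 - p) - (x - p) / (1 - p) - (x - p)\<^sup>2 / 2\<close> bounds the rest. In the mean the linear term
  vanishes, since \<open>E S\<^sub>1 = m p\<close>, and the mean of \<open>Y = \<Sum> (x\<^sub>i - p)\<^sup>2\<close> cancels the terms of order \<open>a\<^sub>1 m\<^sup>2 / a\<^sub>2\<close>
  of the constant. What is left of the Kullback-Leibler distance is \<open>O(a\<^sub>1 m / a\<^sub>2)\<close>, and a Pinsker-type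
  inequality transfers this to total variation.

  (ii) The test statistic \<open>U(y) = \<Sum> (y\<^sub>i - 2 a\<^sub>1)\<^sup>2 / (4 a)\<close> has bounded variance under both laws, while its
  means differ by at least a positive constant when \<open>a\<^sub>1 m / a\<^sub>2\<close> tends to a positive limit. This works
  uniformly for bounded and unbounded \<open>m\<close>, so no central limit theorem is needed.
\<close>

text \<open>Direct integration by parts fails: the repulsion is not differentiable on the diagonal
  for \<beta> \<le> 1, and the exponents of x and 1 - x may be negative. Under a flow fixing the
  endpoints each singular factor is merely multiplied by some 1 + t u with tame u, and only these
  multipliers get differentiated. A field k yields a function \<open>drift k\<close> with E h' + E
  (h * drift k) = 0. The choice h = 1 gives means. Choosing for h a combination of drifts turns its
  second moment into the mean of a derivative; this yields variances of order one although the m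
  coordinates are strongly dependent. The quadratic statistic is such a combination, up to a
  constant and, for Jacobi, a small multiple of a squared deviation of S 1. The gap of the means in
  (ii) is governed by m p^2 \<delta> with \<delta> = 1 + \<beta>/2 (m - 1), which is at least a
  multiple of (m p)^2 for every m. Finally a1 > \<beta>/2 (m - 1) makes m a1 = O(a2) imply m^2 =
  O(a), so that all constants depend on \<beta> and the limit only.\<close>

section \<open>Change of variables in product measures\<close>

text \<open>Boxes determine the product measure because the factors are sigma-finite, and on a box
  the integrand is a product of functions of one coordinate, so Tonelli reduces the claim to the
  one-dimensional identity \<open>one\<close>. The weight \<open>I\<close> stands for a Jacobian
  times the indicator of a domain.\<close>

lemma distr_PiM_density_lborel:
  fixes T :: "real \<Rightarrow> real" and J :: "real \<Rightarrow> ennreal" and I :: "real \<Rightarrow> ennreal"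
  assumes K: "finite K"
    and [measurable]: "T \<in> borel_measurable borel" "I \<in> borel_measurable borel" "J \<in> borel_measurable borel"
    and sf: "sigma_finite_measure (density lborel J)"
    and one: "distr (density lborel I) lborel T = density lborel J"
  shows "distr (density (PiM K (\<lambda>_. lborel)) (\<lambda>x. \<Prod>i\<in>K. I (x i))) (PiM K (\<lambda>_. lborel)) (\<lambda>x. \<lambda>i\<in>K. T (x i))
     = PiM K (\<lambda>_. density lborel J)"
proof -
  interpret L: product_sigma_finite "\<lambda>_. lborel :: real measure" ..
  interpret N: product_sigma_finite "\<lambda>_. density lborel J"
    by (simp add: product_sigma_finite_def sf)
  show ?thesis
  proof (rule N.PiM_eqI[OF K])
    show "sets (distr (density (PiM K (\<lambda>_. lborel)) (\<lambda>x. \<Prod>i\<in>K. I (x i))) (PiM K (\<lambda>_. lborel)) (\<lambda>x. \<lambda>i\<in>K. T (x i)))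
      = sets (PiM K (\<lambda>_. density lborel J))"
      by (simp cong: sets_PiM_cong)
    fix A assume A0: "\<And>i. i \<in> K \<Longrightarrow> A i \<in> sets (density lborel J)"
    then have A[measurable]: "\<And>i. i \<in> K \<Longrightarrow> A i \<in> sets borel" by simp
    have AK[measurable]: "Pi\<^sub>E K A \<in> sets (PiM K (\<lambda>_. lborel))"
      using A K by (intro sets_PiM_I_finite) auto
    have "emeasure (distr (density (PiM K (\<lambda>_. lborel)) (\<lambda>x. \<Prod>i\<in>K. I (x i))) (PiM K (\<lambda>_. lborel)) (\<lambda>x. \<lambda>i\<in>K. T (x i))) (Pi\<^sub>E K A)
      = (\<integral>\<^sup>+x. indicator (Pi\<^sub>E K A) x \<partial>(distr (density (PiM K (\<lambda>_. lborel)) (\<lambda>x. \<Prod>i\<in>K. I (x i))) (PiM K (\<lambda>_. lborel)) (\<lambda>x. \<lambda>i\<in>K. T (x i))))"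
      by (subst nn_integral_indicator) auto
    also have "\<dots> = (\<integral>\<^sup>+x. (\<Prod>i\<in>K. I (x i)) * indicator (Pi\<^sub>E K A) (\<lambda>i\<in>K. T (x i)) \<partial>(PiM K (\<lambda>_. lborel)))"
      by (subst nn_integral_distr) (auto simp: nn_integral_density)
    also have "\<dots> = (\<integral>\<^sup>+x. (\<Prod>i\<in>K. I (x i) * indicator (A i) (T (x i))) \<partial>(PiM K (\<lambda>_. lborel)))"
    proof (intro nn_integral_cong)
      fix x
      have "indicator (Pi\<^sub>E K A) (\<lambda>i\<in>K. T (x i)) = (\<Prod>i\<in>K. indicator (A i) (T (x i)) :: ennreal)"
        using K by (auto simp: indicator_def PiE_def Pi_def intro!: prod.neutral[symmetric] prod_zero)
      then show "(\<Prod>i\<in>K. I (x i)) * indicator (Pi\<^sub>E K A) (\<lambda>i\<in>K. T (x i)) =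
         (\<Prod>i\<in>K. I (x i) * indicator (A i) (T (x i)))"
        by (simp add: prod.distrib)
    qed
    also have "\<dots> = (\<Prod>i\<in>K. \<integral>\<^sup>+x. I x * indicator (A i) (T x) \<partial>lborel)"
      using K A by (intro L.product_nn_integral_prod) auto
    also have "\<dots> = (\<Prod>i\<in>K. emeasure (distr (density lborel I) lborel T) (A i))"
    proof (intro prod.cong refl)
      fix i assume i: "i \<in> K"
      note [measurable] = A[OF i]
      have "emeasure (distr (density lborel I) lborel T) (A i) = (\<integral>\<^sup>+x. indicator (A i) x \<partial>distr (density lborel I) lborel T)"
        by (subst nn_integral_indicator) auto
      also have "\<dots> = (\<integral>\<^sup>+x. I x * indicator (A i) (T x) \<partial>lborel)"
        by (subst nn_integral_distr) (auto simp: nn_integral_density)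
      finally show "(\<integral>\<^sup>+x. I x * indicator (A i) (T x) \<partial>lborel) = emeasure (distr (density lborel I) lborel T) (A i)" ..
    qed
    finally show "emeasure (distr (density (PiM K (\<lambda>_. lborel)) (\<lambda>x. \<Prod>i\<in>K. I (x i))) (PiM K (\<lambda>_. lborel)) (\<lambda>x. \<lambda>i\<in>K. T (x i))) (Pi\<^sub>E K A)
       = (\<Prod>i\<in>K. emeasure (density lborel J) (A i))"
      by (simp add: one)
  qed
qed

lemma sigma_finite_density_indicator_lborel:
  assumes "J \<in> sets borel"
  shows "sigma_finite_measure (density lborel (indicator J :: real \<Rightarrow> ennreal))"
proof -
  have "(indicator J :: real \<Rightarrow> ennreal) = (\<lambda>x. ennreal (indicator J x))"
    by (auto simp: indicator_def)
  then show ?thesis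
    using assms
    by (subst sigma_finite_measure.sigma_finite_iff_density_finite[OF lborel.sigma_finite_measure_axioms]) auto
qed

text \<open>The measure with density \<open>indicator J\<close> in every coordinate is written twice
  as an image: of the weighted measure under \<open>T\<close>, and of itself under the identity.
  Integrating \<open>F\<close> against both gives the formula. The hypothesis \<open>one\<close>
  tests sets only, so each concrete map requires just a one-dimensional check.\<close>

lemma nn_integral_PiM_lborel_subst:
  fixes T T' :: "real \<Rightarrow> real" and F :: "('i \<Rightarrow> real) \<Rightarrow> ennreal"
  assumes K: "finite K"
    and [measurable]: "T \<in> borel_measurable borel" "T' \<in> borel_measurable borel" "I \<in> sets borel" "J \<in> sets borel"
    and F[measurable]: "F \<in> borel_measurable (PiM K (\<lambda>_. lborel))"
    and one: "\<And>A. A \<in> sets borel \<Longrightarrow>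
      (\<integral>\<^sup>+x. ennreal (T' x) * indicator I x * indicator A (T x) \<partial>lborel) = (\<integral>\<^sup>+y. indicator J y * indicator A y \<partial>lborel)"
  shows "(\<integral>\<^sup>+y. F y * (\<Prod>i\<in>K. indicator J (y i)) \<partial>PiM K (\<lambda>_. lborel)) =
    (\<integral>\<^sup>+x. F (\<lambda>i\<in>K. T (x i)) * (\<Prod>i\<in>K. ennreal (T' (x i)) * indicator I (x i)) \<partial>PiM K (\<lambda>_. lborel))"
proof -
  let ?L = "PiM K (\<lambda>_. lborel :: real measure)"
  let ?I = "\<lambda>x. ennreal (T' x) * indicator I x"
  have sf: "sigma_finite_measure (density lborel (indicator J :: real \<Rightarrow> ennreal))"
    by (rule sigma_finite_density_indicator_lborel) fact
  have eq: "distr (density lborel ?I) lborel T = density lborel (indicator J)"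
  proof (rule measure_eqI)
    fix A assume "A \<in> sets (distr (density lborel ?I) lborel T)"
    then have [measurable]: "A \<in> sets borel" by simp
    have "emeasure (distr (density lborel ?I) lborel T) A = (\<integral>\<^sup>+x. indicator A x \<partial>distr (density lborel ?I) lborel T)"
      by (subst nn_integral_indicator) auto
    also have "\<dots> = (\<integral>\<^sup>+x. ?I x * indicator A (T x) \<partial>lborel)"
      by (subst nn_integral_distr) (auto simp: nn_integral_density)
    finally show "emeasure (distr (density lborel ?I) lborel T) A = emeasure (density lborel (indicator J)) A"
      by (simp add: one emeasure_density)
  qed simp
  have 1: "distr (density ?L (\<lambda>x. \<Prod>i\<in>K. ?I (x i))) ?L (\<lambda>x. \<lambda>i\<in>K. T (x i)) = PiM K (\<lambda>_. density lborel (indicator J))"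
    by (rule distr_PiM_density_lborel[OF K _ _ _ sf eq]) auto
  have 2: "distr (density ?L (\<lambda>x. \<Prod>i\<in>K. indicator J (x i))) ?L (\<lambda>x. \<lambda>i\<in>K. x i) = PiM K (\<lambda>_. density lborel (indicator J))"
    by (rule distr_PiM_density_lborel[OF K _ _ _ sf]) (auto simp: distr_id2)
  have "(\<integral>\<^sup>+y. F y * (\<Prod>i\<in>K. indicator J (y i)) \<partial>?L) =
     (\<integral>\<^sup>+y. (\<Prod>i\<in>K. indicator J (y i)) * F (\<lambda>i\<in>K. y i) \<partial>?L)"
    by (intro nn_integral_cong) (auto simp: space_PiM mult.commute PiE_restrict)
  also have "\<dots> = (\<integral>\<^sup>+y. F y \<partial>distr (density ?L (\<lambda>x. \<Prod>i\<in>K. indicator J (x i))) ?L (\<lambda>x. \<lambda>i\<in>K. x i))"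
    by (subst nn_integral_distr) (auto simp: nn_integral_density)
  also have "\<dots> = (\<integral>\<^sup>+y. F y \<partial>distr (density ?L (\<lambda>x. \<Prod>i\<in>K. ?I (x i))) ?L (\<lambda>x. \<lambda>i\<in>K. T (x i)))"
    by (simp only: 1 2)
  also have "\<dots> = (\<integral>\<^sup>+x. (\<Prod>i\<in>K. ?I (x i)) * F (\<lambda>i\<in>K. T (x i)) \<partial>?L)"
    by (subst nn_integral_distr) (auto simp: nn_integral_density)
  finally show ?thesis by (simp add: mult.commute)
qed

lemma nn_integral_subst_Icc:
  fixes T T' :: "real \<Rightarrow> real"
  assumes "a \<le> b"
    and der: "\<And>x. x \<in> {a..b} \<Longrightarrow> (T has_real_derivative T' x) (at x)"
    and cont: "continuous_on {a..b} T'" and nonneg: "\<And>x. x \<in> {a..b} \<Longrightarrow> T' x \<ge> 0"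
    and [measurable]: "A \<in> sets borel"
  shows "(\<integral>\<^sup>+x. ennreal (T' x) * indicator {a..b} x * indicator A (T x) \<partial>lborel)
    = (\<integral>\<^sup>+y. indicator {T a..T b} y * indicator A y \<partial>lborel)"
proof -
  have "(\<integral>\<^sup>+y. indicator {T a..T b} y * indicator A y \<partial>lborel) = (\<integral>\<^sup>+y. ennreal (indicator A y) * indicator {T a..T b} y \<partial>lborel)"
    by (intro nn_integral_cong) (auto simp: indicator_def)
  also have "\<dots> = (\<integral>\<^sup>+y. ennreal (indicator A y * indicator {T a..T b} y) \<partial>lborel)"
    by (intro nn_integral_cong) (auto simp: indicator_def)
  also have "\<dots> = (\<integral>\<^sup>+x. ennreal (indicator A (T x) * T' x * indicator {a..b} x) \<partial>lborel)"
    using assms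
    by (intro nn_integral_substitution[OF _ der cont nonneg \<open>a \<le> b\<close>]) (auto simp: set_borel_measurable_def)
  also have "\<dots> = (\<integral>\<^sup>+x. ennreal (T' x) * indicator {a..b} x * indicator A (T x) \<partial>lborel)"
    by (intro nn_integral_cong) (auto simp: indicator_def)
  finally show ?thesis ..
qed

text \<open>Monotone convergence over the intervals from 0 to n: their images are the intervals from
  0 to \<open>T n\<close>, and \<open>T x \<ge> x\<close> makes these exhaust the half-line as
  well.\<close>

lemma nn_integral_subst_atLeast_0:
  fixes T T' :: "real \<Rightarrow> real"
  assumes der: "\<And>x. x \<ge> 0 \<Longrightarrow> (T has_real_derivative T' x) (at x)"
    and cont: "continuous_on {0..} T'" and nonneg: "\<And>x. x \<ge> 0 \<Longrightarrow> T' x \<ge> 0"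
    and T0: "T 0 = 0" and T1: "\<And>x. x \<ge> 0 \<Longrightarrow> T x \<ge> x"
    and [measurable]: "A \<in> sets borel" "T \<in> borel_measurable borel" "T' \<in> borel_measurable borel"
  shows "(\<integral>\<^sup>+x. ennreal (T' x) * indicator {0..} x * indicator A (T x) \<partial>lborel)
    = (\<integral>\<^sup>+y. indicator {0..} y * indicator A y \<partial>lborel)"
proof -
  have mono: "T x \<le> T y" if "0 \<le> x" "x \<le> y" for x y
  proof (rule DERIV_nonneg_imp_nondecreasing[OF that(2)])
    fix z assume "x \<le> z" "z \<le> y"
    then show "\<exists>D. (T has_real_derivative D) (at z) \<and> 0 \<le> D"
      using der[of z] nonneg[of z] that by auto
  qed
  have S: "(SUP n. indicator {0..b n} x * c) = indicator {0..} x * c"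
    if inc: "incseq b" and lim: "\<And>x. \<exists>n. x \<le> b n" for x :: real and b :: "nat \<Rightarrow> real" and c :: ennreal
  proof (rule antisym)
    show "(SUP n. indicator {0..b n} x * c) \<le> indicator {0..} x * c"
      by (intro SUP_least) (auto simp: indicator_def)
    obtain n where "x \<le> b n" using lim by blast
    then have "indicator {0..} x * c \<le> indicator {0..b n} x * c" by (auto simp: indicator_def)
    also have "\<dots> \<le> (SUP n. indicator {0..b n} x * c)" by (intro SUP_upper) auto
    finally show "indicator {0..} x * c \<le> (SUP n. indicator {0..b n} x * c)" .
  qed
  have incT: "incseq (\<lambda>n. T (real n))" by (auto simp: incseq_def intro!: mono)
  have limT: "\<exists>n. x \<le> T (real n)" for x
  proof -
    obtain n where "x \<le> real n" using real_arch_simple by blast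
    with T1[of "real n"] show ?thesis by (intro exI[of _ n]) auto
  qed
  have inc: "incseq (\<lambda>n. indicator {0..b n} x * c)"
    if "incseq b" for b :: "nat \<Rightarrow> real" and x and c :: ennreal
    unfolding incseq_def
  proof (intro allI impI mult_right_mono)
    fix n k :: nat assume "n \<le> k"
    then have "b n \<le> b k" using that by (auto simp: incseq_def)
    then show "indicator {0..b n} x \<le> (indicator {0..b k} x :: ennreal)"
      by (auto simp: indicator_def)
  qed simp
  have "(\<integral>\<^sup>+y. indicator {0..} y * indicator A y \<partial>lborel) = (\<integral>\<^sup>+y. (SUP n. indicator {0..T (real n)} y * indicator A y) \<partial>lborel)"
    by (subst S[OF incT limT]) auto
  also have "\<dots> = (SUP n. \<integral>\<^sup>+y. indicator {0..T (real n)} y * indicator A y \<partial>lborel)"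
    using inc[OF incT] by (intro nn_integral_monotone_convergence_SUP) (auto simp: incseq_def le_fun_def)
  also have "\<dots> = (SUP n. \<integral>\<^sup>+x. indicator {0..real n} x * (ennreal (T' x) * indicator A (T x)) \<partial>lborel)"
  proof (intro SUP_cong refl)
    fix n :: nat
    have "(\<integral>\<^sup>+x. ennreal (T' x) * indicator {0..real n} x * indicator A (T x) \<partial>lborel)
      = (\<integral>\<^sup>+y. indicator {T 0..T (real n)} y * indicator A y \<partial>lborel)"
      by (rule nn_integral_subst_Icc)
        (simp_all add: der nonneg continuous_on_subset[OF cont])
    then show "(\<integral>\<^sup>+y. indicator {0..T (real n)} y * indicator A y \<partial>lborel) =
      (\<integral>\<^sup>+x. indicator {0..real n} x * (ennreal (T' x) * indicator A (T x)) \<partial>lborel)"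
      by (simp add: T0 ac_simps)
  qed
  also have "\<dots> = (\<integral>\<^sup>+x. (SUP n. indicator {0..real n} x * (ennreal (T' x) * indicator A (T x))) \<partial>lborel)"
    using inc[of real] by (intro nn_integral_monotone_convergence_SUP[symmetric]) (auto simp: incseq_def le_fun_def)
  also have "\<dots> = (\<integral>\<^sup>+x. indicator {0..} x * (ennreal (T' x) * indicator A (T x)) \<partial>lborel)"
    by (subst S) (auto simp: incseq_def real_arch_simple)
  finally show ?thesis by (simp add: ac_simps)
qed

section \<open>Log-gases and loop equations\<close>

text \<open>Otherwise \<open>simp\<close> rewrites the index set \<open>{1..m}\<close> and the power sum \<open>S 1\<close> to forms with \<open>Suc 0\<close>.\<close>

declare One_nat_def [simp del]

definition index_pairs :: "nat \<Rightarrow> (nat \<times> nat) set" where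
  "index_pairs m = {(i, j). 1 \<le> i \<and> i < j \<and> j \<le> m}"

lemma finite_index_pairs [simp]: "finite (index_pairs m)"
  by (rule finite_subset[of _ "{1..m} \<times> {1..m}"]) (auto simp: index_pairs_def)

definition power_sum :: "nat \<Rightarrow> nat \<Rightarrow> (nat \<Rightarrow> real) \<Rightarrow> real" where
  "power_sum m k x = (\<Sum>i=1..m. x i ^ k)"

lemma power_sum_0 [simp]: "power_sum m 0 x = real m"
  by (simp add: power_sum_def)

lemma power_sum_measurable [measurable]:
  "power_sum m k \<in> borel_measurable (PiM {1..m} (\<lambda>_. lborel))"
  unfolding power_sum_def by measurable

text \<open>One form for both ensembles, which differ only in the one-body weight \<open>w\<close>
  and the interval \<open>I\<close>. The constant \<open>c\<close> stays a parameter: the loop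
  equations use nothing about it beyond its sign and total mass one.\<close>

definition log_gas_density ::
    "real \<Rightarrow> nat \<Rightarrow> real \<Rightarrow> (real \<Rightarrow> real) \<Rightarrow> real set \<Rightarrow> (nat \<Rightarrow> real) \<Rightarrow> real" where
  "log_gas_density \<beta> m c w I x =
    (if \<forall>i\<in>{1..m}. x i \<in> I
     then c * (\<Prod>(i, j)\<in>index_pairs m. \<bar>x i - x j\<bar> powr \<beta>) * (\<Prod>i=1..m. w (x i)) else 0)"

lemma component_measurable_index_pairs:
  assumes "p \<in> index_pairs m"
  shows "(\<lambda>x. x (fst p)) \<in> borel_measurable (PiM {1..m} (\<lambda>_. lborel))"
    "(\<lambda>x. x (snd p)) \<in> borel_measurable (PiM {1..m} (\<lambda>_. lborel))"
proof -
  have "fst p \<in> {1..m}" "snd p \<in> {1..m}" using assms by (auto simp: index_pairs_def)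
  then show "(\<lambda>x. x (fst p)) \<in> borel_measurable (PiM {1..m} (\<lambda>_. lborel))"
    "(\<lambda>x. x (snd p)) \<in> borel_measurable (PiM {1..m} (\<lambda>_. lborel))"
    by measurable
qed

lemma prod_index_pairs_measurable:
  fixes q :: "real \<Rightarrow> real \<Rightarrow> real"
  assumes [measurable]: "case_prod q \<in> borel_measurable (borel \<Otimes>\<^sub>M borel)"
  shows "(\<lambda>x. \<Prod>(i, j)\<in>index_pairs m. q (x i) (x j)) \<in> borel_measurable (PiM {1..m} (\<lambda>_. lborel))"
proof -
  have "(\<lambda>x. \<Prod>p\<in>index_pairs m. q (x (fst p)) (x (snd p))) \<in> borel_measurable (PiM {1..m} (\<lambda>_. lborel))"
  proof (rule borel_measurable_prod)
    fix p assume "p \<in> index_pairs m"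
    note [measurable] = component_measurable_index_pairs[OF this]
    show "(\<lambda>x. q (x (fst p)) (x (snd p))) \<in> borel_measurable (PiM {1..m} (\<lambda>_. lborel))"
      by measurable
  qed
  then show ?thesis by (simp add: case_prod_beta)
qed

lemma log_gas_density_measurable:
  assumes [measurable]: "w \<in> borel_measurable borel" "I \<in> sets borel"
  shows "log_gas_density \<beta> m c w I \<in> borel_measurable (PiM {1..m} (\<lambda>_. lborel))"
proof -
  have [measurable]: "(\<lambda>x. \<Prod>(i, j)\<in>index_pairs m. \<bar>x i - x j\<bar> powr \<beta>) \<in> borel_measurable (PiM {1..m} (\<lambda>_. lborel))"
    by (rule prod_index_pairs_measurable) measurable
  show ?thesis unfolding log_gas_density_def by measurable
qed

text \<open>\<open>exp_moment\<close> is the integrability input from which all others follow: the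
  polynomials and the dominating functions below are bounded on the support by a multiple of this
  exponential.\<close>

locale log_gas =
  fixes \<beta> :: real and m :: nat and c :: real and w :: "real \<Rightarrow> real" and I :: "real set"
    and P :: "(nat \<Rightarrow> real) measure"
  assumes c_nonneg: "c \<ge> 0" and w_measurable [measurable]: "w \<in> borel_measurable borel"
    and w_nonneg: "\<And>x. x \<in> I \<Longrightarrow> w x \<ge> 0"
    and I_measurable [measurable]: "I \<in> sets borel" and I_nonneg: "I \<subseteq> {0..}"
    and P_def: "P = density (PiM {1..m} (\<lambda>_. lborel)) (\<lambda>x. ennreal (log_gas_density \<beta> m c w I x))"
    and prob: "prob_space P"
    and exp_moment: "\<exists>\<delta>>0. integrable P (\<lambda>x. exp (\<delta> * power_sum m 1 x))"
begin

abbreviation "L \<equiv> PiM {1..m} (\<lambda>_. lborel :: real measure)"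

abbreviation "S k \<equiv> power_sum m k"

lemma density_measurable [measurable]: "log_gas_density \<beta> m c w I \<in> borel_measurable L"
  by (rule log_gas_density_measurable) measurable

lemma sets_P [measurable_cong]: "sets P = sets L"
  by (simp add: P_def)

sublocale prob_space P by (fact prob)

definition supp :: "(nat \<Rightarrow> real) set" where "supp = {x. \<forall>i\<in>{1..m}. x i \<in> I}"

lemma supp_I: "x \<in> supp \<Longrightarrow> i \<in> {1..m} \<Longrightarrow> x i \<in> I"
  by (auto simp: supp_def)

lemma supp_nonneg: "x \<in> supp \<Longrightarrow> i \<in> {1..m} \<Longrightarrow> 0 \<le> x i"
  using I_nonneg supp_I by force

lemma AE_supp: "AE x in P. x \<in> supp"
proof -
  have m: "(\<lambda>x. ennreal (log_gas_density \<beta> m c w I x)) \<in> borel_measurable L" by measurable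
  show ?thesis
    unfolding P_def AE_density[OF m] by (auto simp: log_gas_density_def supp_def intro!: AE_I2)
qed

lemma power_sum_nonneg: "x \<in> supp \<Longrightarrow> 0 \<le> S k x"
  unfolding power_sum_def by (intro sum_nonneg zero_le_power) (auto intro: supp_nonneg)

text \<open>The Radon-Nikodym factor of a coordinatewise map T: \<open>\<rho>\<close> plays the role
  of w(T x) T'(x) / w(x), and \<open>q\<close> that of the divided difference of T. They are
  supplied as separate functions because these quotients are undefined where w or x - y
  vanishes.\<close>

definition flow_weight :: "(real \<Rightarrow> real) \<Rightarrow> (real \<Rightarrow> real \<Rightarrow> real) \<Rightarrow> (nat \<Rightarrow> real) \<Rightarrow> real" where
  "flow_weight \<rho> q x = (\<Prod>i=1..m. \<rho> (x i)) * (\<Prod>(i, j)\<in>index_pairs m. q (x i) (x j) powr \<beta>)"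

lemma flow_weight_measurable [measurable]:
  assumes [measurable]: "\<rho> \<in> borel_measurable borel" "case_prod q \<in> borel_measurable (borel \<Otimes>\<^sub>M borel)"
  shows "flow_weight \<rho> q \<in> borel_measurable L"
proof -
  have [measurable]: "(\<lambda>x. \<Prod>(i, j)\<in>index_pairs m. q (x i) (x j) powr \<beta>) \<in> borel_measurable L"
    by (rule prod_index_pairs_measurable) measurable
  show ?thesis unfolding flow_weight_def by measurable
qed

text \<open>Substitution y = T x: the one-body factors produce \<open>\<rho>\<close>, the
  differences of coordinates produce \<open>q\<close>, and together they turn the density at T x
  times the Jacobian into \<open>flow_weight\<close> times the density at x. No division occurs, so
  coinciding coordinates and endpoints are covered.\<close>

lemma distr_flow:
  assumes [measurable]: "T \<in> borel_measurable borel" "T' \<in> borel_measurable borel"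
      "\<rho> \<in> borel_measurable borel" "case_prod q \<in> borel_measurable (borel \<Otimes>\<^sub>M borel)"
    and one: "\<And>A. A \<in> sets borel \<Longrightarrow>
      (\<integral>\<^sup>+x. ennreal (T' x) * indicator I x * indicator A (T x) \<partial>lborel) = (\<integral>\<^sup>+y. indicator I y * indicator A y \<partial>lborel)"
    and TI: "\<And>x. x \<in> I \<Longrightarrow> T x \<in> I" and T'_nonneg: "\<And>x. x \<in> I \<Longrightarrow> T' x \<ge> 0"
    and \<rho>: "\<And>x. x \<in> I \<Longrightarrow> w (T x) * T' x = \<rho> x * w x" "\<And>x. x \<in> I \<Longrightarrow> \<rho> x \<ge> 0"
    and q: "\<And>x y. x \<in> I \<Longrightarrow> y \<in> I \<Longrightarrow> T x - T y = (x - y) * q x y" "\<And>x y. x \<in> I \<Longrightarrow> y \<in> I \<Longrightarrow> q x y \<ge> 0"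
  shows "P = distr (density P (\<lambda>x. ennreal (flow_weight \<rho> q x))) P (\<lambda>x. \<lambda>i\<in>{1..m}. T (x i))"
    (is "_ = distr ?D P ?T")
proof (rule measure_eqI)
  fix A assume "A \<in> sets P"
  then have [measurable]: "A \<in> sets L" by (simp add: sets_P)
  let ?f = "log_gas_density \<beta> m c w I"
  \<comment> \<open>Outside the support both sides vanish, on the left through an indicator and on
    the right through the density.\<close>
  have key: "ennreal (?f (?T x)) * (\<Prod>i\<in>{1..m}. ennreal (T' (x i)) * indicator I (x i)) =
      ennreal (?f x) * ennreal (flow_weight \<rho> q x)" for x
  proof (cases "x \<in> supp")
    case True
    note xI = supp_I[OF True]
    have "(\<Prod>i\<in>{1..m}. ennreal (T' (x i)) * indicator I (x i)) = ennreal (\<Prod>i=1..m. T' (x i))"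
      using xI T'_nonneg by (subst prod_ennreal[symmetric]) (auto intro!: prod.cong)
    moreover have "?f (?T x) * (\<Prod>i=1..m. T' (x i)) = ?f x * flow_weight \<rho> q x"
    proof -
      have 1: "?f (?T x) = c * (\<Prod>(i, j)\<in>index_pairs m. \<bar>T (x i) - T (x j)\<bar> powr \<beta>) * (\<Prod>i=1..m. w (T (x i)))"
        using xI TI
        by (auto simp: log_gas_density_def index_pairs_def intro!: prod.cong)
      have 2: "(\<Prod>(i, j)\<in>index_pairs m. \<bar>T (x i) - T (x j)\<bar> powr \<beta>) =
        (\<Prod>(i, j)\<in>index_pairs m. \<bar>x i - x j\<bar> powr \<beta>) * (\<Prod>(i, j)\<in>index_pairs m. q (x i) (x j) powr \<beta>)"
      proof (subst prod.distrib[symmetric], rule prod.cong[OF refl], clarify)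
        fix i j assume "(i, j) \<in> index_pairs m"
        then have "x i \<in> I" "x j \<in> I" using xI by (auto simp: index_pairs_def)
        then show "\<bar>T (x i) - T (x j)\<bar> powr \<beta> = \<bar>x i - x j\<bar> powr \<beta> * q (x i) (x j) powr \<beta>"
          using q by (simp add: abs_mult powr_mult)
      qed
      have 3: "(\<Prod>i=1..m. w (T (x i))) * (\<Prod>i=1..m. T' (x i)) = (\<Prod>i=1..m. \<rho> (x i)) * (\<Prod>i=1..m. w (x i))"
        unfolding prod.distrib[symmetric] using \<rho> xI by (intro prod.cong) auto
      have 4: "?f x = c * (\<Prod>(i, j)\<in>index_pairs m. \<bar>x i - x j\<bar> powr \<beta>) * (\<Prod>i=1..m. w (x i))"
        using xI by (auto simp: log_gas_density_def)
      have "?f (?T x) * (\<Prod>i=1..m. T' (x i)) = c * (\<Prod>(i, j)\<in>index_pairs m. \<bar>T (x i) - T (x j)\<bar> powr \<beta>)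
         * ((\<Prod>i=1..m. w (T (x i))) * (\<Prod>i=1..m. T' (x i)))"
        by (simp only: 1 mult.assoc)
      then show ?thesis unfolding 2 3 4 flow_weight_def by (simp only: ac_simps)
    qed
    moreover have "0 \<le> flow_weight \<rho> q x"
      unfolding flow_weight_def using xI \<rho>(2) by (intro mult_nonneg_nonneg prod_nonneg) auto
    moreover have "0 \<le> (\<Prod>i=1..m. T' (x i))"
      using xI T'_nonneg by (intro prod_nonneg) auto
    ultimately show ?thesis by (simp add: ennreal_mult''[symmetric])
  next
    case False
    then obtain i where "i \<in> {1..m}" "x i \<notin> I" by (auto simp: supp_def)
    then have "(\<Prod>i\<in>{1..m}. ennreal (T' (x i)) * indicator I (x i)) = 0" "?f x = 0"
      by (auto intro!: prod_zero bexI[of _ i] simp: log_gas_density_def)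
    then show ?thesis by simp
  qed
  have fI: "ennreal (?f y) * (\<Prod>i\<in>{1..m}. indicator I (y i)) = ennreal (?f y)" for y
    by (auto simp: log_gas_density_def indicator_def)
  have "emeasure P A = (\<integral>\<^sup>+y. ennreal (?f y) * indicator A y \<partial>L)"
    by (simp add: P_def emeasure_density)
  also have "\<dots> = (\<integral>\<^sup>+y. (ennreal (?f y) * indicator A y) * (\<Prod>i\<in>{1..m}. indicator I (y i)) \<partial>L)"
    by (intro nn_integral_cong) (subst fI[symmetric], simp only: ac_simps)
  also have "\<dots> = (\<integral>\<^sup>+x. (ennreal (?f (?T x)) * indicator A (?T x)) * (\<Prod>i\<in>{1..m}. ennreal (T' (x i)) * indicator I (x i)) \<partial>L)"
    by (rule nn_integral_PiM_lborel_subst[OF _ _ _ _ _ _ one]) auto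
  also have "\<dots> = (\<integral>\<^sup>+x. ennreal (?f x) * (ennreal (flow_weight \<rho> q x) * indicator A (?T x)) \<partial>L)"
  proof (intro nn_integral_cong)
    fix x
    show "(ennreal (?f (?T x)) * indicator A (?T x)) * (\<Prod>i\<in>{1..m}. ennreal (T' (x i)) * indicator I (x i)) =
      ennreal (?f x) * (ennreal (flow_weight \<rho> q x) * indicator A (?T x))"
      using key[of x] by (simp add: ac_simps)
  qed
  also have "\<dots> = (\<integral>\<^sup>+x. ennreal (flow_weight \<rho> q x) * indicator A (?T x) \<partial>P)"
    unfolding P_def by (subst nn_integral_density) auto
  also have "\<dots> = (\<integral>\<^sup>+x. indicator A x \<partial>distr ?D P ?T)"
    by (subst nn_integral_distr) (auto simp: nn_integral_density sets_P cong: measurable_cong_sets)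
  also have "\<dots> = emeasure (distr ?D P ?T) A"
    by (subst nn_integral_indicator) (auto simp: sets_P)
  finally show "emeasure P A = emeasure (distr ?D P ?T) A" .
qed simp

lemma integral_flow:
  fixes h :: "(nat \<Rightarrow> real) \<Rightarrow> real"
  assumes [measurable]: "T \<in> borel_measurable borel" "T' \<in> borel_measurable borel"
      "\<rho> \<in> borel_measurable borel" "case_prod q \<in> borel_measurable (borel \<Otimes>\<^sub>M borel)" "h \<in> borel_measurable L"
    and one: "\<And>A. A \<in> sets borel \<Longrightarrow>
      (\<integral>\<^sup>+x. ennreal (T' x) * indicator I x * indicator A (T x) \<partial>lborel) = (\<integral>\<^sup>+y. indicator I y * indicator A y \<partial>lborel)"
    and TI: "\<And>x. x \<in> I \<Longrightarrow> T x \<in> I" and T'_nonneg: "\<And>x. x \<in> I \<Longrightarrow> T' x \<ge> 0"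
    and \<rho>: "\<And>x. x \<in> I \<Longrightarrow> w (T x) * T' x = \<rho> x * w x" "\<And>x. x \<in> I \<Longrightarrow> \<rho> x \<ge> 0"
    and q: "\<And>x y. x \<in> I \<Longrightarrow> y \<in> I \<Longrightarrow> T x - T y = (x - y) * q x y" "\<And>x y. x \<in> I \<Longrightarrow> y \<in> I \<Longrightarrow> q x y \<ge> 0"
  shows "(\<integral>x. h x \<partial>P) = (\<integral>x. flow_weight \<rho> q x * h (\<lambda>i\<in>{1..m}. T (x i)) \<partial>P)"
proof -
  have [measurable]: "(\<lambda>x. \<lambda>i\<in>{1..m}. T (x i)) \<in> measurable P P"
    by (simp add: sets_P cong: measurable_cong_sets)
  have [measurable]: "h \<in> borel_measurable P" "flow_weight \<rho> q \<in> borel_measurable P"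
    by (simp_all add: sets_P cong: measurable_cong_sets)
  have "AE x in P. 0 \<le> flow_weight \<rho> q x"
    using AE_supp
  proof eventually_elim
    case (elim x)
    show ?case
      unfolding flow_weight_def using supp_I[OF elim] \<rho>(2) by (intro mult_nonneg_nonneg prod_nonneg) auto
  qed
  have "(\<integral>x. h x \<partial>P) = (\<integral>x. h x \<partial>distr (density P (\<lambda>x. ennreal (flow_weight \<rho> q x))) P (\<lambda>x. \<lambda>i\<in>{1..m}. T (x i)))"
    using distr_flow[OF assms(1-4) one TI T'_nonneg \<rho> q] by simp
  also have "\<dots> = (\<integral>x. h (\<lambda>i\<in>{1..m}. T (x i)) \<partial>density P (\<lambda>x. ennreal (flow_weight \<rho> q x)))"
    by (subst integral_distr) auto
  also have "\<dots> = (\<integral>x. flow_weight \<rho> q x * h (\<lambda>i\<in>{1..m}. T (x i)) \<partial>P)"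
    by (subst integral_density) (auto, fact)
  finally show ?thesis .
qed

end

lemma tendsto_difference_quotient:
  fixes f :: "real \<Rightarrow> real"
  assumes "(f has_real_derivative D) (at 0)"
  shows "((\<lambda>t. (f t - f 0) / t) \<longlongrightarrow> D) (at_right 0)"
  using assms unfolding DERIV_def by (auto intro: tendsto_mono[OF at_le])

text \<open>Mean value theorem in s. The derivative contains the power \<gamma> - 1 of a base
  between 1/2 and 1 + |u|. For \<gamma> \<ge> 1 the upper end of this range controls it, otherwise
  the lower end; the base 2 (1 + |u|) with exponent |\<gamma>| + 1 serves both cases.\<close>

lemma powr_diff_one_bound:
  fixes u \<gamma> s :: real
  assumes "0 \<le> s" "s \<le> 1" "1 + s * u \<ge> 1 / 2"
  shows "\<bar>(1 + s * u) powr \<gamma> - 1\<bar> \<le> s * (\<bar>u\<bar> * \<bar>\<gamma>\<bar> * (2 * (1 + \<bar>u\<bar>)) powr (\<bar>\<gamma>\<bar> + 1))"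
proof (cases "s = 0")
  case False
  then have s: "0 < s" using assms by simp
  have pos: "1 + z * u \<ge> 1 / 2" "1 + z * u \<le> 1 + \<bar>u\<bar>" if z: "0 \<le> z" "z \<le> s" for z
  proof -
    show "1 + z * u \<ge> 1 / 2"
    proof (cases "u \<ge> 0")
      case True then have "0 \<le> z * u" using z by simp
      then show ?thesis by linarith
    next
      case False
      then have "s * u \<le> z * u" using z by (intro mult_right_mono_neg) auto
      then show ?thesis using assms by linarith
    qed
    have "z * u \<le> z * \<bar>u\<bar>" using z by (intro mult_left_mono) auto
    also have "\<dots> \<le> 1 * \<bar>u\<bar>" using z assms by (intro mult_right_mono) auto
    finally show "1 + z * u \<le> 1 + \<bar>u\<bar>" by simp
  qed
  have "\<exists>z>0. z < s \<and> (1 + s * u) powr \<gamma> - (1 + 0 * u) powr \<gamma> = (s - 0) * (\<gamma> * (1 + z * u) powr (\<gamma> - 1) * u)"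
  proof (rule MVT2[OF s])
    fix z assume z: "0 \<le> z" "z \<le> s"
    show "((\<lambda>s. (1 + s * u) powr \<gamma>) has_real_derivative \<gamma> * (1 + z * u) powr (\<gamma> - 1) * u) (at z)"
      using pos[OF z] by (auto intro!: derivative_eq_intros simp: powr_diff field_simps)
  qed
  then obtain z where z: "0 < z" "z < s"
    and eq: "(1 + s * u) powr \<gamma> - 1 = s * (\<gamma> * (1 + z * u) powr (\<gamma> - 1) * u)" by auto
  have b: "(1 + z * u) powr (\<gamma> - 1) \<le> (2 * (1 + \<bar>u\<bar>)) powr (\<bar>\<gamma>\<bar> + 1)"
  proof (cases "\<gamma> \<ge> 1")
    case True
    have "(1 + z * u) powr (\<gamma> - 1) \<le> (2 * (1 + \<bar>u\<bar>)) powr (\<gamma> - 1)"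
      using pos[of z] z True by (intro powr_mono2) auto
    also have "\<dots> \<le> (2 * (1 + \<bar>u\<bar>)) powr (\<bar>\<gamma>\<bar> + 1)" by (intro powr_mono) auto
    finally show ?thesis .
  next
    case False
    have "(1 + z * u) powr (\<gamma> - 1) \<le> (1 / 2) powr (\<gamma> - 1)"
      using pos[of z] z False by (intro powr_mono2') auto
    also have "\<dots> = 2 powr (1 - \<gamma>)"
      by (simp add: powr_divide powr_minus_divide[symmetric])
    also have "\<dots> \<le> (2 * (1 + \<bar>u\<bar>)) powr (1 - \<gamma>)"
      using False by (intro powr_mono2) auto
    also have "\<dots> \<le> (2 * (1 + \<bar>u\<bar>)) powr (\<bar>\<gamma>\<bar> + 1)" by (intro powr_mono) auto
    finally show ?thesis .
  qed
  have "\<bar>(1 + s * u) powr \<gamma> - 1\<bar> = s * (\<bar>u\<bar> * \<bar>\<gamma>\<bar> * (1 + z * u) powr (\<gamma> - 1))"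
    unfolding eq using s by (simp add: abs_mult)
  also have "\<dots> \<le> s * (\<bar>u\<bar> * \<bar>\<gamma>\<bar> * (2 * (1 + \<bar>u\<bar>)) powr (\<bar>\<gamma>\<bar> + 1))"
    using s b by (intro mult_left_mono) auto
  finally show ?thesis .
qed simp

section \<open>Dominated functions and right derivatives along a flow\<close>

context log_gas
begin

text \<open>The dominating functions for dominated convergence. On \<open>[0, 1]\<^sup>m\<close> these are the bounded functions;
  asking for every \<open>\<epsilon>\<close> makes the class closed under products and powers.\<close>

definition subexp :: "((nat \<Rightarrow> real) \<Rightarrow> real) \<Rightarrow> bool" where
  "subexp h \<longleftrightarrow> (\<forall>\<epsilon>>0. \<exists>C. \<forall>x\<in>supp. \<bar>h x\<bar> \<le> C * exp (\<epsilon> * S 1 x))"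

lemma subexpD:
  assumes "subexp h" "\<epsilon> > 0"
  shows "\<exists>C\<ge>0. \<forall>x\<in>supp. \<bar>h x\<bar> \<le> C * exp (\<epsilon> * S 1 x)"
proof -
  obtain C where C: "\<And>x. x \<in> supp \<Longrightarrow> \<bar>h x\<bar> \<le> C * exp (\<epsilon> * S 1 x)"
    using assms unfolding subexp_def by blast
  have "\<bar>h x\<bar> \<le> max C 0 * exp (\<epsilon> * S 1 x)" if "x \<in> supp" for x
    using C[OF that] by (rule order_trans) (intro mult_right_mono, auto)
  then show ?thesis by (intro exI[of _ "max C 0"]) auto
qed

lemma subexp_mono:
  assumes "subexp g" "\<And>x. x \<in> supp \<Longrightarrow> \<bar>h x\<bar> \<le> \<bar>g x\<bar>"
  shows "subexp h"
  using assms unfolding subexp_def by (meson order_trans)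

lemma subexp_const: "subexp (\<lambda>x. k)"
  unfolding subexp_def
proof (intro allI impI)
  fix \<epsilon> :: real assume e: "\<epsilon> > 0"
  have "\<bar>k\<bar> * 1 \<le> \<bar>k\<bar> * exp (\<epsilon> * S 1 x)" if "x \<in> supp" for x
    using power_sum_nonneg[OF that] e by (intro mult_left_mono) auto
  then show "\<exists>C. \<forall>x\<in>supp. \<bar>k\<bar> \<le> C * exp (\<epsilon> * S 1 x)" by (intro exI[of _ "\<bar>k\<bar>"]) auto
qed

lemma subexp_add:
  assumes "subexp g" "subexp h"
  shows "subexp (\<lambda>x. g x + h x)"
  unfolding subexp_def
proof (intro allI impI)
  fix \<epsilon> :: real assume e: "\<epsilon> > 0"
  obtain C where C: "C \<ge> 0" "\<And>x. x \<in> supp \<Longrightarrow> \<bar>g x\<bar> \<le> C * exp (\<epsilon> * S 1 x)" using subexpD[OF assms(1) e] by blast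
  obtain C' where C': "C' \<ge> 0" "\<And>x. x \<in> supp \<Longrightarrow> \<bar>h x\<bar> \<le> C' * exp (\<epsilon> * S 1 x)" using subexpD[OF assms(2) e] by blast
  have "\<bar>g x + h x\<bar> \<le> (C + C') * exp (\<epsilon> * S 1 x)" if "x \<in> supp" for x
    using C(2)[OF that] C'(2)[OF that] by (simp add: distrib_right)
  then show "\<exists>C. \<forall>x\<in>supp. \<bar>g x + h x\<bar> \<le> C * exp (\<epsilon> * S 1 x)" by blast
qed

lemma subexp_mult:
  assumes "subexp g" "subexp h"
  shows "subexp (\<lambda>x. g x * h x)"
  unfolding subexp_def
proof (intro allI impI)
  fix \<epsilon> :: real assume "\<epsilon> > 0"
  then have e: "\<epsilon> / 2 > 0" by simp
  obtain C where C: "C \<ge> 0" "\<And>x. x \<in> supp \<Longrightarrow> \<bar>g x\<bar> \<le> C * exp (\<epsilon> / 2 * S 1 x)" using subexpD[OF assms(1) e] by blast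
  obtain C' where C': "C' \<ge> 0" "\<And>x. x \<in> supp \<Longrightarrow> \<bar>h x\<bar> \<le> C' * exp (\<epsilon> / 2 * S 1 x)" using subexpD[OF assms(2) e] by blast
  have "\<bar>g x * h x\<bar> \<le> (C * C') * exp (\<epsilon> * S 1 x)" if "x \<in> supp" for x
  proof -
    have "\<bar>g x * h x\<bar> \<le> (C * exp (\<epsilon> / 2 * S 1 x)) * (C' * exp (\<epsilon> / 2 * S 1 x))"
      unfolding abs_mult using C C' that by (intro mult_mono) auto
    also have "\<dots> = (C * C') * exp (\<epsilon> * S 1 x)"
      by (simp add: exp_add[symmetric] ac_simps)
    finally show ?thesis .
  qed
  then show "\<exists>C. \<forall>x\<in>supp. \<bar>g x * h x\<bar> \<le> C * exp (\<epsilon> * S 1 x)" by blast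
qed

lemma subexp_sum:
  assumes "\<And>i. i \<in> A \<Longrightarrow> subexp (g i)"
  shows "subexp (\<lambda>x. \<Sum>i\<in>A. g i x)"
  using assms by (induction A rule: infinite_finite_induct) (auto intro: subexp_const subexp_add)

lemma subexp_power:
  assumes "subexp g"
  shows "subexp (\<lambda>x. g x ^ n)"
  using assms by (induction n) (auto intro: subexp_const subexp_mult)

lemma subexp_abs: "subexp g \<Longrightarrow> subexp (\<lambda>x. \<bar>g x\<bar>)"
  by (erule subexp_mono) simp

lemma subexp_cmult: "subexp g \<Longrightarrow> subexp (\<lambda>x. k * g x)"
  by (intro subexp_mult subexp_const)

lemma subexp_minus: "subexp g \<Longrightarrow> subexp (\<lambda>x. - g x)"
  by (erule subexp_mono) simp

lemma subexp_diff: "subexp g \<Longrightarrow> subexp h \<Longrightarrow> subexp (\<lambda>x. g x - h x)"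
  using subexp_add[of g "\<lambda>x. - h x"] subexp_minus[of h] by simp

lemma subexp_powr:
  assumes g: "subexp g" and nonneg: "\<And>x. x \<in> supp \<Longrightarrow> g x \<ge> 0" and "\<gamma> > 0"
  shows "subexp (\<lambda>x. g x powr \<gamma>)"
  unfolding subexp_def
proof (intro allI impI)
  fix \<epsilon> :: real assume "\<epsilon> > 0"
  then have e: "\<epsilon> / \<gamma> > 0" using assms by simp
  obtain C where C: "C \<ge> 0" "\<And>x. x \<in> supp \<Longrightarrow> \<bar>g x\<bar> \<le> C * exp (\<epsilon> / \<gamma> * S 1 x)" using subexpD[OF g e] by blast
  have "\<bar>g x powr \<gamma>\<bar> \<le> C powr \<gamma> * exp (\<epsilon> * S 1 x)" if "x \<in> supp" for x
  proof -
    have "g x powr \<gamma> \<le> (C * exp (\<epsilon> / \<gamma> * S 1 x)) powr \<gamma>"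
      using C(2)[OF that] nonneg[OF that] assms by (intro powr_mono2) auto
    also have "\<dots> = C powr \<gamma> * exp (\<epsilon> * S 1 x)"
      using C assms by (simp add: powr_mult exp_powr_real)
    finally show ?thesis by simp
  qed
  then show "\<exists>C. \<forall>x\<in>supp. \<bar>g x powr \<gamma>\<bar> \<le> C * exp (\<epsilon> * S 1 x)" by blast
qed

lemma subexp_power_sum_1: "subexp (S 1)"
  unfolding subexp_def
proof (intro allI impI)
  fix \<epsilon> :: real assume e: "\<epsilon> > 0"
  have "\<bar>S 1 x\<bar> \<le> 1 / \<epsilon> * exp (\<epsilon> * S 1 x)" if "x \<in> supp" for x
  proof -
    have "\<epsilon> * S 1 x \<le> exp (\<epsilon> * S 1 x)" using exp_ge_add_one_self[of "\<epsilon> * S 1 x"] by linarith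
    then show ?thesis using power_sum_nonneg[OF that, of 1] e by (simp add: field_simps)
  qed
  then show "\<exists>C. \<forall>x\<in>supp. \<bar>S 1 x\<bar> \<le> C * exp (\<epsilon> * S 1 x)" by blast
qed

lemma component_le_power_sum:
  assumes "x \<in> supp" "i \<in> {1..m}"
  shows "x i \<le> S 1 x"
  unfolding power_sum_def using assms supp_nonneg
  by (simp, intro member_le_sum) auto

lemma subexp_component: "i \<in> {1..m} \<Longrightarrow> subexp (\<lambda>x. x i)"
  using subexp_power_sum_1
  by (rule subexp_mono) (use component_le_power_sum supp_nonneg power_sum_nonneg in force)

lemma subexp_power_sum: "subexp (S k)"
  unfolding power_sum_def by (intro subexp_sum subexp_power subexp_component)

text \<open>The growth bound holds at every rate, in particular at the one rate for which an
  exponential moment is known.\<close>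

lemma integrable_subexp:
  assumes [measurable]: "h \<in> borel_measurable L" and "subexp h"
  shows "integrable P h"
proof -
  obtain \<delta> where \<delta>: "\<delta> > 0" "integrable P (\<lambda>x. exp (\<delta> * S 1 x))" using exp_moment by auto
  obtain C where C: "C \<ge> 0" "\<And>x. x \<in> supp \<Longrightarrow> \<bar>h x\<bar> \<le> C * exp (\<delta> * S 1 x)" using subexpD[OF assms(2) \<delta>(1)] by blast
  show ?thesis
  proof (rule Bochner_Integration.integrable_bound)
    show "integrable P (\<lambda>x. C * exp (\<delta> * S 1 x))" using \<delta> by simp
    show "h \<in> borel_measurable P" by (simp add: sets_P cong: measurable_cong_sets)
    show "AE x in P. norm (h x) \<le> norm (C * exp (\<delta> * S 1 x))"
      using AE_supp by eventually_elim (use C in auto)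
  qed
qed

text \<open>\<open>u'\<close> is the right derivative at \<open>t = 0\<close> of \<open>t \<mapsto> u t\<close>, whose value at 0 is \<open>u0\<close> (not \<open>u 0\<close>), with
  difference quotients dominated by a subexponential \<open>G\<close>.\<close>

definition flow_deriv ::
    "real \<Rightarrow> (real \<Rightarrow> (nat \<Rightarrow> real) \<Rightarrow> real) \<Rightarrow> ((nat \<Rightarrow> real) \<Rightarrow> real) \<Rightarrow> ((nat \<Rightarrow> real) \<Rightarrow> real) \<Rightarrow> bool" where
  "flow_deriv t0 u u0 u' \<longleftrightarrow>
     (\<forall>t\<in>{0<..t0}. u t \<in> borel_measurable L) \<and> u0 \<in> borel_measurable L \<and> u' \<in> borel_measurable L \<and> subexp u0 \<and>
     (\<exists>G. subexp G \<and> (\<forall>t\<in>{0<..t0}. \<forall>x\<in>supp. \<bar>u t x - u0 x\<bar> \<le> t * G x)) \<and>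
     (\<forall>x\<in>supp. ((\<lambda>t. (u t x - u0 x) / t) \<longlongrightarrow> u' x) (at_right 0))"

lemma flow_deriv_const:
  assumes "k \<in> borel_measurable L" "subexp k"
  shows "flow_deriv t0 (\<lambda>t. k) k (\<lambda>x. 0)"
  using assms unfolding flow_deriv_def by (auto intro!: exI[of _ "\<lambda>x. 0"] subexp_const)

lemma flow_deriv_add:
  assumes "flow_deriv t0 u u0 u'" "flow_deriv t0 v v0 v'"
  shows "flow_deriv t0 (\<lambda>t x. u t x + v t x) (\<lambda>x. u0 x + v0 x) (\<lambda>x. u' x + v' x)"
proof -
  from assms obtain G H where G: "subexp G" "\<And>t x. t \<in> {0<..t0} \<Longrightarrow> x \<in> supp \<Longrightarrow> \<bar>u t x - u0 x\<bar> \<le> t * G x"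
     and H: "subexp H" "\<And>t x. t \<in> {0<..t0} \<Longrightarrow> x \<in> supp \<Longrightarrow> \<bar>v t x - v0 x\<bar> \<le> t * H x"
    unfolding flow_deriv_def by meson
  have "\<bar>u t x + v t x - (u0 x + v0 x)\<bar> \<le> t * (G x + H x)" if "t \<in> {0<..t0}" "x \<in> supp" for t x
    using G(2)[OF that] H(2)[OF that] by (simp add: distrib_left)
  moreover have "((\<lambda>t. (u t x + v t x - (u0 x + v0 x)) / t) \<longlongrightarrow> u' x + v' x) (at_right 0)" if "x \<in> supp" for x
  proof -
    have "((\<lambda>t. (u t x - u0 x) / t + (v t x - v0 x) / t) \<longlongrightarrow> u' x + v' x) (at_right 0)"
      using assms that by (intro tendsto_add) (auto simp: flow_deriv_def)
    then show ?thesis by (simp add: add_divide_distrib[symmetric] algebra_simps)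
  qed
  ultimately show ?thesis
    using assms subexp_add[OF G(1) H(1)] unfolding flow_deriv_def
    by (auto intro!: subexp_add borel_measurable_add exI[of _ "\<lambda>x. G x + H x"])
qed

lemma flow_deriv_tendsto:
  assumes "flow_deriv t0 u u0 u'" "t0 > 0" "x \<in> supp"
  shows "((\<lambda>t. u t x) \<longlongrightarrow> u0 x) (at_right 0)"
proof -
  have "((\<lambda>t. u0 x + t * ((u t x - u0 x) / t)) \<longlongrightarrow> u0 x + 0 * u' x) (at_right 0)"
    using assms unfolding flow_deriv_def by (intro tendsto_intros) auto
  moreover have "\<forall>\<^sub>F t in at_right 0. u0 x + t * ((u t x - u0 x) / t) = u t x"
    by (auto simp: eventually_at_filter)
  ultimately show ?thesis by (simp add: tendsto_cong)
qed

lemma flow_deriv_mult: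
  assumes uv: "flow_deriv t0 u u0 u'" "flow_deriv t0 v v0 v'" and t0: "t0 > 0"
  shows "flow_deriv t0 (\<lambda>t x. u t x * v t x) (\<lambda>x. u0 x * v0 x) (\<lambda>x. u' x * v0 x + u0 x * v' x)"
proof -
  from assms obtain G H where G: "subexp G" "\<And>t x. t \<in> {0<..t0} \<Longrightarrow> x \<in> supp \<Longrightarrow> \<bar>u t x - u0 x\<bar> \<le> t * G x"
     and H: "subexp H" "\<And>t x. t \<in> {0<..t0} \<Longrightarrow> x \<in> supp \<Longrightarrow> \<bar>v t x - v0 x\<bar> \<le> t * H x"
    unfolding flow_deriv_def by meson
  have sub: "subexp u0" "subexp v0" using uv by (auto simp: flow_deriv_def)
  \<comment> \<open>The factor \<open>v t\<close> is replaced by its value at 0 plus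
    \<open>t0 * \<bar>H x\<bar>\<close>; here t \<le> t0 makes the bound free of t.\<close>
  let ?B = "\<lambda>x. \<bar>G x\<bar> * (\<bar>v0 x\<bar> + t0 * \<bar>H x\<bar>) + \<bar>u0 x\<bar> * \<bar>H x\<bar>"
  have "\<bar>u t x * v t x - u0 x * v0 x\<bar> \<le> t * ?B x" if tx: "t \<in> {0<..t0}" "x \<in> supp" for t x
  proof -
    have t: "0 < t" "t \<le> t0" using tx by auto
    have 1: "\<bar>u t x - u0 x\<bar> \<le> t * \<bar>G x\<bar>" "\<bar>v t x - v0 x\<bar> \<le> t * \<bar>H x\<bar>"
      using G(2)[OF tx] H(2)[OF tx] t by (meson abs_ge_self mult_left_mono order_trans less_imp_le)+
    have "t * \<bar>H x\<bar> \<le> t0 * \<bar>H x\<bar>" using t by (intro mult_right_mono) auto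
    then have 2: "\<bar>v t x\<bar> \<le> \<bar>v0 x\<bar> + t0 * \<bar>H x\<bar>" using 1(2) by linarith
    have "\<bar>u t x * v t x - u0 x * v0 x\<bar> = \<bar>(u t x - u0 x) * v t x + u0 x * (v t x - v0 x)\<bar>"
      by (simp add: algebra_simps)
    also have "\<dots> \<le> \<bar>u t x - u0 x\<bar> * \<bar>v t x\<bar> + \<bar>u0 x\<bar> * \<bar>v t x - v0 x\<bar>"
      by (metis abs_mult abs_triangle_ineq)
    also have "\<dots> \<le> (t * \<bar>G x\<bar>) * (\<bar>v0 x\<bar> + t0 * \<bar>H x\<bar>) + \<bar>u0 x\<bar> * (t * \<bar>H x\<bar>)"
      using 1 2 by (intro add_mono mult_mono) auto
    finally show ?thesis by (simp add: algebra_simps)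
  qed
  moreover have "subexp ?B"
    by (intro subexp_add subexp_mult subexp_abs subexp_cmult G H sub)
  moreover have "((\<lambda>t. (u t x * v t x - u0 x * v0 x) / t) \<longlongrightarrow> u' x * v0 x + u0 x * v' x) (at_right 0)" if x: "x \<in> supp" for x
  proof -
    have "((\<lambda>t. (u t x - u0 x) / t * v t x + u0 x * ((v t x - v0 x) / t)) \<longlongrightarrow> u' x * v0 x + u0 x * v' x) (at_right 0)"
      using uv x by (intro tendsto_intros flow_deriv_tendsto[OF uv(2) t0 x]) (auto simp: flow_deriv_def)
    then show ?thesis by (simp add: add_divide_distrib[symmetric] algebra_simps)
  qed
  ultimately show ?thesis
    using uv subexp_mult[OF sub] unfolding flow_deriv_def
    by (auto intro!: borel_measurable_add borel_measurable_times exI[of _ ?B])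
qed

lemma flow_deriv_sum:
  assumes "\<And>i. i \<in> A \<Longrightarrow> flow_deriv t0 (u i) (u0 i) (u' i)"
  shows "flow_deriv t0 (\<lambda>t x. \<Sum>i\<in>A. u i t x) (\<lambda>x. \<Sum>i\<in>A. u0 i x) (\<lambda>x. \<Sum>i\<in>A. u' i x)"
  using assms
proof (induction A rule: infinite_finite_induct)
  case (insert i A)
  then show ?case using flow_deriv_add[of t0 "u i" "u0 i" "u' i"] by simp
qed (auto intro: flow_deriv_const subexp_const)

lemma flow_deriv_prod:
  assumes "\<And>i. i \<in> A \<Longrightarrow> flow_deriv t0 (u i) (\<lambda>x. 1) (u' i)" and "t0 > 0"
  shows "flow_deriv t0 (\<lambda>t x. \<Prod>i\<in>A. u i t x) (\<lambda>x. 1) (\<lambda>x. \<Sum>i\<in>A. u' i x)"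
  using assms(1)
proof (induction A rule: infinite_finite_induct)
  case (insert i A)
  then show ?case using flow_deriv_mult[of t0 "u i" "\<lambda>x. 1" "u' i" "\<lambda>t x. \<Prod>i\<in>A. u i t x" "\<lambda>x. 1" "\<lambda>x. \<Sum>i\<in>A. u' i x"] assms(2)
    by simp
qed (auto intro: flow_deriv_const subexp_const)

lemma flow_deriv_cmult:
  assumes "flow_deriv t0 u u0 u'" "t0 > 0"
  shows "flow_deriv t0 (\<lambda>t x. k * u t x) (\<lambda>x. k * u0 x) (\<lambda>x. k * u' x)"
  using flow_deriv_mult[OF flow_deriv_const[of "\<lambda>x. k"] assms] subexp_const by simp

lemma flow_deriv_diff:
  assumes "flow_deriv t0 u u0 u'" "flow_deriv t0 v v0 v'" "t0 > 0"
  shows "flow_deriv t0 (\<lambda>t x. u t x - v t x) (\<lambda>x. u0 x - v0 x) (\<lambda>x. u' x - v' x)"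
  using flow_deriv_add[OF assms(1) flow_deriv_cmult[OF assms(2,3), of "-1"]] by simp

lemma flow_deriv_power:
  assumes "flow_deriv t0 u u0 u'" "t0 > 0"
  shows "flow_deriv t0 (\<lambda>t x. u t x ^ n) (\<lambda>x. u0 x ^ n) (\<lambda>x. real n * u0 x ^ (n - 1) * u' x)"
proof (induction n)
  case 0
  then show ?case by (auto intro: flow_deriv_const subexp_const)
next
  case (Suc n)
  have "(\<lambda>x. u' x * u0 x ^ n + u0 x * (real n * u0 x ^ (n - 1) * u' x)) =
      (\<lambda>x. real (Suc n) * u0 x ^ (Suc n - 1) * u' x)"
    by (cases n) (auto simp: fun_eq_iff algebra_simps)
  then show ?case using flow_deriv_mult[OF assms(1) Suc assms(2)] by simp
qed

lemma flow_deriv_affine: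
  assumes [measurable]: "q0 \<in> borel_measurable L" "q \<in> borel_measurable L" and "subexp q0" "subexp q"
  shows "flow_deriv t0 (\<lambda>t x. q0 x + t * q x) q0 q"
  unfolding flow_deriv_def
proof (intro conjI ballI)
  show "\<exists>G. subexp G \<and> (\<forall>t\<in>{0<..t0}. \<forall>x\<in>supp. \<bar>q0 x + t * q x - q0 x\<bar> \<le> t * G x)"
    using subexp_abs[OF assms(4)] by (intro exI[of _ "\<lambda>x. \<bar>q x\<bar>"]) (auto simp: abs_mult)
  show "((\<lambda>t. (q0 x + t * q x - q0 x) / t) \<longlongrightarrow> q x) (at_right 0)" for x
    by (rule tendsto_eventually) (auto simp: eventually_at_filter)
qed (use assms in auto)

text \<open>The exponents of x and 1 - x in the ensembles can be negative. A base of at least 1/2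
  makes the bound of \<open>powr_diff_one_bound\<close> uniform in t for either sign of
  \<gamma>.\<close>

lemma flow_deriv_powr:
  assumes [measurable]: "q \<in> borel_measurable L" and sub: "subexp q" and t0: "t0 \<le> 1"
    and ge: "\<And>t x. t \<in> {0<..t0} \<Longrightarrow> x \<in> supp \<Longrightarrow> 1 + t * q x \<ge> 1 / 2"
  shows "flow_deriv t0 (\<lambda>t x. (1 + t * q x) powr \<gamma>) (\<lambda>x. 1) (\<lambda>x. \<gamma> * q x)"
  unfolding flow_deriv_def
proof (intro conjI ballI)
  show "\<exists>G. subexp G \<and> (\<forall>t\<in>{0<..t0}. \<forall>x\<in>supp. \<bar>(1 + t * q x) powr \<gamma> - 1\<bar> \<le> t * G x)"
  proof (intro exI[of _ "\<lambda>x. \<bar>q x\<bar> * \<bar>\<gamma>\<bar> * (2 * (1 + \<bar>q x\<bar>)) powr (\<bar>\<gamma>\<bar> + 1)"] conjI ballI)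
    show "subexp (\<lambda>x. \<bar>q x\<bar> * \<bar>\<gamma>\<bar> * (2 * (1 + \<bar>q x\<bar>)) powr (\<bar>\<gamma>\<bar> + 1))"
      by (intro subexp_mult subexp_powr subexp_abs subexp_const subexp_add sub) auto
    show "\<bar>(1 + t * q x) powr \<gamma> - 1\<bar> \<le> t * (\<bar>q x\<bar> * \<bar>\<gamma>\<bar> * (2 * (1 + \<bar>q x\<bar>)) powr (\<bar>\<gamma>\<bar> + 1))"
      if "t \<in> {0<..t0}" "x \<in> supp" for t x
      using that ge[OF that] t0 by (intro powr_diff_one_bound) auto
  qed
  show "((\<lambda>t. ((1 + t * q x) powr \<gamma> - 1) / t) \<longlongrightarrow> \<gamma> * q x) (at_right 0)" for x
  proof -
    have "((\<lambda>t. (1 + t * q x) powr \<gamma>) has_real_derivative \<gamma> * q x) (at 0)"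
      by (auto intro!: derivative_eq_intros)
    from tendsto_difference_quotient[OF this] show ?thesis by simp
  qed
qed (use subexp_const in auto)

lemma flow_deriv_exp:
  assumes [measurable]: "q \<in> borel_measurable L" and sub: "subexp q"
    and nonneg: "\<And>x. x \<in> supp \<Longrightarrow> q x \<ge> 0"
  shows "flow_deriv t0 (\<lambda>t x. exp (- (t * q x))) (\<lambda>x. 1) (\<lambda>x. - q x)"
  unfolding flow_deriv_def
proof (intro conjI ballI)
  show "\<exists>G. subexp G \<and> (\<forall>t\<in>{0<..t0}. \<forall>x\<in>supp. \<bar>exp (- (t * q x)) - 1\<bar> \<le> t * G x)"
  proof (intro exI[of _ q] conjI ballI sub)
    fix t x assume tx: "t \<in> {0<..t0}" "x \<in> supp"
    then have "0 \<le> t * q x" using nonneg by auto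
    then show "\<bar>exp (- (t * q x)) - 1\<bar> \<le> t * q x" using exp_ge_add_one_self[of "- (t * q x)"] by (auto simp: abs_if)
  qed
  show "((\<lambda>t. (exp (- (t * q x)) - 1) / t) \<longlongrightarrow> - q x) (at_right 0)" for x
  proof -
    have "((\<lambda>t. exp (- (t * q x))) has_real_derivative - q x) (at 0)"
      by (auto intro!: derivative_eq_intros)
    from tendsto_difference_quotient[OF this] show ?thesis by simp
  qed
qed (use subexp_const in auto)

text \<open>The difference quotients have integral 0 for every t and converge pointwise to
  \<open>u'\<close>; domination by \<open>G\<close> moves the limit inside the integral.\<close>

lemma flow_deriv_integral_zero:
  assumes u: "flow_deriv t0 u u0 u'" and t0: "t0 > 0"
    and const: "\<And>t. t \<in> {0<..t0} \<Longrightarrow> (\<integral>x. u t x \<partial>P) = (\<integral>x. u0 x \<partial>P)"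
  shows "(\<integral>x. u' x \<partial>P) = 0"
proof -
  \<comment> \<open>Dominated convergence is applied along a sequence; this one stays in (0, t0] and
    tends to 0 from the right.\<close>
  define \<tau> where "\<tau> n = t0 / (1 + real n)" for n
  have \<tau>: "\<tau> n \<in> {0<..t0}" for n using t0 by (auto simp: \<tau>_def field_simps)
  have \<tau>0: "\<tau> \<longlonglongrightarrow> 0" unfolding \<tau>_def
    by (rule real_tendsto_divide_at_top[OF tendsto_const]) (auto intro!: filterlim_tendsto_add_at_top filterlim_real_sequentially)
  have \<tau>_right: "filterlim \<tau> (at_right 0) sequentially"
    unfolding filterlim_at using \<tau>0 \<tau> by (auto intro!: always_eventually simp: less_imp_neq[symmetric])
  from u obtain G where G: "subexp G" "\<And>t x. t \<in> {0<..t0} \<Longrightarrow> x \<in> supp \<Longrightarrow> \<bar>u t x - u0 x\<bar> \<le> t * G x"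
    unfolding flow_deriv_def by meson
  have [measurable]: "u0 \<in> borel_measurable L" "u' \<in> borel_measurable L" "u (\<tau> n) \<in> borel_measurable L" for n
    using u \<tau> by (auto simp: flow_deriv_def)
  have int0: "integrable P u0" using u by (intro integrable_subexp) (auto simp: flow_deriv_def)
  have intt: "integrable P (u (\<tau> n))" for n
  proof (rule integrable_subexp)
    show "subexp (u (\<tau> n))"
    proof (rule subexp_mono)
      show "subexp (\<lambda>x. \<bar>u0 x\<bar> + \<tau> n * \<bar>G x\<bar>)"
        using u by (intro subexp_add subexp_cmult subexp_abs G) (auto simp: flow_deriv_def)
      fix x assume x: "x \<in> supp"
      have "\<tau> n * G x \<le> \<tau> n * \<bar>G x\<bar>" using \<tau>[of n] by (intro mult_left_mono) auto
      then show "\<bar>u (\<tau> n) x\<bar> \<le> \<bar>\<bar>u0 x\<bar> + \<tau> n * \<bar>G x\<bar>\<bar>" using G(2)[OF \<tau>[of n] x] by linarith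
    qed
  qed simp
  obtain \<delta> where \<delta>: "\<delta> > 0" "integrable P (\<lambda>x. exp (\<delta> * S 1 x))" using exp_moment by auto
  obtain C where C: "C \<ge> 0" "\<And>x. x \<in> supp \<Longrightarrow> \<bar>G x\<bar> \<le> C * exp (\<delta> * S 1 x)" using subexpD[OF G(1) \<delta>(1)] by blast
  have "(\<lambda>n. \<integral>x. (u (\<tau> n) x - u0 x) / \<tau> n \<partial>P) \<longlonglongrightarrow> (\<integral>x. u' x \<partial>P)"
  proof (rule integral_dominated_convergence[where w = "\<lambda>x. C * exp (\<delta> * S 1 x)"])
    show "u' \<in> borel_measurable P" "(\<lambda>x. (u (\<tau> n) x - u0 x) / \<tau> n) \<in> borel_measurable P" for n
      by measurable
    show "integrable P (\<lambda>x. C * exp (\<delta> * S 1 x))" using \<delta> by simp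
    show "AE x in P. (\<lambda>n. (u (\<tau> n) x - u0 x) / \<tau> n) \<longlonglongrightarrow> u' x"
      using AE_supp
    proof eventually_elim
      case (elim x)
      then have "((\<lambda>t. (u t x - u0 x) / t) \<longlongrightarrow> u' x) (at_right 0)" using u by (simp add: flow_deriv_def)
      from filterlim_compose[OF this \<tau>_right] show ?case .
    qed
    show "AE x in P. norm ((u (\<tau> n) x - u0 x) / \<tau> n) \<le> C * exp (\<delta> * S 1 x)" for n
      using AE_supp
    proof eventually_elim
      case (elim x)
      have "\<bar>u (\<tau> n) x - u0 x\<bar> \<le> \<tau> n * G x" by (rule G(2)[OF \<tau> elim])
      also have "\<dots> \<le> \<tau> n * (C * exp (\<delta> * S 1 x))" using C(2)[OF elim] \<tau>[of n] by (intro mult_left_mono) auto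
      finally show ?case using \<tau>[of n] by (simp add: field_simps)
    qed
  qed
  moreover have "(\<lambda>n. \<integral>x. (u (\<tau> n) x - u0 x) / \<tau> n \<partial>P) = (\<lambda>n. 0)"
    using const[OF \<tau>] int0 intt by (intro ext) simp
  ultimately show ?thesis by (metis LIMSEQ_const_iff)
qed

text \<open>With T = id + t \<phi>, the mean of \<open>flow_weight\<close> times h o T equals E h
  for all small t, so its right derivative at 0 vanishes. The product rule yields \<open>h'\<close>
  from h, \<open>l\<close> (in effect \<phi>' + \<phi> w' / w) from the one-body factors, and
  \<beta> times the divided differences of \<phi> from the repulsion. This is the divergence theorem
  without boundary terms.\<close>

lemma loop_equation:
  fixes \<rho> :: "real \<Rightarrow> real \<Rightarrow> real"
  assumes t0: "0 < t0" "t0 \<le> 1"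
    and [measurable]: "\<phi> \<in> borel_measurable borel" "\<phi>' \<in> borel_measurable borel"
      "case_prod q \<in> borel_measurable (borel \<Otimes>\<^sub>M borel)" "\<And>t. \<rho> t \<in> borel_measurable borel"
    and one: "\<And>t A. t \<in> {0<..t0} \<Longrightarrow> A \<in> sets borel \<Longrightarrow>
      (\<integral>\<^sup>+x. ennreal (1 + t * \<phi>' x) * indicator I x * indicator A (x + t * \<phi> x) \<partial>lborel) = (\<integral>\<^sup>+y. indicator I y * indicator A y \<partial>lborel)"
    and TI: "\<And>t x. t \<in> {0<..t0} \<Longrightarrow> x \<in> I \<Longrightarrow> x + t * \<phi> x \<in> I"
    and T': "\<And>t x. t \<in> {0<..t0} \<Longrightarrow> x \<in> I \<Longrightarrow> 1 + t * \<phi>' x \<ge> 0"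
    and \<rho>: "\<And>t x. t \<in> {0<..t0} \<Longrightarrow> x \<in> I \<Longrightarrow> w (x + t * \<phi> x) * (1 + t * \<phi>' x) = \<rho> t x * w x"
      "\<And>t x. t \<in> {0<..t0} \<Longrightarrow> x \<in> I \<Longrightarrow> \<rho> t x \<ge> 0"
    and q: "\<And>x y. x \<in> I \<Longrightarrow> y \<in> I \<Longrightarrow> \<phi> x - \<phi> y = (x - y) * q x y"
      "\<And>t x y. t \<in> {0<..t0} \<Longrightarrow> x \<in> I \<Longrightarrow> y \<in> I \<Longrightarrow> 1 + t * q x y \<ge> 1 / 2"
    and q_sub: "\<And>i j. i \<in> {1..m} \<Longrightarrow> j \<in> {1..m} \<Longrightarrow> subexp (\<lambda>x. q (x i) (x j))"
    and \<rho>_deriv: "\<And>i. i \<in> {1..m} \<Longrightarrow> flow_deriv t0 (\<lambda>t x. \<rho> t (x i)) (\<lambda>x. 1) (\<lambda>x. l (x i))"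
    and h: "flow_deriv t0 (\<lambda>t x. h (\<lambda>i\<in>{1..m}. x i + t * \<phi> (x i))) h h'"
  shows "(\<integral>x. h' x + h x * ((\<Sum>i=1..m. l (x i)) + \<beta> * (\<Sum>(i, j)\<in>index_pairs m. q (x i) (x j))) \<partial>P) = 0"
proof -
  have pairs: "flow_deriv t0 (\<lambda>t x. \<Prod>(i, j)\<in>index_pairs m. (1 + t * q (x i) (x j)) powr \<beta>) (\<lambda>x. 1)
      (\<lambda>x. \<beta> * (\<Sum>(i, j)\<in>index_pairs m. q (x i) (x j)))"
  proof -
    have "flow_deriv t0 (\<lambda>t x. \<Prod>p\<in>index_pairs m. (1 + t * q (x (fst p)) (x (snd p))) powr \<beta>) (\<lambda>x. 1)
      (\<lambda>x. \<Sum>p\<in>index_pairs m. \<beta> * q (x (fst p)) (x (snd p)))"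
    proof (rule flow_deriv_prod[OF _ t0(1)])
      fix p assume p: "p \<in> index_pairs m"
      then have i: "fst p \<in> {1..m}" "snd p \<in> {1..m}" by (auto simp: index_pairs_def)
      note [measurable] = component_measurable_index_pairs[OF p]
      show "flow_deriv t0 (\<lambda>t x. (1 + t * q (x (fst p)) (x (snd p))) powr \<beta>) (\<lambda>x. 1) (\<lambda>x. \<beta> * q (x (fst p)) (x (snd p)))"
        using i by (intro flow_deriv_powr q_sub t0 q supp_I) auto
    qed
    then show ?thesis by (simp add: case_prod_beta sum_distrib_left)
  qed
  have W: "flow_deriv t0 (\<lambda>t. flow_weight (\<rho> t) (\<lambda>x y. 1 + t * q x y)) (\<lambda>x. 1)
     (\<lambda>x. (\<Sum>i=1..m. l (x i)) + \<beta> * (\<Sum>(i, j)\<in>index_pairs m. q (x i) (x j)))"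
    unfolding flow_weight_def
    using flow_deriv_mult[OF flow_deriv_prod[OF \<rho>_deriv t0(1), of "{1..m}"] pairs t0(1)] by simp
  have "flow_deriv t0 (\<lambda>t x. flow_weight (\<rho> t) (\<lambda>x y. 1 + t * q x y) x * h (\<lambda>i\<in>{1..m}. x i + t * \<phi> (x i))) h
    (\<lambda>x. h' x + h x * ((\<Sum>i=1..m. l (x i)) + \<beta> * (\<Sum>(i, j)\<in>index_pairs m. q (x i) (x j))))"
    using flow_deriv_mult[OF W h t0(1)] by (simp add: algebra_simps)
  then show ?thesis
  proof (rule flow_deriv_integral_zero[OF _ t0(1)])
    fix t assume t: "t \<in> {0<..t0}"
    have hm: "h \<in> borel_measurable L" using h by (simp add: flow_deriv_def)
    have "(\<integral>x. h x \<partial>P) = (\<integral>x. flow_weight (\<rho> t) (\<lambda>x y. 1 + t * q x y) x * h (\<lambda>i\<in>{1..m}. x i + t * \<phi> (x i)) \<partial>P)"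
    proof (rule integral_flow[OF _ _ _ _ hm one[OF t] TI[OF t] T'[OF t] \<rho>(1)[OF t] \<rho>(2)[OF t]])
      show "x + t * \<phi> x - (y + t * \<phi> y) = (x - y) * (1 + t * q x y)" if "x \<in> I" "y \<in> I" for x y
      proof -
        have "t * (\<phi> x - \<phi> y) = t * ((x - y) * q x y)" using q(1)[OF that] by simp
        then show ?thesis by (simp add: algebra_simps)
      qed
      show "0 \<le> 1 + t * q x y" if "x \<in> I" "y \<in> I" for x y
        using q(2)[OF t that] by simp
    qed auto
    then show "(\<integral>x. flow_weight (\<rho> t) (\<lambda>x y. 1 + t * q x y) x * h (\<lambda>i\<in>{1..m}. x i + t * \<phi> (x i)) \<partial>P) = (\<integral>x. h x \<partial>P)" ..
  qed
qed

end

section \<open>The Jacobi and Laguerre gases\<close>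

lemma sum_symmetric_index_pairs:
  fixes g :: "nat \<Rightarrow> nat \<Rightarrow> real"
  assumes sym: "\<And>i j. g i j = g j i"
  shows "(\<Sum>i=1..m. \<Sum>j=1..m. g i j) = 2 * (\<Sum>(i, j)\<in>index_pairs m. g i j) + (\<Sum>i=1..m. g i i)"
proof -
  let ?D = "(\<lambda>i. (i, i)) ` {1..m}"
  have "{1..m} \<times> {1..m} = (index_pairs m \<union> prod.swap ` index_pairs m) \<union> ?D"
    by (force simp: index_pairs_def)
  then have "(\<Sum>i=1..m. \<Sum>j=1..m. g i j) = (\<Sum>(i, j)\<in>(index_pairs m \<union> prod.swap ` index_pairs m) \<union> ?D. g i j)"
    by (simp add: sum.cartesian_product)
  also have "\<dots> = (\<Sum>(i, j)\<in>index_pairs m. g i j) + (\<Sum>(i, j)\<in>prod.swap ` index_pairs m. g i j) + (\<Sum>(i, j)\<in>?D. g i j)"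
  proof -
    have "(index_pairs m \<union> prod.swap ` index_pairs m) \<inter> ?D = {}" "index_pairs m \<inter> prod.swap ` index_pairs m = {}"
      by (auto simp: index_pairs_def)
    then show ?thesis by (simp add: sum.union_disjoint)
  qed
  also have "(\<Sum>(i, j)\<in>prod.swap ` index_pairs m. g i j) = (\<Sum>(i, j)\<in>index_pairs m. g i j)"
    by (subst sum.reindex) (auto simp: case_prod_beta sym)
  also have "(\<Sum>(i, j)\<in>?D. g i j) = (\<Sum>i=1..m. g i i)"
    by (subst sum.reindex) (auto simp: inj_on_def)
  finally show ?thesis by simp
qed

text \<open>The divided difference of x^(k+1), written as a polynomial so that the diagonal is
  included.\<close>

definition power_diff_quot :: "nat \<Rightarrow> real \<Rightarrow> real \<Rightarrow> real" where
  "power_diff_quot k x y = (\<Sum>l\<le>k. x ^ l * y ^ (k - l))"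

lemma power_diff_quot: "x ^ Suc k - y ^ Suc k = (x - y) * power_diff_quot k x y"
  unfolding power_diff_quot_def diff_power_eq_sum by (simp add: lessThan_Suc_atMost)

lemma power_diff_quot_measurable [measurable]:
  "case_prod (power_diff_quot k) \<in> borel_measurable (borel \<Otimes>\<^sub>M borel)"
  unfolding power_diff_quot_def by (simp add: case_prod_beta)

lemma power_diff_quot_nonneg: "0 \<le> x \<Longrightarrow> 0 \<le> y \<Longrightarrow> 0 \<le> power_diff_quot k x y"
  unfolding power_diff_quot_def by (intro sum_nonneg mult_nonneg_nonneg) auto

lemma power_diff_quot_le:
  assumes "0 \<le> x" "x \<le> 1" "0 \<le> y" "y \<le> 1"
  shows "power_diff_quot k x y \<le> real k + 1"
proof -
  have "power_diff_quot k x y \<le> (\<Sum>l\<le>k. 1)"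
    unfolding power_diff_quot_def using assms by (intro sum_mono mult_le_one power_le_one) auto
  then show ?thesis by simp
qed

definition pair_power_sum :: "nat \<Rightarrow> nat \<Rightarrow> (nat \<Rightarrow> real) \<Rightarrow> real" where
  "pair_power_sum m k x = ((\<Sum>l\<le>k. power_sum m l x * power_sum m (k - l) x) - real (Suc k) * power_sum m k x) / 2"

text \<open>The sum over all i, j splits into products of power sums. Removing the diagonal, where
  the divided difference is (k + 1) x^k, and halving by symmetry leaves the pairs i < j. So the
  repulsion contributes only polynomials in power sums.\<close>

lemma sum_power_diff_quot:
  "(\<Sum>(i, j)\<in>index_pairs m. power_diff_quot k (x i) (x j)) = pair_power_sum m k x"
proof -
  have sym: "power_diff_quot k u v = power_diff_quot k v u" for u v
    unfolding power_diff_quot_def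
    by (rule sum.reindex_bij_witness[where i = "\<lambda>l. k - l" and j = "\<lambda>l. k - l"]) auto
  have diag: "power_diff_quot k u u = real (Suc k) * u ^ k" for u
    unfolding power_diff_quot_def by (simp add: power_add[symmetric])
  have "(\<Sum>i=1..m. \<Sum>j=1..m. power_diff_quot k (x i) (x j)) = (\<Sum>i=1..m. \<Sum>l\<le>k. x i ^ l * power_sum m (k - l) x)"
  proof (rule sum.cong[OF refl])
    fix i
    show "(\<Sum>j=1..m. power_diff_quot k (x i) (x j)) = (\<Sum>l\<le>k. x i ^ l * power_sum m (k - l) x)"
      unfolding power_diff_quot_def power_sum_def by (subst sum.swap) (simp add: sum_distrib_left)
  qed
  also have "\<dots> = (\<Sum>l\<le>k. power_sum m l x * power_sum m (k - l) x)"
    by (subst sum.swap) (simp add: power_sum_def sum_distrib_right)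
  finally have 1: "(\<Sum>i=1..m. \<Sum>j=1..m. power_diff_quot k (x i) (x j)) = (\<Sum>l\<le>k. power_sum m l x * power_sum m (k - l) x)" .
  have 2: "(\<Sum>i=1..m. power_diff_quot k (x i) (x i)) = real (Suc k) * power_sum m k x"
    unfolding diag power_sum_def by (simp add: sum_distrib_left)
  show ?thesis
    using sum_symmetric_index_pairs[of "\<lambda>i j. power_diff_quot k (x i) (x j)" m, OF sym]
    unfolding 1 2 pair_power_sum_def by simp
qed

context log_gas
begin

lemma subexp_power_diff_quot:
  "i \<in> {1..m} \<Longrightarrow> j \<in> {1..m} \<Longrightarrow> subexp (\<lambda>x. power_diff_quot k (x i) (x j))"
  unfolding power_diff_quot_def
  by (intro subexp_sum subexp_mult subexp_power subexp_component)

lemma flow_deriv_power_sum: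
  assumes "t0 > 0" and \<phi>: "\<And>i. i \<in> {1..m} \<Longrightarrow> subexp (\<lambda>x. \<phi> (x i))" and [measurable]: "\<phi> \<in> borel_measurable borel"
  shows "flow_deriv t0 (\<lambda>t x. S j (\<lambda>i\<in>{1..m}. x i + t * \<phi> (x i))) (S j)
     (\<lambda>x. \<Sum>i=1..m. real j * x i ^ (j - 1) * \<phi> (x i))"
proof -
  have "flow_deriv t0 (\<lambda>t x. \<Sum>i=1..m. (x i + t * \<phi> (x i)) ^ j) (\<lambda>x. \<Sum>i=1..m. x i ^ j)
     (\<lambda>x. \<Sum>i=1..m. real j * x i ^ (j - 1) * \<phi> (x i))"
    by (intro flow_deriv_sum flow_deriv_power flow_deriv_affine assms subexp_component) auto
  then show ?thesis
    unfolding power_sum_def by simp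
qed

end

section \<open>The Jacobi gas\<close>

locale jacobi_gas =
  fixes \<beta> :: real and m :: nat and c \<alpha> b :: real and P :: "(nat \<Rightarrow> real) measure"
  assumes c_nonneg: "c \<ge> 0"
    and P_def: "P = density (PiM {1..m} (\<lambda>_. lborel))
       (\<lambda>x. ennreal (log_gas_density \<beta> m c (\<lambda>x. x powr \<alpha> * (1 - x) powr b) {0..1} x))"
    and prob: "prob_space P"
begin

sublocale log_gas \<beta> m c "\<lambda>x. x powr \<alpha> * (1 - x) powr b" "{0..1}" P
proof (rule log_gas.intro)
  interpret prob_space P by (fact prob)
  show "\<exists>\<delta>>0. integrable P (\<lambda>x. exp (\<delta> * power_sum m 1 x))"
  proof (intro exI conjI)
    show "integrable P (\<lambda>x. exp (1 * power_sum m 1 x))"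
    proof (rule integrable_const_bound[of _ "exp (real m)"])
      have [measurable]: "log_gas_density \<beta> m c (\<lambda>x. x powr \<alpha> * (1 - x) powr b) {0..1} \<in> borel_measurable (PiM {1..m} (\<lambda>_. lborel))"
        by (rule log_gas_density_measurable) auto
      have meas: "(\<lambda>x. ennreal (log_gas_density \<beta> m c (\<lambda>x. x powr \<alpha> * (1 - x) powr b) {0..1} x)) \<in> borel_measurable (PiM {1..m} (\<lambda>_. lborel))"
        by measurable
      have "power_sum m 1 x \<le> real m" if "\<forall>i\<in>{1..m}. x i \<in> {0..1}" for x
      proof -
        have "(\<Sum>i=1..m. x i ^ 1) \<le> (\<Sum>i=1..m. 1)" using that by (intro sum_mono) auto
        then show ?thesis by (simp add: power_sum_def)
      qed
      then show "AE x in P. norm (exp (1 * power_sum m 1 x)) \<le> exp (real m)"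
        unfolding P_def AE_density[OF meas] by (auto simp: log_gas_density_def intro!: AE_I2)
      show "(\<lambda>x. exp (1 * power_sum m 1 x)) \<in> borel_measurable P"
        unfolding P_def by measurable
    qed
  qed simp
  show "(\<lambda>x. x powr \<alpha> * (1 - x) powr b) \<in> borel_measurable borel" by measurable
  show "{0..1::real} \<in> sets borel" "{0..1::real} \<subseteq> {0..}" by auto
  show "0 \<le> x powr \<alpha> * (1 - x) powr b" for x by simp
qed (fact c_nonneg P_def prob)+

text \<open>On [0, 1] the derivative of \<open>field k\<close>, its divided differences and x^(k+1)
  are all at most k + 2 in absolute value. For t up to this time their products with t are at most
  1/4, so every factor 1 + t u exceeds 1/2.\<close>

definition flow_time :: "nat \<Rightarrow> real" where "flow_time k = 1 / (4 * (real k + 2))"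

lemma flow_time: "0 < flow_time k" "flow_time k \<le> 1"
  by (auto simp: flow_time_def field_simps)

lemma flow_time_mult_le:
  assumes "t \<in> {0<..flow_time k}" "\<bar>u\<bar> \<le> real k + 2"
  shows "\<bar>t * u\<bar> \<le> 1 / 4"
proof -
  have "\<bar>t * u\<bar> \<le> flow_time k * (real k + 2)"
    unfolding abs_mult using assms flow_time[of k] by (intro mult_mono) auto
  also have "flow_time k * (real k + 2) = 1 / 4" by (simp add: flow_time_def field_simps)
  finally show ?thesis .
qed

text \<open>The zeros at 0 and 1 keep [0, 1] invariant and let x and 1 - x factor out of their
  images under the flow, so the powers in the weight are changed only by factors bounded away from
  0.\<close>

definition field :: "nat \<Rightarrow> real \<Rightarrow> real" where "field k x = x ^ Suc k * (1 - x)"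

lemma field_measurable [measurable]: "field k \<in> borel_measurable borel"
  unfolding field_def by measurable

text \<open>The divergence of \<open>field k\<close> plus its pairing with the gradient of the
  log-density, expressed through power sums.\<close>

definition drift :: "nat \<Rightarrow> (nat \<Rightarrow> real) \<Rightarrow> real" where
  "drift k x = (real k + 1 + \<alpha>) * S k x - (real k + 2 + \<alpha> + b) * S (Suc k) x
     + \<beta> * (pair_power_sum m k x - pair_power_sum m (Suc k) x)"

lemma flow_deriv_power_sum_field:
  "flow_deriv (flow_time k) (\<lambda>t x. S j (\<lambda>i\<in>{1..m}. x i + t * field k (x i))) (S j)
     (\<lambda>x. real j * (S (j + k) x - S (Suc (j + k)) x))"
proof -
  have "flow_deriv (flow_time k) (\<lambda>t x. S j (\<lambda>i\<in>{1..m}. x i + t * field k (x i))) (S j)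
    (\<lambda>x. \<Sum>i=1..m. real j * x i ^ (j - 1) * field k (x i))"
    unfolding field_def
    by (intro flow_deriv_power_sum flow_time subexp_mult subexp_power subexp_diff subexp_const subexp_component) auto
  also have "(\<lambda>x. \<Sum>i=1..m. real j * x i ^ (j - 1) * field k (x i)) = (\<lambda>x. real j * (S (j + k) x - S (Suc (j + k)) x))"
    by (cases j) (auto simp: fun_eq_iff field_def power_sum_def sum_subtractf[symmetric] sum_distrib_left
        power_add algebra_simps intro!: sum.cong)
  finally show ?thesis .
qed

lemma loop:
  assumes h: "flow_deriv (flow_time k) (\<lambda>t x. h (\<lambda>i\<in>{1..m}. x i + t * field k (x i))) h h'"
  shows "(\<integral>x. h' x + h x * drift k x \<partial>P) = 0"
proof -
  define \<phi>' where "\<phi>' x = (real k + 1) * x ^ k - (real k + 2) * x ^ Suc k" for x :: real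
  define q where "q x y = power_diff_quot k x y - power_diff_quot (Suc k) x y" for x y
  \<comment> \<open>The flow sends x to x (1 + t x^k (1 - x)) and 1 - x to (1 - x) (1 - t x^(k+1)),
    as recorded in \<open>T_eq\<close>. Raising the two multipliers to \<alpha> and b and including
    the Jacobian gives the one-body factor.\<close>
  define \<rho> where "\<rho> t x = (1 + t * \<phi>' x) * ((1 + t * (x ^ k * (1 - x))) powr \<alpha> * (1 + t * (- (x ^ Suc k))) powr b)" for t x
  define l where "l x = \<phi>' x + (\<alpha> * (x ^ k * (1 - x)) + b * (- (x ^ Suc k)))" for x :: real
  have [measurable]: "\<phi>' \<in> borel_measurable borel" "\<And>t. \<rho> t \<in> borel_measurable borel"
    unfolding \<rho>_def \<phi>'_def by measurable
  have q_eq: "q = (\<lambda>x y. power_diff_quot k x y - power_diff_quot (Suc k) x y)" by (auto simp: q_def fun_eq_iff)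
  have [measurable]: "case_prod q \<in> borel_measurable (borel \<Otimes>\<^sub>M borel)"
    unfolding q_eq by measurable
  have pw: "0 \<le> x ^ n" "x ^ n \<le> 1" if "x \<in> {0..1}" for x :: real and n
    using that by (auto intro: power_le_one)
  have \<phi>'_le: "\<bar>\<phi>' x\<bar> \<le> real k + 2" if x: "x \<in> {0..1}" for x
  proof -
    have "0 \<le> (real k + 1) * x ^ k" "(real k + 1) * x ^ k \<le> real k + 1"
      "0 \<le> (real k + 2) * x ^ Suc k" "(real k + 2) * x ^ Suc k \<le> real k + 2"
      using pw[OF x] mult_left_mono[of "x ^ k" 1 "real k + 1"] mult_left_mono[of "x ^ Suc k" 1 "real k + 2"]
      by (auto simp del: power_Suc)
    then show ?thesis unfolding \<phi>'_def abs_le_iff by linarith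
  qed
  have \<phi>': "1 + t * \<phi>' x \<ge> 1 / 2" if "t \<in> {0<..flow_time k}" "x \<in> {0..1}" for t x
    using flow_time_mult_le[OF that(1) \<phi>'_le[OF that(2)]] by (simp add: abs_le_iff)
  have q_ge: "1 + t * q x y \<ge> 1 / 2" if "t \<in> {0<..flow_time k}" "x \<in> {0..1}" "y \<in> {0..1}" for t x y
  proof -
    have "0 \<le> power_diff_quot k x y" "power_diff_quot k x y \<le> real k + 1"
      "0 \<le> power_diff_quot (Suc k) x y" "power_diff_quot (Suc k) x y \<le> real (Suc k) + 1"
      using that by (auto intro!: power_diff_quot_nonneg power_diff_quot_le simp del: of_nat_Suc)
    then have "\<bar>q x y\<bar> \<le> real k + 2" unfolding q_def by simp
    from flow_time_mult_le[OF that(1) this] show ?thesis by (simp add: abs_le_iff)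
  qed
  have up: "1 + t * (x ^ k * (1 - x)) \<ge> 1 / 2" if "t \<in> {0<..flow_time k}" "x \<in> {0..1}" for t x
  proof -
    have "0 \<le> t * (x ^ k * (1 - x))" using that by (intro mult_nonneg_nonneg) auto
    then show ?thesis by simp
  qed
  have down: "1 + t * (- (x ^ Suc k)) \<ge> 1 / 2" if "t \<in> {0<..flow_time k}" "x \<in> {0..1}" for t x
  proof -
    have "\<bar>- (x ^ Suc k)\<bar> \<le> real k + 2" using pw[OF that(2), of "Suc k"] by simp
    from flow_time_mult_le[OF that(1) this] show ?thesis by (simp add: abs_le_iff)
  qed
  have T_eq: "x + t * field k x = x * (1 + t * (x ^ k * (1 - x)))"
    "1 - (x + t * field k x) = (1 - x) * (1 + t * (- (x ^ Suc k)))" for t x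
    by (simp_all add: field_def algebra_simps)
  have TI: "x + t * field k x \<in> {0..1}" if "t \<in> {0<..flow_time k}" "x \<in> {0..1}" for t x
  proof -
    have "0 \<le> x + t * field k x" unfolding T_eq using up[OF that] that by (intro mult_nonneg_nonneg) auto
    moreover have "0 \<le> 1 - (x + t * field k x)" unfolding T_eq(2) using down[OF that] that by (intro mult_nonneg_nonneg) auto
    ultimately show ?thesis by simp
  qed
  have one: "(\<integral>\<^sup>+x. ennreal (1 + t * \<phi>' x) * indicator {0..1} x * indicator A (x + t * field k x) \<partial>lborel)
     = (\<integral>\<^sup>+y. indicator {0..1} y * indicator A y \<partial>lborel)" if t: "t \<in> {0<..flow_time k}" and [measurable]: "A \<in> sets borel" for t A
  proof -
    have "(\<integral>\<^sup>+x. ennreal (1 + t * \<phi>' x) * indicator {0..1} x * indicator A (x + t * field k x) \<partial>lborel)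
      = (\<integral>\<^sup>+y. indicator {0 + t * field k 0..1 + t * field k 1} y * indicator A y \<partial>lborel)"
    proof (rule nn_integral_subst_Icc)
      fix x :: real assume x: "x \<in> {0..1}"
      show "((\<lambda>x. x + t * field k x) has_real_derivative 1 + t * \<phi>' x) (at x)"
      proof -
        have "((\<lambda>x. x + t * (x ^ Suc k - x ^ Suc (Suc k))) has_real_derivative
            1 + t * (real (Suc k) * x ^ (Suc k - 1) - real (Suc (Suc k)) * x ^ (Suc (Suc k) - 1))) (at x)"
          by (intro DERIV_add DERIV_ident DERIV_cmult DERIV_diff DERIV_pow[THEN DERIV_cong]) auto
        then show ?thesis by (simp add: field_def \<phi>'_def algebra_simps)
      qed
      show "0 \<le> 1 + t * \<phi>' x" using \<phi>'[OF t x] by simp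
    qed (auto simp: \<phi>'_def intro!: continuous_intros)
    then show ?thesis by (simp add: field_def)
  qed
  have "(\<integral>x. h' x + h x * ((\<Sum>i=1..m. l (x i)) + \<beta> * (\<Sum>(i, j)\<in>index_pairs m. q (x i) (x j))) \<partial>P) = 0"
  proof (rule loop_equation[where \<phi>' = \<phi>' and \<rho> = \<rho>, OF flow_time _ _ _ _ one TI _ _ _ _ q_ge _ _ h])
    show "field k \<in> borel_measurable borel" by measurable
    fix t x :: real assume t: "t \<in> {0<..flow_time k}" and x: "x \<in> {0..1}"
    show "0 \<le> 1 + t * \<phi>' x" using \<phi>'[OF t x] by simp
    then show "0 \<le> \<rho> t x" by (simp add: \<rho>_def)
    have "x \<ge> 0" "1 - x \<ge> 0" using x by auto
    then show "(x + t * field k x) powr \<alpha> * (1 - (x + t * field k x)) powr b * (1 + t * \<phi>' x) = \<rho> t x * (x powr \<alpha> * (1 - x) powr b)"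
      using up[OF t x] down[OF t x] by (subst T_eq(2), subst T_eq(1)) (simp add: powr_mult \<rho>_def)
  next
    fix x y :: real
    show "field k x - field k y = (x - y) * q x y"
      using power_diff_quot[of x k y] power_diff_quot[of x "Suc k" y]
      unfolding field_def q_def by (simp add: algebra_simps)
  next
    fix i j assume ij: "i \<in> {1..m}" "j \<in> {1..m}"
    show "subexp (\<lambda>x. q (x i) (x j))" unfolding q_def by (intro subexp_diff subexp_power_diff_quot ij)
  next
    fix i assume i: "i \<in> {1..m}"
    then have [measurable]: "(\<lambda>x. x i) \<in> borel_measurable L" by measurable
    \<comment> \<open>The unsimplified products with 1 keep the shape that two applications of
      \<open>flow_deriv_mult\<close> produce for the three factors of \<open>\<rho>\<close>.\<close>
    have "flow_deriv (flow_time k) (\<lambda>t x. \<rho> t (x i)) (\<lambda>x. 1 * (1 * 1))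
      (\<lambda>x. \<phi>' (x i) * (1 * 1) + 1 * (\<alpha> * (x i ^ k * (1 - x i)) * 1 + 1 * (b * (- (x i ^ Suc k)))))"
      unfolding \<rho>_def \<phi>'_def
      by (intro flow_deriv_mult flow_deriv_powr flow_deriv_affine flow_time 
           subexp_power subexp_mult subexp_diff subexp_minus subexp_const subexp_component i up down supp_I) auto
    then show "flow_deriv (flow_time k) (\<lambda>t x. \<rho> t (x i)) (\<lambda>x. 1) (\<lambda>x. l (x i))"
      by (simp add: l_def)
  qed auto
  moreover have "(\<Sum>i=1..m. l (x i)) + \<beta> * (\<Sum>(i, j)\<in>index_pairs m. q (x i) (x j)) = drift k x" for x
  proof -
    have "(\<Sum>(i, j)\<in>index_pairs m. q (x i) (x j)) = pair_power_sum m k x - pair_power_sum m (Suc k) x"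
      unfolding q_def sum_power_diff_quot[symmetric] by (simp add: sum_subtractf case_prod_beta)
    moreover have "(\<Sum>i=1..m. l (x i)) = (real k + 1 + \<alpha>) * S k x - (real k + 2 + \<alpha> + b) * S (Suc k) x"
      unfolding power_sum_def sum_distrib_left sum_subtractf[symmetric]
      by (intro sum.cong) (auto simp: l_def \<phi>'_def algebra_simps)
    ultimately show ?thesis by (simp add: drift_def)
  qed
  ultimately show ?thesis by simp
qed

end

section \<open>The Laguerre gas\<close>

locale laguerre_gas =
  fixes \<beta> :: real and m :: nat and c \<alpha> :: real and P :: "(nat \<Rightarrow> real) measure"
  assumes c_nonneg: "c \<ge> 0"
    and P_def: "P = density (PiM {1..m} (\<lambda>_. lborel))
       (\<lambda>x. ennreal (log_gas_density \<beta> m c (\<lambda>x. x powr \<alpha> * exp (- x / 2)) {0..} x))"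
    and prob: "prob_space P"
begin

lemma weight_measurable [measurable]: "(\<lambda>x. x powr \<alpha> * exp (- x / 2)) \<in> borel_measurable borel"
  by measurable

lemma laguerre_density_measurable [measurable]:
  "log_gas_density \<beta> m c (\<lambda>x. x powr \<alpha> * exp (- x / 2)) {0..} \<in> borel_measurable (PiM {1..m} (\<lambda>_. lborel))"
  by (rule log_gas_density_measurable) auto

text \<open>Under the dilation \<open>x \<mapsto> 2 x\<close> the weight becomes a multiple of itself times \<open>exp (- S\<^sub>1 / 2)\<close>.\<close>

lemma integrable_exp_power_sum: "integrable P (\<lambda>x. exp (1 / 4 * power_sum m 1 x))"
proof (rule integrableI_bounded)
  let ?f = "log_gas_density \<beta> m c (\<lambda>x. x powr \<alpha> * exp (- x / 2)) {0..}"
  let ?L = "PiM {1..m} (\<lambda>_. lborel :: real measure)"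
  let ?T = "\<lambda>x. \<lambda>i\<in>{1..m}. 2 * x i"
  interpret prob_space P by (fact prob)
  show "(\<lambda>x. exp (1 / 4 * power_sum m 1 x)) \<in> borel_measurable P"
    unfolding P_def by measurable
  \<comment> \<open>Scaling factors of the dilation by 2: 2^\<beta> for each pair, 2^\<alpha> for
    each coordinate, and the Jacobian 2^m.\<close>
  define K where "K = (2 powr \<beta>) ^ card (index_pairs m) * (2 powr \<alpha>) ^ m * 2 ^ m"
  have K: "K \<ge> 0" by (simp add: K_def)
  have key: "(ennreal (?f (?T x)) * ennreal (exp (1 / 4 * power_sum m 1 (?T x)))) * (\<Prod>i\<in>{1..m}. ennreal 2 * indicator {0..} (x i))
      = ennreal K * ennreal (?f x)" for x
  proof (cases "\<forall>i\<in>{1..m}. x i \<in> {0..}")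
    case True
    have "(\<Prod>i\<in>{1..m}. ennreal 2 * indicator {0..} (x i)) = (\<Prod>i\<in>{1..m}. ennreal 2)"
      using True by (intro prod.cong) auto
    then have 1: "(\<Prod>i\<in>{1..m}. ennreal 2 * indicator {0..} (x i)) = ennreal (2 ^ m)"
      by (simp add: ennreal_power[symmetric])
    have 2: "?f (?T x) = c * (\<Prod>(i, j)\<in>index_pairs m. \<bar>2 * x i - 2 * x j\<bar> powr \<beta>) * (\<Prod>i=1..m. (2 * x i) powr \<alpha> * exp (- (2 * x i) / 2))"
    proof -
      have T: "?T x i = 2 * x i" if "i \<in> {1..m}" for i using that by simp
      have "\<forall>i\<in>{1..m}. ?T x i \<in> {0..}" using True by simp
      then have "?f (?T x) = c * (\<Prod>(i, j)\<in>index_pairs m. \<bar>?T x i - ?T x j\<bar> powr \<beta>) * (\<Prod>i=1..m. ?T x i powr \<alpha> * exp (- ?T x i / 2))"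
        unfolding log_gas_density_def by (rule if_P)
      also have "(\<Prod>(i, j)\<in>index_pairs m. \<bar>?T x i - ?T x j\<bar> powr \<beta>) = (\<Prod>(i, j)\<in>index_pairs m. \<bar>2 * x i - 2 * x j\<bar> powr \<beta>)"
      proof (rule prod.cong[OF refl], clarify)
        fix i j assume "(i, j) \<in> index_pairs m"
        then have "i \<in> {1..m}" "j \<in> {1..m}" by (auto simp: index_pairs_def)
        then show "\<bar>?T x i - ?T x j\<bar> powr \<beta> = \<bar>2 * x i - 2 * x j\<bar> powr \<beta>" by (simp only: T)
      qed
      also have "(\<Prod>i=1..m. ?T x i powr \<alpha> * exp (- ?T x i / 2)) = (\<Prod>i=1..m. (2 * x i) powr \<alpha> * exp (- (2 * x i) / 2))"
        by (rule prod.cong[OF refl]) (simp only: T)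
      finally show ?thesis .
    qed
    have 3: "(\<Prod>(i, j)\<in>index_pairs m. \<bar>2 * x i - 2 * x j\<bar> powr \<beta>) =
       (2 powr \<beta>) ^ card (index_pairs m) * (\<Prod>(i, j)\<in>index_pairs m. \<bar>x i - x j\<bar> powr \<beta>)"
    proof -
      have "\<bar>2 * x i - 2 * x j\<bar> powr \<beta> = 2 powr \<beta> * \<bar>x i - x j\<bar> powr \<beta>" for i j
      proof -
        have "\<bar>2 * x i - 2 * x j\<bar> = 2 * \<bar>x i - x j\<bar>"
          using abs_mult[of 2 "x i - x j"] by (simp add: right_diff_distrib)
        then show ?thesis by (simp only: powr_mult)
      qed
      then show ?thesis by (simp add: prod.distrib case_prod_beta)
    qed
    have 4: "(\<Prod>i=1..m. (2 * x i) powr \<alpha> * exp (- (2 * x i) / 2)) =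
       (2 powr \<alpha>) ^ m * (\<Prod>i=1..m. x i powr \<alpha> * exp (- x i / 2)) * exp (- (1 / 2) * power_sum m 1 x)"
    proof -
      have "(\<Prod>i=1..m. (2 * x i) powr \<alpha> * exp (- (2 * x i) / 2)) =
        (\<Prod>i=1..m. 2 powr \<alpha> * (x i powr \<alpha> * exp (- x i / 2)) * exp (- (1 / 2) * x i))"
      proof (rule prod.cong[OF refl])
        fix i assume "i \<in> {1..m}"
        have "exp (- (2 * x i) / 2) = exp (- x i / 2) * exp (- (1 / 2) * x i)" by (simp add: mult_exp_exp)
        then show "(2 * x i) powr \<alpha> * exp (- (2 * x i) / 2) = 2 powr \<alpha> * (x i powr \<alpha> * exp (- x i / 2)) * exp (- (1 / 2) * x i)"
          by (simp only: powr_mult ac_simps)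
      qed
      also have "\<dots> = (2 powr \<alpha>) ^ m * (\<Prod>i=1..m. x i powr \<alpha> * exp (- x i / 2)) * exp (\<Sum>i=1..m. - (1 / 2) * x i)"
        by (simp add: prod.distrib exp_sum)
      finally show ?thesis by (simp add: power_sum_def sum_distrib_left)
    qed
    have 5: "power_sum m 1 (?T x) = 2 * power_sum m 1 x"
      by (simp add: power_sum_def sum_distrib_left)
    have 6: "?f x = c * (\<Prod>(i, j)\<in>index_pairs m. \<bar>x i - x j\<bar> powr \<beta>) * (\<Prod>i=1..m. x i powr \<alpha> * exp (- x i / 2))"
      using True by (auto simp: log_gas_density_def)
    \<comment> \<open>The rate 1/4 is chosen for this cancellation: dilation turns it into S 1 / 2,
      exactly the extra decay gained by the weight.\<close>
    have "?f (?T x) * exp (1 / 4 * power_sum m 1 (?T x)) * 2 ^ m =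
       K * ?f x * (exp (- (1 / 2) * power_sum m 1 x) * exp (1 / 4 * (2 * power_sum m 1 x)))"
      unfolding 2 3 4 5 6 K_def by (simp only: ac_simps)
    also have "\<dots> = K * ?f x" by (simp add: mult_exp_exp)
    finally have "?f (?T x) * exp (1 / 4 * power_sum m 1 (?T x)) * 2 ^ m = K * ?f x" .
    then show ?thesis unfolding 1 using K
      by (simp add: ennreal_mult'[symmetric] ennreal_mult''[symmetric])
  next
    case False
    then obtain i where "i \<in> {1..m}" "x i \<notin> {0..}" by auto
    then have "(\<Prod>i\<in>{1..m}. ennreal 2 * indicator {0..} (x i)) = 0" "?f x = 0"
      by (auto intro!: prod_zero bexI[of _ i] simp: log_gas_density_def)
    then show ?thesis by simp
  qed
  have one: "(\<integral>\<^sup>+x. ennreal 2 * indicator {0..} x * indicator A (2 * x) \<partial>lborel) = (\<integral>\<^sup>+y. indicator {0..} y * indicator A y \<partial>lborel)"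
    if "A \<in> sets borel" for A :: "real set"
    using that by (intro nn_integral_subst_atLeast_0) (auto intro!: derivative_eq_intros continuous_intros)
  have fI: "ennreal (?f y) * (\<Prod>i\<in>{1..m}. indicator {0..} (y i)) = ennreal (?f y)" for y
    by (auto simp: log_gas_density_def indicator_def)
  have fm [measurable]: "(\<lambda>x. ennreal (?f x)) \<in> borel_measurable ?L" by measurable
  have em [measurable]: "(\<lambda>x. ennreal (exp (1 / 4 * power_sum m 1 x))) \<in> borel_measurable ?L" by measurable
  have "(\<integral>\<^sup>+x. ennreal (norm (exp (1 / 4 * power_sum m 1 x))) \<partial>P) = (\<integral>\<^sup>+x. ennreal (exp (1 / 4 * power_sum m 1 x)) \<partial>P)"
    by simp
  also have "\<dots> = (\<integral>\<^sup>+x. ennreal (?f x) * ennreal (exp (1 / 4 * power_sum m 1 x)) \<partial>?L)"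
    unfolding P_def by (rule nn_integral_density[OF fm em])
  also have "\<dots> = (\<integral>\<^sup>+x. (ennreal (?f x) * ennreal (exp (1 / 4 * power_sum m 1 x))) * (\<Prod>i\<in>{1..m}. indicator {0..} (x i)) \<partial>?L)"
    by (intro nn_integral_cong) (subst fI[symmetric], simp only: ac_simps)
  also have "\<dots> = (\<integral>\<^sup>+x. (ennreal (?f (?T x)) * ennreal (exp (1 / 4 * power_sum m 1 (?T x)))) * (\<Prod>i\<in>{1..m}. ennreal 2 * indicator {0..} (x i)) \<partial>?L)"
    by (rule nn_integral_PiM_lborel_subst[OF _ _ _ _ _ borel_measurable_times_ennreal[OF fm em] one]) auto
  also have "\<dots> = ennreal K * (\<integral>\<^sup>+x. ennreal (?f x) \<partial>?L)"
    unfolding key by (rule nn_integral_cmult) measurable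
  also have "(\<integral>\<^sup>+x. ennreal (?f x) \<partial>?L) = (\<integral>\<^sup>+x. ennreal (?f x) * indicator (space ?L) x \<partial>?L)"
    by (rule nn_integral_cong) simp
  also have "\<dots> = emeasure P (space P)"
    unfolding P_def by (simp only: space_density emeasure_density[OF fm sets.top])
  also have "\<dots> = 1" by (rule emeasure_space_1)
  finally show "(\<integral>\<^sup>+x. ennreal (norm (exp (1 / 4 * power_sum m 1 x))) \<partial>P) < \<infinity>" by simp
qed

sublocale log_gas \<beta> m c "\<lambda>x. x powr \<alpha> * exp (- x / 2)" "{0..}" P
proof (rule log_gas.intro)
  show "\<exists>\<delta>>0. integrable P (\<lambda>x. exp (\<delta> * power_sum m 1 x))"
    using integrable_exp_power_sum by (intro exI[of _ "1 / 4"]) simp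
  show "(\<lambda>x. x powr \<alpha> * exp (- x / 2)) \<in> borel_measurable borel" by (rule weight_measurable)
  show "{0::real..} \<in> sets borel" "{0::real..} \<subseteq> {0..}" by auto
  show "0 \<le> x powr \<alpha> * exp (- x / 2)" for x by simp
qed (fact c_nonneg P_def prob)+

definition drift :: "nat \<Rightarrow> (nat \<Rightarrow> real) \<Rightarrow> real" where
  "drift k x = (real k + 1 + \<alpha>) * S k x - S (Suc k) x / 2 + \<beta> * pair_power_sum m k x"

lemma flow_deriv_power_sum_field:
  "flow_deriv 1 (\<lambda>t x. S j (\<lambda>i\<in>{1..m}. x i + t * x i ^ Suc k)) (S j) (\<lambda>x. real j * S (j + k) x)"
proof -
  have "flow_deriv 1 (\<lambda>t x. S j (\<lambda>i\<in>{1..m}. x i + t * x i ^ Suc k)) (S j)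
    (\<lambda>x. \<Sum>i=1..m. real j * x i ^ (j - 1) * x i ^ Suc k)"
    by (intro flow_deriv_power_sum subexp_power subexp_component) auto
  also have "(\<lambda>x. \<Sum>i=1..m. real j * x i ^ (j - 1) * x i ^ Suc k) = (\<lambda>x. real j * S (j + k) x)"
    by (cases j) (auto simp: fun_eq_iff power_sum_def sum_distrib_left power_add algebra_simps intro!: sum.cong)
  finally show ?thesis .
qed

text \<open>On the half-line the power x^(k+1), its derivative and its divided differences are
  nonnegative, so every multiplier 1 + t u has u \<ge> 0 and all t in (0, 1] are admissible. The
  exponential weight contributes exp (- t x^(k+1) / 2), which is at most 1.\<close>

lemma loop:
  assumes h: "flow_deriv 1 (\<lambda>t x. h (\<lambda>i\<in>{1..m}. x i + t * x i ^ Suc k)) h h'"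
  shows "(\<integral>x. h' x + h x * drift k x \<partial>P) = 0"
proof -
  define \<phi>' where "\<phi>' x = (real k + 1) * x ^ k" for x :: real
  define \<rho> where "\<rho> t x = (1 + t * \<phi>' x) * ((1 + t * x ^ k) powr \<alpha> * exp (- (t * (x ^ Suc k / 2))))" for t x
  define l where "l x = \<phi>' x + (\<alpha> * x ^ k + (- (x ^ Suc k / 2)))" for x :: real
  have [measurable]: "\<phi>' \<in> borel_measurable borel" "\<And>t. \<rho> t \<in> borel_measurable borel"
    unfolding \<rho>_def \<phi>'_def by measurable
  have \<phi>'_nonneg: "\<phi>' x \<ge> 0" if "x \<ge> 0" for x using that by (simp add: \<phi>'_def)
  have \<phi>': "1 + t * \<phi>' x \<ge> 0" if "t \<in> {0<..1}" "x \<ge> 0" for t x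
    using that \<phi>'_nonneg[OF that(2)] by (intro add_nonneg_nonneg mult_nonneg_nonneg) auto
  have half: "1 + t * u \<ge> 1 / 2" if "t \<in> {0<..1}" "u \<ge> 0" for t u :: real
    using that mult_nonneg_nonneg[of t u] by auto
  have one: "(\<integral>\<^sup>+x. ennreal (1 + t * \<phi>' x) * indicator {0..} x * indicator A (x + t * x ^ Suc k) \<partial>lborel)
     = (\<integral>\<^sup>+y. indicator {0..} y * indicator A y \<partial>lborel)" if t: "t \<in> {0<..1}" and [measurable]: "A \<in> sets borel" for t A
  proof (rule nn_integral_subst_atLeast_0)
    fix x :: real assume x: "x \<ge> 0"
    show "((\<lambda>x. x + t * x ^ Suc k) has_real_derivative 1 + t * \<phi>' x) (at x)"
    proof -
      have "((\<lambda>x. x + t * x ^ Suc k) has_real_derivative 1 + t * (real (Suc k) * x ^ (Suc k - 1))) (at x)"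
        by (intro DERIV_add DERIV_ident DERIV_cmult DERIV_pow[THEN DERIV_cong]) auto
      then show ?thesis by (simp add: \<phi>'_def algebra_simps)
    qed
    show "0 \<le> 1 + t * \<phi>' x" using \<phi>'[OF t x] by simp
    show "x \<le> x + t * x ^ Suc k" using t x by simp
  qed (auto simp: \<phi>'_def intro!: continuous_intros)
  have "(\<integral>x. h' x + h x * ((\<Sum>i=1..m. l (x i)) + \<beta> * (\<Sum>(i, j)\<in>index_pairs m. power_diff_quot k (x i) (x j))) \<partial>P) = 0"
  proof (rule loop_equation[where \<phi> = "\<lambda>x. x ^ Suc k" and \<phi>' = \<phi>' and \<rho> = \<rho>, OF zero_less_one order_refl _ _ _ _ one _ _ _ _ _ _ _ _ h])
    fix t x :: real assume t: "t \<in> {0<..1}" and x: "x \<in> {0..}"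
    then have x0: "0 \<le> x" and pw: "1 + t * x ^ k \<ge> 1 / 2" by (auto intro!: half)
    show "x + t * x ^ Suc k \<in> {0..}" using x t by simp
    show "0 \<le> 1 + t * \<phi>' x" using \<phi>'[OF t x0] by simp
    then show "0 \<le> \<rho> t x" by (simp add: \<rho>_def)
    have "x + t * x ^ Suc k = x * (1 + t * x ^ k)" by (simp add: algebra_simps)
    then have "(x + t * x ^ Suc k) powr \<alpha> = x powr \<alpha> * (1 + t * x ^ k) powr \<alpha>"
      using x0 pw by (simp add: powr_mult)
    moreover have "exp (- (x + t * x ^ Suc k) / 2) = exp (- x / 2) * exp (- (t * (x ^ Suc k / 2)))"
      by (simp add: mult_exp_exp field_simps)
    ultimately show "(x + t * x ^ Suc k) powr \<alpha> * exp (- (x + t * x ^ Suc k) / 2) * (1 + t * \<phi>' x) = \<rho> t x * (x powr \<alpha> * exp (- x / 2))"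
      by (simp add: \<rho>_def)
  next
    fix x y :: real
    show "x ^ Suc k - y ^ Suc k = (x - y) * power_diff_quot k x y" by (rule power_diff_quot)
  next
    fix t x y :: real assume "t \<in> {0<..1}" "x \<in> {0..}" "y \<in> {0..}"
    then show "1 + t * power_diff_quot k x y \<ge> 1 / 2" by (intro half power_diff_quot_nonneg) auto
  next
    fix i j assume ij: "i \<in> {1..m}" "j \<in> {1..m}"
    show "subexp (\<lambda>x. power_diff_quot k (x i) (x j))" by (intro subexp_power_diff_quot ij)
  next
    fix i assume i: "i \<in> {1..m}"
    then have [measurable]: "(\<lambda>x. x i) \<in> borel_measurable L" by measurable
    have "flow_deriv 1 (\<lambda>t x. \<rho> t (x i)) (\<lambda>x. 1 * (1 * 1))
      (\<lambda>x. \<phi>' (x i) * (1 * 1) + 1 * (\<alpha> * x i ^ k * 1 + 1 * (- (x i ^ Suc k / 2))))"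
      unfolding \<rho>_def \<phi>'_def times_divide_eq_right[symmetric] divide_inverse
      by (intro flow_deriv_mult flow_deriv_powr flow_deriv_affine flow_deriv_exp subexp_power subexp_mult
           subexp_const subexp_component i half zero_le_power zero_less_one)
         (auto intro!: mult_nonneg_nonneg simp: supp_nonneg[OF _ i])
    then show "flow_deriv 1 (\<lambda>t x. \<rho> t (x i)) (\<lambda>x. 1) (\<lambda>x. l (x i))"
      by (simp add: l_def)
  qed auto
  moreover have "(\<Sum>i=1..m. l (x i)) + \<beta> * (\<Sum>(i, j)\<in>index_pairs m. power_diff_quot k (x i) (x j)) = drift k x" for x
  proof -
    have "(\<Sum>i=1..m. l (x i)) = (real k + 1 + \<alpha>) * S k x - 1 / 2 * S (Suc k) x"
      unfolding power_sum_def sum_distrib_left sum_subtractf[symmetric]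
      by (intro sum.cong) (auto simp: l_def \<phi>'_def algebra_simps)
    then show ?thesis by (simp add: drift_def sum_power_diff_quot)
  qed
  ultimately show ?thesis by simp
qed

end

section \<open>Moments of the Jacobi ensemble\<close>

context log_gas
begin

lemmas subexp_intros = subexp_add subexp_diff subexp_mult subexp_power subexp_sum subexp_minus
  subexp_power_sum subexp_component subexp_const

lemma integrable_power_sum [simp]:
  "integrable P (\<lambda>x. S k x)" "integrable P (\<lambda>x. S j x * S k x)" "integrable P (\<lambda>x. (S k x)\<^sup>2)"
  by (intro integrable_subexp subexp_intros; measurable)+

end

lemma pair_power_sum_simps:
  "pair_power_sum m 0 x = real m * (real m - 1) / 2"
  "pair_power_sum m 1 x = (real m - 1) * power_sum m 1 x"
  "pair_power_sum m 2 x = (real m - 3 / 2) * power_sum m 2 x + (power_sum m 1 x)\<^sup>2 / 2"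
  "pair_power_sum m 3 x = (real m - 2) * power_sum m 3 x + power_sum m 1 x * power_sum m 2 x"
proof -
  have s: "{..0::nat} = {0}" "{..1::nat} = {0, 1}" "{..2::nat} = {0, 1, 2}" "{..3::nat} = {0, 1, 2, 3}"
    by auto
  show "pair_power_sum m 0 x = real m * (real m - 1) / 2"
    "pair_power_sum m 1 x = (real m - 1) * power_sum m 1 x"
    "pair_power_sum m 2 x = (real m - 3 / 2) * power_sum m 2 x + (power_sum m 1 x)\<^sup>2 / 2"
    "pair_power_sum m 3 x = (real m - 2) * power_sum m 3 x + power_sum m 1 x * power_sum m 2 x"
    unfolding pair_power_sum_def s by (simp_all add: field_simps power2_eq_square One_nat_def[symmetric])
qed

locale jacobi_moments = jacobi_gas \<beta> m c "a1 - (1 + \<beta> / 2 * (real m - 1))" "a2 - (1 + \<beta> / 2 * (real m - 1))" P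
  for \<beta> :: real and m :: nat and c a1 a2 :: real and P :: "(nat \<Rightarrow> real) measure" +
  assumes \<beta>_pos: "\<beta> > 0" and m_pos: "m \<ge> 1"
    and a1_gt: "a1 > \<beta> / 2 * (real m - 1)" and a2_gt: "a2 > \<beta> / 2 * (real m - 1)"
begin

definition a :: real where "a = a1 + a2"
definition p :: real where "p = a1 / a"
text \<open>This is the number r of the two densities. With it, A and - D are the coefficients of S
  1 and S 2 in \<open>drift 1\<close>; in D the dependence on m cancels between the exponents of the
  weight and the pair terms.\<close>

definition \<delta> :: real where "\<delta> = 1 + \<beta> / 2 * (real m - 1)"
definition A :: real where "A = a1 + \<delta>"
definition D :: real where "D = a + 1 - \<beta> / 2"

lemma a1_pos: "a1 > 0" and a2_pos: "a2 > 0"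
proof -
  have "0 \<le> \<beta> / 2 * (real m - 1)" using \<beta>_pos m_pos by auto
  then show "a1 > 0" "a2 > 0" using a1_gt a2_gt by linarith+
qed

lemma a_pos: "a > 0" using a1_pos a2_pos by (simp add: a_def)

lemma p_bounds: "0 < p" "p < 1" using a1_pos a2_pos by (auto simp: p_def a_def)

lemma a_p: "a * p = a1" using a_pos by (simp add: p_def)

lemma a_mp: "a * (real m * p) = real m * a1"
  using a_p by (metis mult.left_commute)

lemma drift_simps:
  "drift 0 x = real m * a1 - a * S 1 x"
  "drift 1 x = A * S 1 x - D * S 2 x - \<beta> / 2 * (S 1 x)\<^sup>2"
  "drift 2 x = (A + 1 - \<beta> / 2) * S 2 x - (a + 2 - \<beta>) * S 3 x + \<beta> / 2 * (S 1 x)\<^sup>2 - \<beta> * (S 1 x * S 2 x)"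
proof -
  have e: "Suc 0 = 1" "Suc 1 = 2" "Suc 2 = 3" by auto
  show "drift 0 x = real m * a1 - a * S 1 x"
    "drift 1 x = A * S 1 x - D * S 2 x - \<beta> / 2 * (S 1 x)\<^sup>2"
    "drift 2 x = (A + 1 - \<beta> / 2) * S 2 x - (a + 2 - \<beta>) * S 3 x + \<beta> / 2 * (S 1 x)\<^sup>2 - \<beta> * (S 1 x * S 2 x)"
    unfolding drift_def e pair_power_sum_simps A_def D_def a_def \<delta>_def
    by (simp_all add: field_simps)
qed

lemmas drift_fun = ext[of "drift 0", OF drift_simps(1)] ext[of "drift 1", OF drift_simps(2)] ext[of "drift 2", OF drift_simps(3)]

lemma loop_const: "(\<integral>x. drift k x \<partial>P) = 0"
  using loop[of k "\<lambda>x. 1" "\<lambda>x. 0"] by (simp add: flow_deriv_const subexp_const)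

lemma mean_S1: "(\<integral>x. S 1 x \<partial>P) = real m * p"
  using loop_const[of 0, unfolded drift_fun] a_pos prob_space by (simp add: p_def field_simps)

lemma mean_S2: "D * (\<integral>x. S 2 x \<partial>P) = A * (real m * p) - \<beta> / 2 * (\<integral>x. (S 1 x)\<^sup>2 \<partial>P)"
  using loop_const[of 1, unfolded drift_fun] mean_S1 by simp

lemma mean_S3: "(a + 2 - \<beta>) * (\<integral>x. S 3 x \<partial>P) = (A + 1 - \<beta> / 2) * (\<integral>x. S 2 x \<partial>P)
    + \<beta> / 2 * (\<integral>x. (S 1 x)\<^sup>2 \<partial>P) - \<beta> * (\<integral>x. S 1 x * S 2 x \<partial>P)"
  using loop_const[of 2, unfolded drift_fun] by simp

text \<open>Loop equation with test function S 1 along \<open>field 0\<close>, whose drift is affine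
  in S 1.\<close>

lemma mean_S1_square: "a * (\<integral>x. (S 1 x)\<^sup>2 \<partial>P) = (real m * a1 + 1) * (real m * p) - (\<integral>x. S 2 x \<partial>P)"
proof -
  have "(\<integral>x. real 1 * (S (1 + 0) x - S (Suc (1 + 0)) x) + S 1 x * drift 0 x \<partial>P) = 0"
    by (rule loop[OF flow_deriv_power_sum_field])
  moreover have "real 1 * (S (1 + 0) x - S (Suc (1 + 0)) x) + S 1 x * drift 0 x =
     (real m * a1 + 1) * S 1 x - S 2 x - a * (S 1 x)\<^sup>2" for x
    unfolding drift_simps by (simp add: algebra_simps power2_eq_square)
  ultimately have "(\<integral>x. (real m * a1 + 1) * S 1 x - S 2 x - a * (S 1 x)\<^sup>2 \<partial>P) = 0" by (simp only:)
  then show ?thesis by (simp add: mean_S1)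
qed

lemma mean_S1_centred: "(\<integral>x. S 1 x - real m * p \<partial>P) = 0"
  using mean_S1 prob_space by simp

lemma integral_S2_nonneg: "0 \<le> (\<integral>x. S 2 x \<partial>P)"
proof (rule integral_nonneg_AE)
  show "AE x in P. 0 \<le> S 2 x" using AE_supp by eventually_elim (rule power_sum_nonneg)
qed

lemma mean_S1_square_ge: "(real m * p)\<^sup>2 \<le> (\<integral>x. (S 1 x)\<^sup>2 \<partial>P)"
proof -
  have "0 \<le> (\<integral>x. (S 1 x - real m * p)\<^sup>2 \<partial>P)" by simp
  also have "(\<integral>x. (S 1 x - real m * p)\<^sup>2 \<partial>P) = (\<integral>x. (S 1 x)\<^sup>2 - (2 * (real m * p)) * S 1 x + (real m * p)\<^sup>2 \<partial>P)"
    by (rule Bochner_Integration.integral_cong) (auto simp: power2_eq_square algebra_simps)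
  also have "\<dots> = (\<integral>x. (S 1 x)\<^sup>2 \<partial>P) - 2 * (real m * p) * (real m * p) + (real m * p)\<^sup>2"
    using mean_S1 prob_space by simp
  finally show ?thesis by (simp add: power2_eq_square algebra_simps)
qed

lemma mean_S1_square_le: "a * (\<integral>x. (S 1 x)\<^sup>2 \<partial>P) \<le> (real m * a1 + 1) * (real m * p)"
  using mean_S1_square integral_S2_nonneg by linarith

text \<open>By \<open>mean_S1_square\<close>, a times the variance equals m p - E (S 2), and S 2 is
  nonnegative.\<close>

lemma variance_S1_le: "a * (\<integral>x. (S 1 x - real m * p)\<^sup>2 \<partial>P) \<le> real m * p"
proof -
  have "(\<integral>x. (S 1 x - real m * p)\<^sup>2 \<partial>P) = (\<integral>x. (S 1 x)\<^sup>2 - (2 * (real m * p)) * S 1 x + (real m * p)\<^sup>2 \<partial>P)"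
    by (rule Bochner_Integration.integral_cong) (auto simp: power2_eq_square algebra_simps)
  also have "\<dots> = (\<integral>x. (S 1 x)\<^sup>2 \<partial>P) - (real m * p)\<^sup>2"
    using mean_S1 prob_space by (simp add: power2_eq_square)
  finally have e: "(\<integral>x. (S 1 x - real m * p)\<^sup>2 \<partial>P) = (\<integral>x. (S 1 x)\<^sup>2 \<partial>P) - (real m * p)\<^sup>2" .
  have "a * (real m * p)\<^sup>2 = real m * a1 * (real m * p)"
    unfolding power2_eq_square mult.assoc[symmetric] using a_mp by simp
  then show ?thesis
    using mean_S1_square integral_S2_nonneg unfolding e by (simp add: algebra_simps)
qed

text \<open>Put s = S 1 - m p. Since \<open>drift 0\<close> is - a s, the test function s^3 gives a
  E s^4 = 3 E (s^2 (S 1 - S 2)), and S 1 - S 2 is at most m on the unit cube.\<close>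

lemma fourth_moment_S1: "a * (\<integral>x. (S 1 x - real m * p) ^ 4 \<partial>P) \<le> 3 * real m * (\<integral>x. (S 1 x - real m * p)\<^sup>2 \<partial>P)"
proof -
  let ?s = "\<lambda>x. S 1 x - real m * p"
  have fd: "flow_deriv (flow_time 0) (\<lambda>t x. S 1 (\<lambda>i\<in>{1..m}. x i + t * field 0 (x i)) - real m * p) ?s
    (\<lambda>x. real 1 * (S (1 + 0) x - S (Suc (1 + 0)) x) - 0)"
    by (intro flow_deriv_diff flow_deriv_power_sum_field flow_deriv_const subexp_const flow_time) auto
  have "(\<integral>x. real 3 * ?s x ^ (3 - 1) * (real 1 * (S (1 + 0) x - S (Suc (1 + 0)) x) - 0) + ?s x ^ 3 * drift 0 x \<partial>P) = 0"
    by (rule loop, rule flow_deriv_power[OF fd flow_time(1)])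
  moreover have "real 3 * ?s x ^ (3 - 1) * (real 1 * (S (1 + 0) x - S (Suc (1 + 0)) x) - 0) + ?s x ^ 3 * drift 0 x =
     3 * ((?s x)\<^sup>2 * (S 1 x - S 2 x)) - a * ?s x ^ 4" for x
  proof -
    have d: "drift 0 x = - a * ?s x"
    proof -
      have "a * ?s x = a * S 1 x - real m * a1" by (simp only: right_diff_distrib a_mp)
      then show ?thesis unfolding drift_simps by linarith
    qed
    have "Suc (1 + 0) = (2::nat)" "1 + 0 = (1::nat)" "3 - 1 = (2::nat)" by auto
    then show ?thesis unfolding d by (simp add: eval_nat_numeral One_nat_def algebra_simps)
  qed
  ultimately have "(\<integral>x. 3 * ((?s x)\<^sup>2 * (S 1 x - S 2 x)) - a * ?s x ^ 4 \<partial>P) = 0" by (simp only:)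
  moreover have i1: "integrable P (\<lambda>x. (?s x)\<^sup>2 * (S 1 x - S 2 x))" "integrable P (\<lambda>x. ?s x ^ 4)" "integrable P (\<lambda>x. (?s x)\<^sup>2)"
    by (intro integrable_subexp subexp_intros; measurable)+
  ultimately have eq: "a * (\<integral>x. ?s x ^ 4 \<partial>P) = 3 * (\<integral>x. (?s x)\<^sup>2 * (S 1 x - S 2 x) \<partial>P)" by simp
  have "(\<integral>x. (?s x)\<^sup>2 * (S 1 x - S 2 x) \<partial>P) \<le> (\<integral>x. (?s x)\<^sup>2 * real m \<partial>P)"
  proof (rule integral_mono_AE)
    show "AE x in P. (?s x)\<^sup>2 * (S 1 x - S 2 x) \<le> (?s x)\<^sup>2 * real m"
      using AE_supp
    proof eventually_elim
      case (elim x)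
      have "S 1 x \<le> (\<Sum>i=1..m. 1)" unfolding power_sum_def using supp_I[OF elim] by (intro sum_mono) auto
      then show ?case using power_sum_nonneg[OF elim, of 2] by (intro mult_left_mono) auto
    qed
  qed (use i1 in auto)
  then show ?thesis unfolding eq by (simp add: mult.commute)
qed

text \<open>The test statistic U at the point 2 a x equals a Y x. The same sum is also the quadratic
  term in the bound on the log-likelihood ratio.\<close>

definition Y :: "(nat \<Rightarrow> real) \<Rightarrow> real" where "Y x = S 2 x - 2 * p * S 1 x + real m * p\<^sup>2"

lemma Y_eq: "Y x = (\<Sum>i=1..m. (x i - p)\<^sup>2)"
  unfolding Y_def power_sum_def sum_distrib_left
  by (simp add: power2_diff sum.distrib sum_subtractf sum_distrib_left algebra_simps)

lemma Y_measurable [measurable]: "Y \<in> borel_measurable L"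
  unfolding Y_def by measurable

lemma Y_subexp: "subexp Y"
  unfolding Y_def by (intro subexp_intros)

lemma integrable_Y [simp]: "integrable P Y"
  by (intro integrable_subexp Y_subexp) measurable

lemma mean_Y: "(\<integral>x. Y x \<partial>P) = (\<integral>x. S 2 x \<partial>P) - real m * p\<^sup>2"
  unfolding Y_def using mean_S1 prob_space by (simp add: power2_eq_square)

lemma mean_Y_nonneg: "0 \<le> (\<integral>x. Y x \<partial>P)"
  unfolding Y_eq by (simp add: sum_nonneg)

text \<open>After subtracting m p^2 the leading part a1 of A cancels against a p, so only terms
  governed by \<delta> and the second moment of S 1 survive.\<close>

lemma mean_Y_eq:
  "D * (\<integral>x. Y x \<partial>P) = real m * p * (\<delta> - p * (1 - \<beta> / 2)) - \<beta> / 2 * (\<integral>x. (S 1 x)\<^sup>2 \<partial>P)"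
proof -
  have "D * (real m * p\<^sup>2) = real m * p * (a * p + p * (1 - \<beta> / 2))"
    by (simp add: D_def algebra_simps power2_eq_square)
  then show ?thesis unfolding mean_Y right_diff_distrib mean_S2 a_p A_def by (simp add: algebra_simps)
qed

lemma \<delta>_bounds: "1 \<le> \<delta>" "\<delta> \<le> (1 + \<beta> / 2) * real m"
proof -
  have "0 \<le> \<beta> / 2 * (real m - 1)" using \<beta>_pos m_pos by auto
  then show "1 \<le> \<delta>" by (simp add: \<delta>_def)
  have "1 \<le> real m" using m_pos by simp
  moreover have "\<beta> / 2 * (real m - 1) \<le> \<beta> / 2 * real m" using \<beta>_pos by (intro mult_left_mono) auto
  ultimately show "\<delta> \<le> (1 + \<beta> / 2) * real m" unfolding \<delta>_def distrib_right by linarith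
qed

lemma mean_Y_le: "D * (\<integral>x. Y x \<partial>P) \<le> (1 + \<beta>) * (real m * p) * real m"
proof -
  have "p * (\<beta> / 2) \<le> 1 * (\<beta> / 2)" using p_bounds \<beta>_pos by (intro mult_right_mono) auto
  then have "\<delta> - p * (1 - \<beta> / 2) \<le> \<delta> + \<beta> / 2"
    unfolding right_diff_distrib using p_bounds by linarith
  also have "\<beta> / 2 * 1 \<le> \<beta> / 2 * real m" using \<beta>_pos m_pos by (intro mult_left_mono) auto
  then have "\<delta> + \<beta> / 2 \<le> (1 + \<beta>) * real m"
    using \<delta>_bounds(2) unfolding distrib_right by linarith
  finally have "real m * p * (\<delta> - p * (1 - \<beta> / 2)) \<le> real m * p * ((1 + \<beta>) * real m)"
    using p_bounds by (intro mult_left_mono) auto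
  moreover have "0 \<le> \<beta> / 2 * (\<integral>x. (S 1 x)\<^sup>2 \<partial>P)" using \<beta>_pos by simp
  ultimately show ?thesis unfolding mean_Y_eq by (simp add: algebra_simps)
qed

text \<open>The centre \<open>ce\<close> makes the linear part of \<open>B\<close> vanish at \<open>S\<^sub>1 = m p\<close>, so that
  \<open>D Y\<close> differs from \<open>- B\<close> only by a constant and a negligible quadratic term.\<close>

definition ce :: real where "ce = (2 * p * D + \<beta> * (real m * p) - A) / a"

definition B :: "(nat \<Rightarrow> real) \<Rightarrow> real" where "B x = drift 1 x - ce * drift 0 x"

lemma a_ce: "a * ce = 2 * p * D + \<beta> * (real m * p) - A"
  using a_pos by (simp add: ce_def)

lemma B_eq: "B x = (2 * p * D + \<beta> * (real m * p)) * S 1 x - D * S 2 x - \<beta> / 2 * (S 1 x)\<^sup>2 - ce * (real m * a1)"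
proof -
  have "B x = (A + a * ce) * S 1 x - D * S 2 x - \<beta> / 2 * (S 1 x)\<^sup>2 - ce * (real m * a1)"
    unfolding B_def drift_simps by (simp add: algebra_simps)
  then show ?thesis unfolding a_ce by simp
qed

lemma D_Y_eq: "\<exists>k. \<forall>x. D * Y x - k = - B x - \<beta> / 2 * (S 1 x - real m * p)\<^sup>2"
  by (intro exI[of _ "D * (real m * p\<^sup>2) - ce * (real m * a1) + \<beta> / 2 * (real m * p)\<^sup>2"] allI)
    (simp add: B_eq Y_def power2_diff, simp add: field_simps power2_eq_square)

lemma flow_deriv_B:
  "flow_deriv (flow_time k) (\<lambda>t x. B (\<lambda>i\<in>{1..m}. x i + t * field k (x i))) B
    (\<lambda>x. (2 * p * D - \<beta> * (S 1 x - real m * p)) * (S (1 + k) x - S (2 + k) x) - 2 * D * (S (2 + k) x - S (3 + k) x))"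
proof -
  have "flow_deriv (flow_time k) (\<lambda>t x. B (\<lambda>i\<in>{1..m}. x i + t * field k (x i))) B
    (\<lambda>x. (2 * p * D + \<beta> * (real m * p)) * (real 1 * (S (1 + k) x - S (Suc (1 + k)) x))
      - D * (real 2 * (S (2 + k) x - S (Suc (2 + k)) x))
      - \<beta> / 2 * (real 2 * S 1 x ^ (2 - 1) * (real 1 * (S (1 + k) x - S (Suc (1 + k)) x))) - 0)"
    unfolding B_eq
    by (intro flow_deriv_diff flow_deriv_cmult flow_deriv_power flow_deriv_power_sum_field flow_deriv_const subexp_const flow_time) auto
  moreover have "(\<lambda>x. (2 * p * D + \<beta> * (real m * p)) * (real 1 * (S (1 + k) x - S (Suc (1 + k)) x))
      - D * (real 2 * (S (2 + k) x - S (Suc (2 + k)) x))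
      - \<beta> / 2 * (real 2 * S 1 x ^ (2 - 1) * (real 1 * (S (1 + k) x - S (Suc (1 + k)) x))) - 0) =
    (\<lambda>x. (2 * p * D - \<beta> * (S 1 x - real m * p)) * (S (1 + k) x - S (2 + k) x) - 2 * D * (S (2 + k) x - S (3 + k) x))"
  proof
    fix x
    have e: "Suc (1 + k) = 2 + k" "Suc (2 + k) = 3 + k" "2 - 1 = (1::nat)" by auto
    show "(2 * p * D + \<beta> * (real m * p)) * (real 1 * (S (1 + k) x - S (Suc (1 + k)) x))
      - D * (real 2 * (S (2 + k) x - S (Suc (2 + k)) x))
      - \<beta> / 2 * (real 2 * S 1 x ^ (2 - 1) * (real 1 * (S (1 + k) x - S (Suc (1 + k)) x))) - 0 =
      (2 * p * D - \<beta> * (S 1 x - real m * p)) * (S (1 + k) x - S (2 + k) x) - 2 * D * (S (2 + k) x - S (3 + k) x)"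
      unfolding e by (simp add: algebra_simps)
  qed
  ultimately show ?thesis by simp
qed

text \<open>The derivative of S 1 along the combined field \<open>field 1 - ce * field 0\<close>,
  whose drift is \<open>B\<close>.\<close>

definition G :: "(nat \<Rightarrow> real) \<Rightarrow> real" where "G x = (S 2 x - S 3 x) - ce * (S 1 x - S 2 x)"

definition Z :: "(nat \<Rightarrow> real) \<Rightarrow> real" where "Z x = (\<Sum>i=1..m. (x i - p)\<^sup>2 * (1 - x i - p))"

lemma Z_measurable [measurable]: "Z \<in> borel_measurable L" unfolding Z_def by measurable

lemma Z_subexp: "subexp Z" unfolding Z_def by (intro subexp_intros) auto

text \<open>\<open>B\<close> is itself the drift of \<open>field 1 - ce * field 0\<close>, so the
  loop equation with test function \<open>B\<close> identifies E (B^2) with minus the mean of the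
  derivative of \<open>B\<close> along that field. The derivative of the (S 1)^2 part produces
  \<open>G\<close>; the rest is regrouped around p.\<close>

lemma second_moment_B:
  "(\<integral>x. (B x)\<^sup>2 \<partial>P) = \<beta> * (\<integral>x. (S 1 x - real m * p) * G x \<partial>P)
     + 2 * D * ((\<integral>x. (S 3 x - S 4 x) - 2 * p * (S 2 x - S 3 x) + p\<^sup>2 * (S 1 x - S 2 x) \<partial>P)
        + (p - ce) * (\<integral>x. Z x \<partial>P))"
proof -
  let ?s = "\<lambda>x. S 1 x - real m * p"
  have e: "1 + 0 = (1::nat)" "2 + 0 = (2::nat)" "3 + 0 = (3::nat)" "1 + 1 = (2::nat)" "2 + 1 = (3::nat)" "3 + 1 = (4::nat)" by auto
  \<comment> \<open>From x (1 - x) = p (1 - p) + (x - p) (1 - x - p): the sum of x (1 - x) (x - p)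
    is \<open>Z\<close> plus a multiple of the centred S 1, which has mean zero. Unlike the original
    sum, \<open>Z\<close> is of the size of \<open>Y\<close>.\<close>
  have Zs: "Z x + p * (1 - p) * ?s x = S 2 x - S 3 x - p * (S 1 x - S 2 x)" for x
  proof -
    have "Z x + p * (1 - p) * ?s x = (\<Sum>i=1..m. (x i - p)\<^sup>2 * (1 - x i - p) + p * (1 - p) * (x i - p))"
      unfolding Z_def power_sum_def by (simp add: sum.distrib sum_subtractf sum_distrib_left right_diff_distrib)
    also have "\<dots> = (\<Sum>i=1..m. x i ^ 2 - x i ^ 3 - p * (x i ^ 1 - x i ^ 2))"
      by (intro sum.cong refl) (simp add: power2_eq_square power3_eq_cube algebra_simps)
    finally show ?thesis unfolding power_sum_def by (simp add: sum_subtractf sum_distrib_left right_diff_distrib)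
  qed
  have l0: "(\<integral>x. (2 * p * D - \<beta> * ?s x) * (S 1 x - S 2 x) - 2 * D * (S 2 x - S 3 x) + B x * drift 0 x \<partial>P) = 0"
    using loop[OF flow_deriv_B[of 0]] unfolding e .
  have l1: "(\<integral>x. (2 * p * D - \<beta> * ?s x) * (S 2 x - S 3 x) - 2 * D * (S 3 x - S 4 x) + B x * drift 1 x \<partial>P) = 0"
    using loop[OF flow_deriv_B[of 1]] unfolding e .
  have Bm[measurable]: "B \<in> borel_measurable L" unfolding B_eq by measurable
  have dm[measurable]: "drift k \<in> borel_measurable L" for k
    unfolding drift_def pair_power_sum_def by measurable
  have Bs: "subexp B" unfolding B_eq by (intro subexp_intros)
  have ds: "subexp (drift 0)" "subexp (drift 1)"
    unfolding drift_fun by (intro subexp_intros)+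
  let ?i0 = "\<lambda>x. (2 * p * D - \<beta> * ?s x) * (S 1 x - S 2 x) - 2 * D * (S 2 x - S 3 x) + B x * drift 0 x"
  let ?i1 = "\<lambda>x. (2 * p * D - \<beta> * ?s x) * (S 2 x - S 3 x) - 2 * D * (S 3 x - S 4 x) + B x * drift 1 x"
  let ?q = "\<lambda>x. (S 3 x - S 4 x) - 2 * p * (S 2 x - S 3 x) + p\<^sup>2 * (S 1 x - S 2 x)"
  have i0: "integrable P ?i0" and i1: "integrable P ?i1"
    by (intro integrable_subexp subexp_intros Bs ds; measurable)+
  have iG: "integrable P (\<lambda>x. ?s x * G x)" unfolding G_def
    by (intro integrable_subexp subexp_intros; measurable)
  have iZ: "integrable P Z" by (intro integrable_subexp Z_subexp; measurable)
  have iq: "integrable P ?q" by (intro integrable_subexp subexp_intros; measurable)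
  have iS: "integrable P ?s" by (intro integrable_subexp subexp_intros; measurable)
  have "(B x)\<^sup>2 = (?i1 x - ce * ?i0 x) + \<beta> * (?s x * G x) + 2 * D * (?q x + (p - ce) * Z x + (p - ce) * (p * (1 - p)) * ?s x)" for x
  proof -
    have "(p - ce) * Z x + (p - ce) * (p * (1 - p)) * ?s x = (p - ce) * (S 2 x - S 3 x - p * (S 1 x - S 2 x))"
      unfolding Zs[symmetric] by (simp add: algebra_simps)
    then have r: "?q x + (p - ce) * Z x + (p - ce) * (p * (1 - p)) * ?s x = ?q x + (p - ce) * (S 2 x - S 3 x - p * (S 1 x - S 2 x))"
      by simp
    have "(B x)\<^sup>2 = B x * drift 1 x - ce * (B x * drift 0 x)" by (simp add: B_def power2_eq_square algebra_simps)
    then show ?thesis unfolding r G_def by (simp add: algebra_simps power2_eq_square)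
  qed
  then have "(\<integral>x. (B x)\<^sup>2 \<partial>P) = (\<integral>x. (?i1 x - ce * ?i0 x) + \<beta> * (?s x * G x) + 2 * D * (?q x + (p - ce) * Z x + (p - ce) * (p * (1 - p)) * ?s x) \<partial>P)"
    by (simp only:)
  also have "\<dots> = ((\<integral>x. ?i1 x \<partial>P) - ce * (\<integral>x. ?i0 x \<partial>P)) + \<beta> * (\<integral>x. ?s x * G x \<partial>P)
     + 2 * D * ((\<integral>x. ?q x \<partial>P) + (p - ce) * (\<integral>x. Z x \<partial>P) + (p - ce) * (p * (1 - p)) * (\<integral>x. ?s x \<partial>P))"
    using i0 i1 iG iZ iq iS
    by (simp only: Bochner_Integration.integral_add Bochner_Integration.integral_diff Bochner_Integration.integrable_add
        Bochner_Integration.integrable_diff integrable_mult_right integral_mult_right_zero)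
  finally show ?thesis unfolding l0 l1 mean_S1_centred by simp
qed

end

section \<open>Bounds for the second moments of \<open>B\<close> and \<open>Y\<close>\<close>

context jacobi_moments
begin

lemma power_sum_antimono:
  assumes "x \<in> supp" shows "S (Suc k) x \<le> S k x"
  unfolding power_sum_def
proof (intro sum_mono)
  fix i assume "i \<in> {1..m}"
  with supp_I[OF assms this] show "x i ^ Suc k \<le> x i ^ k" by (intro power_decreasing) auto
qed

lemma G_bound:
  assumes x: "x \<in> supp" shows "\<bar>G x\<bar> \<le> (1 + \<bar>ce\<bar>) * S 1 x"
proof -
  have "S 2 x \<le> S 1 x" "S 3 x \<le> S 2 x" "0 \<le> S 3 x" "0 \<le> S 2 x"
    using power_sum_antimono[OF x, of 1] power_sum_antimono[OF x, of 2] power_sum_nonneg[OF x] by auto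
  then have 1: "\<bar>S 2 x - S 3 x\<bar> \<le> S 1 x" "\<bar>S 1 x - S 2 x\<bar> \<le> S 1 x" by linarith+
  have "\<bar>G x\<bar> \<le> \<bar>S 2 x - S 3 x\<bar> + \<bar>ce\<bar> * \<bar>S 1 x - S 2 x\<bar>"
    unfolding G_def abs_mult[symmetric] by (rule abs_triangle_ineq4)
  also have "\<dots> \<le> S 1 x + \<bar>ce\<bar> * S 1 x" using 1 by (intro add_mono mult_left_mono) auto
  finally show ?thesis by (simp add: algebra_simps)
qed

lemma Z_bound:
  assumes x: "x \<in> supp" shows "\<bar>Z x\<bar> \<le> Y x"
proof -
  have "\<bar>Z x\<bar> \<le> (\<Sum>i=1..m. \<bar>(x i - p)\<^sup>2 * (1 - x i - p)\<bar>)" unfolding Z_def by (rule sum_abs)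
  also have "\<dots> \<le> (\<Sum>i=1..m. (x i - p)\<^sup>2)"
  proof (rule sum_mono)
    fix i assume "i \<in> {1..m}"
    then have "\<bar>1 - x i - p\<bar> \<le> 1" using supp_I[OF x, of i] p_bounds by auto
    then have "(x i - p)\<^sup>2 * \<bar>1 - x i - p\<bar> \<le> (x i - p)\<^sup>2 * 1" by (intro mult_left_mono) auto
    then show "\<bar>(x i - p)\<^sup>2 * (1 - x i - p)\<bar> \<le> (x i - p)\<^sup>2" by (simp add: abs_mult)
  qed
  finally show ?thesis by (simp add: Y_eq)
qed

text \<open>The mean of the sum of x_i (x_i - p)^2. The form in terms of E (S 3), E (S 2) and E (S
  1) is the one to which the loop equations apply.\<close>

definition third :: real where
  "third = (\<integral>x. S 3 x \<partial>P) - 2 * p * (\<integral>x. S 2 x \<partial>P) + p\<^sup>2 * (\<integral>x. S 1 x \<partial>P)"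

lemma third_eq: "third = (\<integral>x. S 3 x - 2 * p * S 2 x + p\<^sup>2 * S 1 x \<partial>P)"
  unfolding third_def by simp

lemma third_nonneg: "0 \<le> third"
  unfolding third_eq
proof (rule integral_nonneg_AE)
  show "AE x in P. 0 \<le> S 3 x - 2 * p * S 2 x + p\<^sup>2 * S 1 x"
    using AE_supp
  proof eventually_elim
    case (elim x)
    have "S 3 x - 2 * p * S 2 x + p\<^sup>2 * S 1 x = (\<Sum>i=1..m. x i * (x i - p)\<^sup>2)"
      unfolding power_sum_def sum_distrib_left sum_subtractf[symmetric] sum.distrib[symmetric]
      by (intro sum.cong refl) (simp add: power2_eq_square power3_eq_cube algebra_simps)
    also have "\<dots> \<ge> 0" using supp_nonneg[OF elim] by (intro sum_nonneg mult_nonneg_nonneg) auto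
    finally show ?case .
  qed
qed

lemma second_moment_B_le:
  "(\<integral>x. (B x)\<^sup>2 \<partial>P) \<le> \<beta> * ((1 + \<bar>ce\<bar>) / 2 * ((\<integral>x. (S 1 x - real m * p)\<^sup>2 \<partial>P) + (\<integral>x. (S 1 x)\<^sup>2 \<partial>P)))
     + 2 * \<bar>D\<bar> * (third + \<bar>p - ce\<bar> * (\<integral>x. Y x \<partial>P))"
  if "D \<ge> 0"
proof -
  have iS: "integrable P (\<lambda>x. (S 1 x - real m * p) * G x)" "integrable P (\<lambda>x. (S 1 x - real m * p)\<^sup>2)"
    "integrable P (\<lambda>x. S 3 x - S 4 x - 2 * p * (S 2 x - S 3 x) + p\<^sup>2 * (S 1 x - S 2 x))"
    "integrable P (\<lambda>x. S 3 x - 2 * p * S 2 x + p\<^sup>2 * S 1 x)"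
    unfolding G_def by (intro integrable_subexp subexp_intros; measurable)+
  have iZ: "integrable P Z" by (intro integrable_subexp Z_subexp; measurable)
  have 1: "(\<integral>x. (S 1 x - real m * p) * G x \<partial>P) \<le> (1 + \<bar>ce\<bar>) / 2 * ((\<integral>x. (S 1 x - real m * p)\<^sup>2 \<partial>P) + (\<integral>x. (S 1 x)\<^sup>2 \<partial>P))"
  proof -
    have "(\<integral>x. (S 1 x - real m * p) * G x \<partial>P) \<le> (\<integral>x. (1 + \<bar>ce\<bar>) / 2 * ((S 1 x - real m * p)\<^sup>2 + (S 1 x)\<^sup>2) \<partial>P)"
    proof (rule integral_mono_AE)
      show "AE x in P. (S 1 x - real m * p) * G x \<le> (1 + \<bar>ce\<bar>) / 2 * ((S 1 x - real m * p)\<^sup>2 + (S 1 x)\<^sup>2)"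
        using AE_supp
      proof eventually_elim
        case (elim x)
        have "(S 1 x - real m * p) * G x \<le> \<bar>S 1 x - real m * p\<bar> * \<bar>G x\<bar>" by (metis abs_ge_self abs_mult)
        also have "\<dots> \<le> \<bar>S 1 x - real m * p\<bar> * ((1 + \<bar>ce\<bar>) * S 1 x)" using G_bound[OF elim] by (intro mult_left_mono) auto
        also have "\<dots> = (1 + \<bar>ce\<bar>) / 2 * (2 * \<bar>S 1 x - real m * p\<bar> * S 1 x)" by (simp add: field_simps)
        also have "\<dots> \<le> (1 + \<bar>ce\<bar>) / 2 * (\<bar>S 1 x - real m * p\<bar>\<^sup>2 + (S 1 x)\<^sup>2)"
          by (intro mult_left_mono sum_squares_bound) auto
        finally show ?case by simp
      qed
    qed (use iS in auto)
    then show ?thesis using iS by simp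
  qed
  have 2: "(p - ce) * (\<integral>x. Z x \<partial>P) \<le> \<bar>p - ce\<bar> * (\<integral>x. Y x \<partial>P)"
  proof -
    have "\<bar>\<integral>x. Z x \<partial>P\<bar> \<le> (\<integral>x. \<bar>Z x\<bar> \<partial>P)" by (rule integral_abs_bound)
    also have "\<dots> \<le> (\<integral>x. Y x \<partial>P)"
      using iZ AE_supp Z_bound by (intro integral_mono_AE) auto
    finally have le: "\<bar>\<integral>x. Z x \<partial>P\<bar> \<le> (\<integral>x. Y x \<partial>P)" .
    have "(p - ce) * (\<integral>x. Z x \<partial>P) \<le> \<bar>(p - ce) * (\<integral>x. Z x \<partial>P)\<bar>" by (rule abs_ge_self)
    also have "\<dots> = \<bar>p - ce\<bar> * \<bar>\<integral>x. Z x \<partial>P\<bar>" by (rule abs_mult)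
    also have "\<dots> \<le> \<bar>p - ce\<bar> * (\<integral>x. Y x \<partial>P)" by (rule mult_left_mono[OF le abs_ge_zero])
    finally show ?thesis .
  qed
  have 3: "(\<integral>x. S 3 x - S 4 x - 2 * p * (S 2 x - S 3 x) + p\<^sup>2 * (S 1 x - S 2 x) \<partial>P) \<le> third"
    unfolding third_eq
  proof (rule integral_mono)
    fix x
    \<comment> \<open>Adding this nonnegative sum replaces the factor x (1 - x) by x and leads to
      \<open>third\<close>.\<close>
    have "0 \<le> (\<Sum>i=1..m. (x i * (x i - p))\<^sup>2)" by (intro sum_nonneg) auto
    also have "\<dots> = S 4 x - 2 * p * S 3 x + p\<^sup>2 * S 2 x"
      unfolding power_sum_def sum_distrib_left sum_subtractf[symmetric] sum.distrib[symmetric]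
      by (intro sum.cong refl) (simp add: eval_nat_numeral One_nat_def algebra_simps)
    finally show "S 3 x - S 4 x - 2 * p * (S 2 x - S 3 x) + p\<^sup>2 * (S 1 x - S 2 x) \<le> S 3 x - 2 * p * S 2 x + p\<^sup>2 * S 1 x"
      by (simp add: algebra_simps)
  qed (use iS in auto)
  have "\<beta> * (\<integral>x. (S 1 x - real m * p) * G x \<partial>P) \<le> \<beta> * ((1 + \<bar>ce\<bar>) / 2 * ((\<integral>x. (S 1 x - real m * p)\<^sup>2 \<partial>P) + (\<integral>x. (S 1 x)\<^sup>2 \<partial>P)))"
    using 1 \<beta>_pos by (intro mult_left_mono) auto
  moreover have "2 * D * ((\<integral>x. S 3 x - S 4 x - 2 * p * (S 2 x - S 3 x) + p\<^sup>2 * (S 1 x - S 2 x) \<partial>P) + (p - ce) * (\<integral>x. Z x \<partial>P))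
    \<le> 2 * \<bar>D\<bar> * (third + \<bar>p - ce\<bar> * (\<integral>x. Y x \<partial>P))"
    unfolding abs_of_nonneg[OF that] by (rule mult_left_mono[OF add_mono[OF 3 2]]) (use that in simp)
  ultimately show ?thesis unfolding second_moment_B by linarith
qed

text \<open>Inserting the loop identity for S 3, the terms of order a1 m p^2 cancel because a p =
  a1. The contributions - a1 E Y and - \<beta> E (S 1 * S 2) are nonpositive and get dropped, so the
  right-hand side has no term of order a1.\<close>

lemma third_le: "(a + 2 - \<beta>) * third \<le> (2 + 3 * \<beta>) * real m * (real m * p\<^sup>2 + (\<integral>x. Y x \<partial>P)) + \<beta> / 2 * (\<integral>x. (S 1 x)\<^sup>2 \<partial>P)"
proof -
  define y where "y = (\<integral>x. Y x \<partial>P)"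
  define v where "v = (\<integral>x. (S 1 x)\<^sup>2 \<partial>P)"
  define w where "w = (\<integral>x. S 1 x * S 2 x \<partial>P)"
  have u2: "(\<integral>x. S 2 x \<partial>P) = real m * p\<^sup>2 + y" using mean_Y by (simp add: y_def)
  have w: "0 \<le> w" unfolding w_def
  proof (rule integral_nonneg_AE)
    show "AE x in P. 0 \<le> S 1 x * S 2 x"
      using AE_supp by eventually_elim (intro mult_nonneg_nonneg power_sum_nonneg)
  qed
  have y: "0 \<le> y" unfolding y_def by (rule mean_Y_nonneg)
  have eq: "(a + 2 - \<beta>) * third = real m * p\<^sup>2 * (1 - \<beta> / 2 + \<delta> - p * (2 - \<beta>)) +
      y * (1 - \<beta> / 2 + \<delta> - a1 - 2 * p * (2 - \<beta>)) + \<beta> / 2 * v - \<beta> * w"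
  proof -
    have "(a + 2 - \<beta>) * third = (a + 2 - \<beta>) * (\<integral>x. S 3 x \<partial>P) - 2 * p * (a + 2 - \<beta>) * (real m * p\<^sup>2 + y) + p\<^sup>2 * (a + 2 - \<beta>) * (real m * p)"
      unfolding third_def u2 mean_S1 by (simp add: algebra_simps)
    also have "\<dots> = (A + 1 - \<beta> / 2) * (real m * p\<^sup>2 + y) + \<beta> / 2 * v - \<beta> * w
       - 2 * (a * p + p * (2 - \<beta>)) * (real m * p\<^sup>2 + y) + (a * p + p * (2 - \<beta>)) * (real m * p\<^sup>2)"
      unfolding mean_S3 u2 v_def[symmetric] w_def[symmetric] by (simp add: algebra_simps power2_eq_square)
    finally show ?thesis unfolding a_p A_def by (simp add: algebra_simps)
  qed
  have m1: "1 \<le> real m" using m_pos by simp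
  have pb: "0 \<le> p * \<beta>" "p * \<beta> \<le> \<beta>" using p_bounds \<beta>_pos mult_right_mono[of p 1 \<beta>] by auto
  have "1 - \<beta> / 2 + \<delta> - p * (2 - \<beta>) \<le> 1 + \<delta> + \<beta> / 2" unfolding right_diff_distrib using pb p_bounds by linarith
  also have *: "1 + \<delta> + 2 * \<beta> \<le> (2 + 3 * \<beta>) * real m"
  proof -
    have "(1 + 2 * \<beta>) * 1 \<le> (1 + 2 * \<beta>) * real m" using m1 \<beta>_pos by (intro mult_left_mono) auto
    moreover have "0 \<le> \<beta> * real m" using \<beta>_pos by simp
    ultimately show ?thesis using \<delta>_bounds(2) by (simp add: algebra_simps)
  qed
  then have "1 + \<delta> + \<beta> / 2 \<le> (2 + 3 * \<beta>) * real m" using \<beta>_pos by linarith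
  finally have b1: "1 - \<beta> / 2 + \<delta> - p * (2 - \<beta>) \<le> (2 + 3 * \<beta>) * real m" .
  have b2: "1 - \<beta> / 2 + \<delta> - a1 - 2 * p * (2 - \<beta>) \<le> (2 + 3 * \<beta>) * real m"
  proof -
    have "1 - \<beta> / 2 + \<delta> - a1 - 2 * p * (2 - \<beta>) \<le> 1 + \<delta> + 2 * \<beta>"
    proof -
      have "1 - \<beta> / 2 + \<delta> - a1 - 2 * p * (2 - \<beta>) = 1 - \<beta> / 2 + \<delta> - a1 - 4 * p + 2 * (p * \<beta>)" by (simp add: algebra_simps)
      then show ?thesis using pb p_bounds a1_pos \<beta>_pos by linarith
    qed
    then show ?thesis using * by linarith
  qed
  have "real m * p\<^sup>2 * (1 - \<beta> / 2 + \<delta> - p * (2 - \<beta>)) \<le> real m * p\<^sup>2 * ((2 + 3 * \<beta>) * real m)"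
    using b1 by (intro mult_left_mono) auto
  moreover have "y * (1 - \<beta> / 2 + \<delta> - a1 - 2 * p * (2 - \<beta>)) \<le> y * ((2 + 3 * \<beta>) * real m)"
    using b2 y by (intro mult_left_mono) auto
  moreover have "0 \<le> \<beta> * w" using w \<beta>_pos by simp
  ultimately have "(a + 2 - \<beta>) * third \<le> real m * p\<^sup>2 * ((2 + 3 * \<beta>) * real m) + y * ((2 + 3 * \<beta>) * real m) + \<beta> / 2 * v"
    unfolding eq by linarith
  then show ?thesis unfolding y_def[symmetric] v_def[symmetric] by (simp add: algebra_simps)
qed

text \<open>\<open>K\<close> is a common bound for the mean m p of S 1 and for m^2 / a. Every
  estimate here is in terms of \<beta> and \<open>K\<close> alone, hence uniform along a family of
  parameters.\<close>

context
  fixes K :: real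
  assumes K1: "K \<ge> 1" and a_ge: "a \<ge> 2 * (1 + \<beta>)" and mp_le: "real m * p \<le> K" and m_le: "(real m)\<^sup>2 \<le> K * a"
begin

lemma a_ge_1: "1 \<le> a"
proof -
  have "2 + 2 * \<beta> \<le> a" using a_ge by (simp add: algebra_simps)
  then show ?thesis using \<beta>_pos by linarith
qed

lemma D_bounds: "a / 2 \<le> D" "D \<le> 2 * a" "0 < D" "a / 2 \<le> a + 2 - \<beta>"
  using a_ge \<beta>_pos by (auto simp: D_def)

lemma m_ge_1: "1 \<le> real m" using m_pos by simp

lemma m_le_K_a: "real m \<le> K * a"
proof -
  have "real m * 1 \<le> real m * real m" using m_ge_1 by (intro mult_left_mono) auto
  then show ?thesis using m_le by (simp add: power2_eq_square)
qed

text \<open>E Y is O(m / a) by \<open>mean_Y_le\<close>, so the additional factor m costs m^2 / a,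
  which is at most \<open>K\<close>. This factor has to be paid because a |p - ce| is only
  O(m).\<close>

lemma m_mean_Y_le: "real m * (\<integral>x. Y x \<partial>P) \<le> 2 * (1 + \<beta>) * K\<^sup>2"
proof -
  let ?y = "\<integral>x. Y x \<partial>P"
  have y: "0 \<le> ?y" by (rule mean_Y_nonneg)
  have "a / 2 * ?y \<le> D * ?y" using D_bounds y by (intro mult_right_mono) auto
  also have "\<dots> \<le> (1 + \<beta>) * (real m * p) * real m" by (rule mean_Y_le)
  also have "\<dots> \<le> (1 + \<beta>) * K * real m" using mp_le \<beta>_pos by (intro mult_right_mono mult_left_mono) auto
  finally have "real m * (a / 2 * ?y) \<le> real m * ((1 + \<beta>) * K * real m)" by (intro mult_left_mono) auto
  also have "\<dots> = (1 + \<beta>) * K * (real m)\<^sup>2" by (simp add: power2_eq_square)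
  also have "\<dots> \<le> (1 + \<beta>) * K * (K * a)" using m_le K1 \<beta>_pos by (intro mult_left_mono) auto
  finally have "a * (real m * ?y) \<le> a * (2 * (1 + \<beta>) * K\<^sup>2)" by (simp add: power2_eq_square algebra_simps)
  then show ?thesis using a_pos by simp
qed

lemma mean_S1_square_bound: "(\<integral>x. (S 1 x)\<^sup>2 \<partial>P) \<le> (K + 1) * K"
proof -
  have mp0: "0 \<le> real m * p" using p_bounds by simp
  have "a * (\<integral>x. (S 1 x)\<^sup>2 \<partial>P) \<le> (a * (real m * p) + 1) * (real m * p)"
    using mean_S1_square_le unfolding a_mp .
  also have "\<dots> \<le> (a * K + a) * K"
    using mp_le mp0 a_pos a_ge_1 K1 by (intro mult_mono add_mono mult_left_mono) auto
  also have "\<dots> = a * ((K + 1) * K)" by (simp add: algebra_simps)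
  finally show ?thesis using a_pos by simp
qed

lemma variance_S1_bound: "(\<integral>x. (S 1 x - real m * p)\<^sup>2 \<partial>P) \<le> K"
proof -
  have v: "0 \<le> (\<integral>x. (S 1 x - real m * p)\<^sup>2 \<partial>P)" by simp
  have "1 * (\<integral>x. (S 1 x - real m * p)\<^sup>2 \<partial>P) \<le> a * (\<integral>x. (S 1 x - real m * p)\<^sup>2 \<partial>P)"
    using a_ge_1 v by (intro mult_right_mono) auto
  then show ?thesis using variance_S1_le mp_le by linarith
qed

lemma fourth_moment_S1_bound: "(\<integral>x. (S 1 x - real m * p) ^ 4 \<partial>P) \<le> 3 * K\<^sup>2"
proof -
  let ?v = "\<integral>x. (S 1 x - real m * p)\<^sup>2 \<partial>P"
  have "a * (\<integral>x. (S 1 x - real m * p) ^ 4 \<partial>P) \<le> 3 * real m * ?v" by (rule fourth_moment_S1)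
  also have "\<dots> \<le> 3 * (K * a) * K" using m_le_K_a variance_S1_bound K1 a_pos by (intro mult_mono mult_left_mono) auto
  also have "\<dots> = a * (3 * K\<^sup>2)" by (simp add: power2_eq_square)
  finally show ?thesis using a_pos by simp
qed

lemma ce_bound: "\<bar>ce\<bar> \<le> 5 + (1 + 2 * \<beta>) * K"
proof -
  define X where "X = p * D"
  define y where "y = \<beta> * (real m * p)"
  define U where "U = K * a"
  define V where "V = \<beta> * (K * a)"
  have "p * D \<le> 1 * D" using p_bounds D_bounds by (intro mult_right_mono) auto
  then have X: "X \<le> 2 * a" unfolding X_def using D_bounds by linarith
  have X0: "0 \<le> X" using p_bounds D_bounds by (simp add: X_def)
  have "K * 1 \<le> K * a" using K1 a_ge_1 by (intro mult_left_mono) auto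
  then have "real m * p \<le> K * a" using mp_le by linarith
  then have "\<beta> * (real m * p) \<le> \<beta> * (K * a)" using \<beta>_pos by (intro mult_left_mono) auto
  then have y: "0 \<le> y" "y \<le> V"
    using p_bounds \<beta>_pos by (auto simp: y_def V_def)
  have U: "0 \<le> U" "0 \<le> V" using K1 a_pos \<beta>_pos by (auto simp: U_def V_def)
  have "(1 + \<beta> / 2) * real m \<le> (1 + \<beta> / 2) * (K * a)" using m_le_K_a \<beta>_pos by (intro mult_left_mono) auto
  also have "\<dots> = U + V / 2" by (simp add: U_def V_def algebra_simps)
  finally have A: "0 \<le> A" "A \<le> a + U + V / 2" using \<delta>_bounds a1_pos a2_pos unfolding A_def a_def by linarith+
  have "a * ce = 2 * X + y - A" unfolding a_ce X_def y_def by simp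
  then have "\<bar>a * ce\<bar> \<le> 5 * a + U + 2 * V" using X X0 y U A by (simp add: abs_le_iff)
  then have "a * \<bar>ce\<bar> \<le> a * (5 + (1 + 2 * \<beta>) * K)" using a_pos by (simp add: abs_mult U_def V_def algebra_simps)
  then show ?thesis using a_pos by simp
qed

text \<open>The centre \<open>ce\<close> is built so that the terms of order a in a (p - ce) cancel,
  leaving \<delta> and bounded terms. So p - ce is O(m / a), whereas \<open>ce\<close> by itself is
  only O(1).\<close>

lemma p_ce_bound: "a * \<bar>p - ce\<bar> \<le> real m * (3 + 2 * \<beta> + \<beta> * K)"
proof -
  have eq: "a * (p - ce) = \<delta> - 2 * p + p * \<beta> - \<beta> * (real m * p)"
  proof -
    have "a * (p - ce) = a * p - 2 * (a * p + p * (1 - \<beta> / 2)) - \<beta> * (real m * p) + A"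
      unfolding right_diff_distrib a_ce D_def by (simp add: algebra_simps)
    then show ?thesis unfolding a_p A_def by (simp add: algebra_simps)
  qed
  have pb: "0 \<le> p * \<beta>" "p * \<beta> \<le> \<beta>" using p_bounds \<beta>_pos mult_right_mono[of p 1 \<beta>] by auto
  have mb: "0 \<le> \<beta> * (real m * p)" "\<beta> * (real m * p) \<le> \<beta> * K"
    using p_bounds \<beta>_pos mp_le by (auto intro!: mult_left_mono)
  have "\<bar>a * (p - ce)\<bar> \<le> \<delta> + 2 + \<beta> + \<beta> * K"
    unfolding eq abs_le_iff using pb mb p_bounds \<delta>_bounds(1) by linarith
  also have "(2 + \<beta> + \<beta> * K) * 1 \<le> (2 + \<beta> + \<beta> * K) * real m" using \<beta>_pos K1 m_ge_1 by (intro mult_left_mono) auto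
  then have "\<delta> + 2 + \<beta> + \<beta> * K \<le> real m * (3 + 2 * \<beta> + \<beta> * K)"
  proof -
    have "0 \<le> \<beta> * real m" using \<beta>_pos by simp
    then show ?thesis using \<delta>_bounds \<open>(2 + \<beta> + \<beta> * K) * 1 \<le> (2 + \<beta> + \<beta> * K) * real m\<close> by (simp add: algebra_simps)
  qed
  finally show ?thesis using a_pos by (simp add: abs_mult)
qed

lemma a_third_bound: "a * third \<le> 2 * ((2 + 3 * \<beta>) * (K\<^sup>2 + 2 * (1 + \<beta>) * K\<^sup>2) + \<beta> / 2 * ((K + 1) * K))"
proof -
  let ?y = "\<integral>x. Y x \<partial>P"
  have mp2: "real m * (real m * p\<^sup>2) \<le> K\<^sup>2"
  proof -
    have "(real m * p)\<^sup>2 \<le> K\<^sup>2" using mp_le p_bounds by (intro power_mono) auto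
    then show ?thesis by (simp add: power2_eq_square algebra_simps)
  qed
  have "a / 2 * third \<le> (a + 2 - \<beta>) * third" using D_bounds third_nonneg by (intro mult_right_mono) auto
  also have "\<dots> \<le> (2 + 3 * \<beta>) * real m * (real m * p\<^sup>2 + ?y) + \<beta> / 2 * (\<integral>x. (S 1 x)\<^sup>2 \<partial>P)" by (rule third_le)
  also have "\<dots> = (2 + 3 * \<beta>) * (real m * (real m * p\<^sup>2) + real m * ?y) + \<beta> / 2 * (\<integral>x. (S 1 x)\<^sup>2 \<partial>P)"
    by (simp add: algebra_simps)
  also have "\<dots> \<le> (2 + 3 * \<beta>) * (K\<^sup>2 + 2 * (1 + \<beta>) * K\<^sup>2) + \<beta> / 2 * ((K + 1) * K)"
    using mp2 m_mean_Y_le mean_S1_square_bound \<beta>_pos by (intro add_mono mult_left_mono) auto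
  finally show ?thesis by simp
qed

definition C_third :: real where
  "C_third = 2 * ((2 + 3 * \<beta>) * (K\<^sup>2 + 2 * (1 + \<beta>) * K\<^sup>2) + \<beta> / 2 * ((K + 1) * K))"

definition C_B :: real where
  "C_B = \<beta> * ((1 + (5 + (1 + 2 * \<beta>) * K)) / 2 * (K + (K + 1) * K))
     + 4 * (C_third + (3 + 2 * \<beta> + \<beta> * K) * (2 * (1 + \<beta>) * K\<^sup>2))"

lemma second_moment_B_bound: "(\<integral>x. (B x)\<^sup>2 \<partial>P) \<le> C_B"
proof -
  let ?y = "\<integral>x. Y x \<partial>P"
  have "(\<integral>x. (B x)\<^sup>2 \<partial>P) \<le> \<beta> * ((1 + \<bar>ce\<bar>) / 2 * ((\<integral>x. (S 1 x - real m * p)\<^sup>2 \<partial>P) + (\<integral>x. (S 1 x)\<^sup>2 \<partial>P)))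
     + 2 * \<bar>D\<bar> * (third + \<bar>p - ce\<bar> * ?y)"
    using D_bounds by (intro second_moment_B_le) auto
  also have "\<dots> \<le> C_B"
    unfolding C_B_def
  proof (rule add_mono)
    show "\<beta> * ((1 + \<bar>ce\<bar>) / 2 * ((\<integral>x. (S 1 x - real m * p)\<^sup>2 \<partial>P) + (\<integral>x. (S 1 x)\<^sup>2 \<partial>P)))
      \<le> \<beta> * ((1 + (5 + (1 + 2 * \<beta>) * K)) / 2 * (K + (K + 1) * K))"
      using \<beta>_pos ce_bound variance_S1_bound mean_S1_square_bound by (intro mult_left_mono mult_mono) auto
    have "0 \<le> third + \<bar>p - ce\<bar> * ?y" using third_nonneg mean_Y_nonneg by simp
    then have "2 * \<bar>D\<bar> * (third + \<bar>p - ce\<bar> * ?y) \<le> 2 * (2 * a) * (third + \<bar>p - ce\<bar> * ?y)"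
      using D_bounds by (intro mult_right_mono) auto
    also have "\<dots> = 4 * (a * third + (a * \<bar>p - ce\<bar>) * ?y)" by (simp add: algebra_simps)
    also have "\<dots> \<le> 4 * (C_third + (real m * (3 + 2 * \<beta> + \<beta> * K)) * ?y)"
      using a_third_bound p_ce_bound mean_Y_nonneg by (intro mult_left_mono add_mono mult_right_mono) (auto simp: C_third_def)
    also have "\<dots> = 4 * (C_third + (3 + 2 * \<beta> + \<beta> * K) * (real m * ?y))" by (simp add: algebra_simps)
    also have "\<dots> \<le> 4 * (C_third + (3 + 2 * \<beta> + \<beta> * K) * (2 * (1 + \<beta>) * K\<^sup>2))"
      using m_mean_Y_le \<beta>_pos K1 by (intro mult_left_mono add_mono) auto
    finally show "2 * \<bar>D\<bar> * (third + \<bar>p - ce\<bar> * ?y) \<le> 4 * (C_third + (3 + 2 * \<beta> + \<beta> * K) * (2 * (1 + \<beta>) * K\<^sup>2))" .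
  qed
  finally show ?thesis .
qed

text \<open>By \<open>D_Y_eq\<close> the deviation of D Y from a constant is controlled by
  \<open>B\<close> and by the squared deviation of S 1, that is, by the second moment of
  \<open>B\<close> and the fourth central moment of S 1; then a / D \<le> 2. Any centre k serves,
  since the second moment about the mean is no larger.\<close>

lemma second_moment_Y_bound: "\<exists>k. (\<integral>x. (a * Y x - k)\<^sup>2 \<partial>P) \<le> 8 * C_B + 6 * \<beta>\<^sup>2 * K\<^sup>2"
proof -
  obtain k where k: "\<And>x. D * Y x - k = - B x - \<beta> / 2 * (S 1 x - real m * p)\<^sup>2" using D_Y_eq by blast
  have Bs: "subexp B" and [measurable]: "B \<in> borel_measurable L"
    unfolding B_eq by (intro subexp_intros) measurable
  have i: "integrable P (\<lambda>x. (B x)\<^sup>2)" "integrable P (\<lambda>x. (S 1 x - real m * p) ^ 4)" "integrable P (\<lambda>x. (D * Y x - k)\<^sup>2)"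
    by (intro integrable_subexp subexp_intros Bs Y_subexp; measurable)+
  have D: "a / D \<le> 2" "0 \<le> a / D" using D_bounds a_pos by (auto simp: field_simps)
  have "(\<integral>x. (D * Y x - k)\<^sup>2 \<partial>P) \<le> (\<integral>x. 2 * (B x)\<^sup>2 + \<beta>\<^sup>2 / 2 * (S 1 x - real m * p) ^ 4 \<partial>P)"
  proof (rule integral_mono)
    fix x
    let ?s = "S 1 x - real m * p"
    have "(D * Y x - k)\<^sup>2 = (B x + \<beta> / 2 * ?s\<^sup>2)\<^sup>2" unfolding k by (simp add: power2_eq_square algebra_simps)
    also have "\<dots> \<le> 2 * (B x)\<^sup>2 + 2 * (\<beta> / 2 * ?s\<^sup>2)\<^sup>2"
      using sum_squares_bound[of "B x" "\<beta> / 2 * ?s\<^sup>2"] unfolding power2_sum by linarith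
    also have "2 * (\<beta> / 2 * ?s\<^sup>2)\<^sup>2 = \<beta>\<^sup>2 / 2 * ?s ^ 4" by (simp add: power_mult_distrib power_divide power_mult[symmetric])
    finally show "(D * Y x - k)\<^sup>2 \<le> 2 * (B x)\<^sup>2 + \<beta>\<^sup>2 / 2 * ?s ^ 4" .
  qed (use i in auto)
  also have "\<dots> = 2 * (\<integral>x. (B x)\<^sup>2 \<partial>P) + \<beta>\<^sup>2 / 2 * (\<integral>x. (S 1 x - real m * p) ^ 4 \<partial>P)" using i by simp
  also have "\<dots> \<le> 2 * C_B + \<beta>\<^sup>2 / 2 * (3 * K\<^sup>2)"
    using second_moment_B_bound fourth_moment_S1_bound by (intro add_mono mult_left_mono) auto
  finally have *: "(\<integral>x. (D * Y x - k)\<^sup>2 \<partial>P) \<le> 2 * C_B + \<beta>\<^sup>2 / 2 * (3 * K\<^sup>2)" .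
  have "(\<integral>x. (a * Y x - a / D * k)\<^sup>2 \<partial>P) = (\<integral>x. (a / D)\<^sup>2 * (D * Y x - k)\<^sup>2 \<partial>P)"
  proof (rule Bochner_Integration.integral_cong[OF refl])
    fix x
    have "a * Y x - a / D * k = a / D * (D * Y x - k)" using D_bounds by (simp add: field_simps)
    then show "(a * Y x - a / D * k)\<^sup>2 = (a / D)\<^sup>2 * (D * Y x - k)\<^sup>2" by (simp only: power_mult_distrib)
  qed
  also have "\<dots> = (a / D)\<^sup>2 * (\<integral>x. (D * Y x - k)\<^sup>2 \<partial>P)" by simp
  also have "\<dots> \<le> 2\<^sup>2 * (2 * C_B + \<beta>\<^sup>2 / 2 * (3 * K\<^sup>2))"
    using D * by (intro mult_mono power_mono) auto
  finally show ?thesis by (intro exI[of _ "a / D * k"]) (simp add: mult.commute)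
qed

end

end

section \<open>Moments of the Laguerre ensemble\<close>

locale laguerre_moments = laguerre_gas \<beta> m c "a1 - (1 + \<beta> / 2 * (real m - 1))" P
  for \<beta> :: real and m :: nat and c a1 :: real and P :: "(nat \<Rightarrow> real) measure" +
  assumes \<beta>_pos: "\<beta> > 0" and m_pos: "m \<ge> 1"
    and a1_gt: "a1 > \<beta> / 2 * (real m - 1)"
begin

definition \<delta> :: real where "\<delta> = 1 + \<beta> / 2 * (real m - 1)"
definition A :: real where "A = a1 + \<delta>"
definition M :: real where "M = real m * a1"

text \<open>In contrast to the Jacobi case \<open>drift 1\<close> has no (S 1)^2 term, so the
  hierarchy closes and the moments of S 1, S 2, S 3 come out exactly.\<close>

lemma drift_simps:
  "drift 0 x = M - 1 / 2 * S 1 x"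
  "drift 1 x = A * S 1 x - 1 / 2 * S 2 x"
  "drift 2 x = (A + 1 - \<beta> / 2) * S 2 x - 1 / 2 * S 3 x + \<beta> / 2 * (S 1 x)\<^sup>2"
proof -
  have e: "Suc 0 = 1" "Suc 1 = 2" "Suc 2 = 3" by auto
  show "drift 0 x = M - 1 / 2 * S 1 x"
    "drift 1 x = A * S 1 x - 1 / 2 * S 2 x"
    "drift 2 x = (A + 1 - \<beta> / 2) * S 2 x - 1 / 2 * S 3 x + \<beta> / 2 * (S 1 x)\<^sup>2"
    unfolding drift_def e pair_power_sum_simps A_def \<delta>_def M_def
    by (simp_all add: field_simps)
qed

lemmas drift_fun = ext[of "drift 0", OF drift_simps(1)] ext[of "drift 1", OF drift_simps(2)] ext[of "drift 2", OF drift_simps(3)]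

lemma loop_const: "(\<integral>x. drift k x \<partial>P) = 0"
  using loop[of "\<lambda>x. 1" k "\<lambda>x. 0"] by (simp add: flow_deriv_const subexp_const)

lemma mean_S1: "(\<integral>x. S 1 x \<partial>P) = 2 * M"
  using loop_const[of 0, unfolded drift_fun] prob_space by simp

lemma mean_S2: "(\<integral>x. S 2 x \<partial>P) = 4 * A * M"
  using loop_const[of 1, unfolded drift_fun] mean_S1 by simp

lemma mean_S1_square: "(\<integral>x. (S 1 x)\<^sup>2 \<partial>P) = 4 * M\<^sup>2 + 4 * M"
proof -
  have "(\<integral>x. real 1 * S (1 + 0) x + S 1 x * drift 0 x \<partial>P) = 0"
    by (rule loop[OF flow_deriv_power_sum_field])
  moreover have "real 1 * S (1 + 0) x + S 1 x * drift 0 x = (M + 1) * S 1 x - 1 / 2 * (S 1 x)\<^sup>2" for x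
    unfolding drift_simps by (simp add: algebra_simps power2_eq_square)
  ultimately have "(\<integral>x. (M + 1) * S 1 x - 1 / 2 * (S 1 x)\<^sup>2 \<partial>P) = 0" by (simp only:)
  then show ?thesis using mean_S1 by (simp add: power2_eq_square algebra_simps)
qed

lemma mean_S3: "(\<integral>x. S 3 x \<partial>P) = 8 * A * (A + 1 - \<beta> / 2) * M + 4 * \<beta> * (M\<^sup>2 + M)"
proof -
  have "(A + 1 - \<beta> / 2) * (\<integral>x. S 2 x \<partial>P) - (\<integral>x. S 3 x \<partial>P) / 2 + \<beta> / 2 * (\<integral>x. (S 1 x)\<^sup>2 \<partial>P) = 0"
    using loop_const[of 2, unfolded drift_fun] by simp
  then show ?thesis unfolding mean_S2 mean_S1_square by (simp add: algebra_simps)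
qed

text \<open>This is 4 a times the test statistic U; leaving out the normalisation keeps
  \<open>a2\<close> out of the Laguerre computation.\<close>

definition W :: "(nat \<Rightarrow> real) \<Rightarrow> real" where "W x = S 2 x - 4 * a1 * S 1 x + 4 * a1\<^sup>2 * real m"

lemma W_eq: "W x = (\<Sum>i=1..m. (x i - 2 * a1)\<^sup>2)"
  unfolding W_def power_sum_def sum_distrib_left
  by (simp add: power2_diff sum.distrib sum_subtractf sum_distrib_left algebra_simps power_mult_distrib)

text \<open>The multiplier 2 a1 - 2 \<delta> of \<open>drift 0\<close> raises the coefficient of S 1
  from A to 2 a1, the ratio to S 2 that \<open>W\<close> has. Hence \<open>W\<close> minus its mean
  is exactly - 2 B.\<close>

definition B :: "(nat \<Rightarrow> real) \<Rightarrow> real" where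
  "B x = 2 * a1 * S 1 x - 1 / 2 * S 2 x - (2 * a1 - 2 * \<delta>) * M"

lemma B_drift: "B x = drift 1 x - (2 * a1 - 2 * \<delta>) * drift 0 x"
  unfolding B_def drift_simps A_def by (simp add: algebra_simps)

lemma W_B: "W x - 4 * M * \<delta> = - 2 * B x"
  unfolding W_def B_def M_def by (simp add: algebra_simps power2_eq_square)

lemma mean_W: "(\<integral>x. W x \<partial>P) = 4 * M * \<delta>"
proof -
  have "(\<integral>x. W x \<partial>P) = 4 * A * M - 4 * a1 * (2 * M) + 4 * a1\<^sup>2 * real m"
    unfolding W_def using mean_S1 mean_S2 prob_space by simp
  then show ?thesis unfolding A_def M_def by (simp add: algebra_simps power2_eq_square)
qed

lemma flow_deriv_B:
  "flow_deriv 1 (\<lambda>t x. B (\<lambda>i\<in>{1..m}. x i + t * x i ^ Suc k)) B (\<lambda>x. 2 * a1 * S (1 + k) x - S (2 + k) x)"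
proof -
  have "flow_deriv 1 (\<lambda>t x. B (\<lambda>i\<in>{1..m}. x i + t * x i ^ Suc k)) B
    (\<lambda>x. 2 * a1 * (real 1 * S (1 + k) x) - 1 / 2 * (real 2 * S (2 + k) x) - 0)"
    unfolding B_def
    by (intro flow_deriv_diff flow_deriv_cmult flow_deriv_power_sum_field flow_deriv_const subexp_const zero_less_one) auto
  then show ?thesis by simp
qed

text \<open>The loop equations along the two fields behind \<open>B\<close>, with \<open>B\<close>
  as test function, express E (B^2) through the known means of S 1, S 2 and S 3.\<close>

lemma variance_W: "(\<integral>x. (W x - 4 * M * \<delta>)\<^sup>2 \<partial>P) =
    4 * (M * (16 * \<delta>\<^sup>2 + 8 * (1 - \<beta> / 2) * (a1 + \<delta>)) + 4 * \<beta> * (M\<^sup>2 + M))"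
proof -
  let ?cl = "2 * a1 - 2 * \<delta>"
  have e: "1 + 0 = (1::nat)" "2 + 0 = (2::nat)" "1 + 1 = (2::nat)" "2 + 1 = (3::nat)" by auto
  have l0: "(\<integral>x. 2 * a1 * S 1 x - S 2 x + B x * drift 0 x \<partial>P) = 0"
    using loop[OF flow_deriv_B[of 0]] unfolding e .
  have l1: "(\<integral>x. 2 * a1 * S 2 x - S 3 x + B x * drift 1 x \<partial>P) = 0"
    using loop[OF flow_deriv_B[of 1]] unfolding e .
  have [measurable]: "B \<in> borel_measurable L" unfolding B_def by measurable
  have dm [measurable]: "drift k \<in> borel_measurable L" for k
    unfolding drift_def pair_power_sum_def by measurable
  have Bs: "subexp B" unfolding B_def by (intro subexp_intros)
  have ds: "subexp (drift 0)" "subexp (drift 1)"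
    unfolding drift_fun by (intro subexp_intros)+
  have i0: "integrable P (\<lambda>x. 2 * a1 * S 1 x - S 2 x + B x * drift 0 x)"
    and i1: "integrable P (\<lambda>x. 2 * a1 * S 2 x - S 3 x + B x * drift 1 x)"
    by (intro integrable_subexp subexp_intros Bs ds; measurable)+
  have "(B x)\<^sup>2 = (2 * a1 * S 2 x - S 3 x + B x * drift 1 x) - ?cl * (2 * a1 * S 1 x - S 2 x + B x * drift 0 x)
     + (S 3 x - (2 * a1 + ?cl) * S 2 x + 2 * a1 * ?cl * S 1 x)" for x
  proof -
    have "(B x)\<^sup>2 = B x * drift 1 x - ?cl * (B x * drift 0 x)" unfolding B_drift by (simp add: power2_eq_square algebra_simps)
    then show ?thesis by (simp add: algebra_simps)
  qed
  then have "(\<integral>x. (B x)\<^sup>2 \<partial>P) = (\<integral>x. (2 * a1 * S 2 x - S 3 x + B x * drift 1 x) - ?cl * (2 * a1 * S 1 x - S 2 x + B x * drift 0 x)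
     + (S 3 x - (2 * a1 + ?cl) * S 2 x + 2 * a1 * ?cl * S 1 x) \<partial>P)" by (simp only:)
  also have "\<dots> = (\<integral>x. 2 * a1 * S 2 x - S 3 x + B x * drift 1 x \<partial>P) - ?cl * (\<integral>x. 2 * a1 * S 1 x - S 2 x + B x * drift 0 x \<partial>P)
     + ((\<integral>x. S 3 x \<partial>P) - (2 * a1 + ?cl) * (\<integral>x. S 2 x \<partial>P) + 2 * a1 * ?cl * (\<integral>x. S 1 x \<partial>P))"
    using i0 i1 integrable_power_sum(1)
    by (simp only: Bochner_Integration.integral_add Bochner_Integration.integral_diff Bochner_Integration.integrable_add
        Bochner_Integration.integrable_diff integrable_mult_right integral_mult_right_zero)
  also have "\<dots> = M * (16 * \<delta>\<^sup>2 + 8 * (1 - \<beta> / 2) * (a1 + \<delta>)) + 4 * \<beta> * (M\<^sup>2 + M)"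
    unfolding l0 l1 mean_S1 mean_S2 mean_S3 A_def by (simp add: algebra_simps power2_eq_square)
  finally show ?thesis
    unfolding W_B by (simp add: power_mult_distrib)
qed

lemma W_measurable [measurable]: "W \<in> borel_measurable L" unfolding W_def by measurable

lemma W_subexp: "subexp W" unfolding W_def by (intro subexp_intros)

text \<open>Each of M, \<delta>^2 and a1 + \<delta> is O(a), so the variance is O(a^2), and division
  of \<open>W\<close> by 4 a makes it bounded.\<close>

lemma variance_W_le:
  assumes K1: "K \<ge> 1" and a: "a \<ge> 1" "a \<ge> a1" and Ma: "M \<le> K * a" and m_le: "(real m)\<^sup>2 \<le> K * a"
  shows "(\<integral>x. (W x - 4 * M * \<delta>)\<^sup>2 \<partial>P) \<le>
    4 * (K * (16 * (1 + \<beta>)\<^sup>2 * K + 8 * (1 + \<beta>) * (1 + (1 + \<beta>) * K)) + 8 * \<beta> * K\<^sup>2) * a\<^sup>2"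
proof -
  have b: "0 \<le> \<beta> / 2 * (real m - 1)" using \<beta>_pos m_pos by auto
  then have a1: "0 \<le> a1" using a1_gt by linarith
  have \<delta>0: "0 \<le> \<delta>" using b by (simp add: \<delta>_def)
  have M0: "0 \<le> M" using a1 by (simp add: M_def)
  have m1: "1 \<le> real m" using m_pos by simp
  have \<delta>m: "\<delta> \<le> (1 + \<beta>) * real m"
  proof -
    have "\<beta> / 2 * (real m - 1) \<le> \<beta> * real m" using \<beta>_pos m1 by (intro mult_mono) auto
    then show ?thesis unfolding \<delta>_def distrib_right using m1 by linarith
  qed
  have \<delta>2: "\<delta>\<^sup>2 \<le> (1 + \<beta>)\<^sup>2 * (K * a)"
  proof -
    have "\<delta>\<^sup>2 \<le> ((1 + \<beta>) * real m)\<^sup>2" using \<delta>m \<delta>0 by (intro power_mono) auto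
    also have "\<dots> \<le> (1 + \<beta>)\<^sup>2 * (K * a)" unfolding power_mult_distrib using m_le by (intro mult_left_mono) auto
    finally show ?thesis .
  qed
  have "real m * 1 \<le> real m * real m" using m1 by (intro mult_left_mono) auto
  then have "real m \<le> K * a" using m_le by (simp add: power2_eq_square)
  then have "(1 + \<beta>) * real m \<le> (1 + \<beta>) * (K * a)" using \<beta>_pos by (intro mult_left_mono) auto
  then have A: "a1 + \<delta> \<le> (1 + (1 + \<beta>) * K) * a" using \<delta>m a unfolding distrib_right mult.assoc by linarith
  have "(1 - \<beta> / 2) * (a1 + \<delta>) \<le> (1 + \<beta>) * ((1 + (1 + \<beta>) * K) * a)"
    using A a1 \<delta>0 \<beta>_pos by (intro mult_mono) auto
  then have 0: "8 * ((1 - \<beta> / 2) * (a1 + \<delta>)) \<le> 8 * ((1 + \<beta>) * ((1 + (1 + \<beta>) * K) * a))" by simp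
  have "(16 * (1 + \<beta>)\<^sup>2 * K + 8 * (1 + \<beta>) * (1 + (1 + \<beta>) * K)) * a
     = 16 * ((1 + \<beta>)\<^sup>2 * (K * a)) + 8 * ((1 + \<beta>) * ((1 + (1 + \<beta>) * K) * a))" by (simp add: distrib_right)
  then have "16 * \<delta>\<^sup>2 + 8 * (1 - \<beta> / 2) * (a1 + \<delta>) \<le> (16 * (1 + \<beta>)\<^sup>2 * K + 8 * (1 + \<beta>) * (1 + (1 + \<beta>) * K)) * a"
    using \<delta>2 0 unfolding mult.assoc[of 8] by linarith
  then have "M * (16 * \<delta>\<^sup>2 + 8 * (1 - \<beta> / 2) * (a1 + \<delta>)) \<le> M * ((16 * (1 + \<beta>)\<^sup>2 * K + 8 * (1 + \<beta>) * (1 + (1 + \<beta>) * K)) * a)"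
    using M0 by (intro mult_left_mono) auto
  also have "\<dots> \<le> (K * a) * ((16 * (1 + \<beta>)\<^sup>2 * K + 8 * (1 + \<beta>) * (1 + (1 + \<beta>) * K)) * a)"
    using Ma K1 \<beta>_pos a by (intro mult_right_mono) auto
  finally have 1: "M * (16 * \<delta>\<^sup>2 + 8 * (1 - \<beta> / 2) * (a1 + \<delta>)) \<le> K * (16 * (1 + \<beta>)\<^sup>2 * K + 8 * (1 + \<beta>) * (1 + (1 + \<beta>) * K)) * a\<^sup>2"
    by (simp add: power2_eq_square ac_simps)
  have "M\<^sup>2 + M \<le> 2 * (K * a)\<^sup>2"
  proof -
    have "M\<^sup>2 \<le> (K * a)\<^sup>2" using Ma M0 by (intro power_mono) auto
    moreover have "1 \<le> K * a" using K1 a mult_mono[of 1 K 1 a] by auto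
    then have "K * a * 1 \<le> K * a * (K * a)" by (intro mult_left_mono) auto
    ultimately show ?thesis using Ma by (simp add: power2_eq_square)
  qed
  then have "4 * \<beta> * (M\<^sup>2 + M) \<le> 4 * \<beta> * (2 * (K * a)\<^sup>2)" using \<beta>_pos by (intro mult_left_mono) auto
  then have "4 * \<beta> * (M\<^sup>2 + M) \<le> 8 * \<beta> * K\<^sup>2 * a\<^sup>2" by (simp add: power_mult_distrib)
  with 1 show ?thesis unfolding variance_W by (simp add: distrib_right)
qed

end

section \<open>Entropy and total variation\<close>

lemma mult_ln_ge: "\<rho> - 1 \<le> \<rho> * ln \<rho>" if "0 \<le> \<rho>" for \<rho> :: real
proof (cases "\<rho> = 0")
  case False
  then have pos: "\<rho> > 0" using that by simp
  have "ln (1 / \<rho>) \<le> 1 / \<rho> - 1" using pos by (intro ln_le_minus_one) auto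
  then have "\<rho> * ln (1 / \<rho>) \<le> \<rho> * (1 / \<rho> - 1)" using pos by (intro mult_left_mono) auto
  then show ?thesis using pos by (simp add: ln_div algebra_simps)
qed simp

text \<open>The integrated form is a weak Pinsker inequality; with \<open>s = sqrt \<rho>\<close> it combines
  \<open>\<rho> ln \<rho> - \<rho> + 1 \<ge> (s - 1)\<^sup>2\<close> and AM-GM for \<open>\<bar>\<rho> - 1\<bar> = \<bar>s - 1\<bar> (s + 1)\<close>.\<close>

lemma abs_diff_one_le_entropy:
  fixes \<rho> \<eta> :: real
  assumes "0 \<le> \<rho>" "\<eta> > 0"
  shows "\<bar>\<rho> - 1\<bar> \<le> (\<rho> * ln \<rho> - \<rho> + 1) / (2 * \<eta>) + \<eta> * (\<rho> + 1)"
proof -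
  define s where "s = sqrt \<rho>"
  have s: "0 \<le> s" "s\<^sup>2 = \<rho>" using assms by (auto simp: s_def)
  have ent: "(s - 1)\<^sup>2 \<le> \<rho> * ln \<rho> - \<rho> + 1"
  proof (cases "s = 0")
    case True then show ?thesis using s by simp
  next
    case False
    then have pos: "s > 0" using s by simp
    have "s - 1 \<le> s * ln s" using pos by (intro mult_ln_ge) auto
    then have "2 * s * (s - 1) \<le> 2 * s * (s * ln s)" using pos by (intro mult_left_mono) auto
    moreover have "ln \<rho> = 2 * ln s"
      unfolding s(2)[symmetric] using pos by (simp add: ln_realpow)
    from this have "\<rho> * ln \<rho> = 2 * s * (s * ln s)"
      by (simp add: s(2)[symmetric] power2_eq_square)
    moreover have "(s - 1)\<^sup>2 = \<rho> - 2 * s + 1" "2 * s * (s - 1) = 2 * \<rho> - 2 * s"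
      by (simp_all add: s(2)[symmetric] power2_eq_square algebra_simps)
    ultimately show ?thesis by linarith
  qed
  have "\<bar>\<rho> - 1\<bar> = \<bar>s - 1\<bar> * (s + 1)"
  proof -
    have "\<rho> - 1 = (s - 1) * (s + 1)" unfolding s(2)[symmetric] by (simp add: power2_eq_square algebra_simps)
    then show ?thesis using s by (simp add: abs_mult)
  qed
  also have "\<dots> \<le> (s - 1)\<^sup>2 / (2 * \<eta>) + \<eta> / 2 * (s + 1)\<^sup>2"
  proof -
    have "2 * \<bar>s - 1\<bar> * (\<eta> * (s + 1)) \<le> \<bar>s - 1\<bar>\<^sup>2 + (\<eta> * (s + 1))\<^sup>2" by (rule sum_squares_bound)
    then have "(2 * \<eta>) * (\<bar>s - 1\<bar> * (s + 1)) \<le> (2 * \<eta>) * ((s - 1)\<^sup>2 / (2 * \<eta>) + \<eta> / 2 * (s + 1)\<^sup>2)"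
    proof -
      have "(2 * \<eta>) * ((s - 1)\<^sup>2 / (2 * \<eta>) + \<eta> / 2 * (s + 1)\<^sup>2) = (s - 1)\<^sup>2 + (\<eta> * (s + 1))\<^sup>2"
        using assms by (simp add: distrib_left[of "2 * \<eta>"] power_mult_distrib power2_eq_square[of \<eta>])
      then show ?thesis
        using \<open>2 * \<bar>s - 1\<bar> * (\<eta> * (s + 1)) \<le> \<bar>s - 1\<bar>\<^sup>2 + (\<eta> * (s + 1))\<^sup>2\<close> by (simp add: ac_simps)
    qed
    then show ?thesis using assms by simp
  qed
  also have "\<dots> \<le> (\<rho> * ln \<rho> - \<rho> + 1) / (2 * \<eta>) + \<eta> * (\<rho> + 1)"
  proof (rule add_mono)
    show "(s - 1)\<^sup>2 / (2 * \<eta>) \<le> (\<rho> * ln \<rho> - \<rho> + 1) / (2 * \<eta>)" using ent assms by (intro divide_right_mono) auto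
    have "(s + 1)\<^sup>2 \<le> 2 * (\<rho> + 1)"
      using sum_squares_bound[of s 1] unfolding s(2)[symmetric] power2_sum by simp
    then have "\<eta> / 2 * (s + 1)\<^sup>2 \<le> \<eta> / 2 * (2 * (\<rho> + 1))" using assms by (intro mult_left_mono) auto
    also have "\<eta> / 2 * (2 * (\<rho> + 1)) = \<eta> * (\<rho> + 1)" by (simp add: field_simps)
    finally show "\<eta> / 2 * (s + 1)\<^sup>2 \<le> \<eta> * (\<rho> + 1)" .
  qed
  finally show ?thesis .
qed

locale likelihood_ratio = Q: prob_space Q for Q :: "'a measure" +
  fixes \<rho> :: "'a \<Rightarrow> real" and P :: "'a measure"
  assumes \<rho>_measurable [measurable]: "\<rho> \<in> borel_measurable Q" and \<rho>_nonneg: "\<And>x. 0 \<le> \<rho> x"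
    and P_def: "P = density Q (\<lambda>x. ennreal (\<rho> x))" and prob_P: "prob_space P"
begin

sublocale P: prob_space P by (fact prob_P)

lemma sets_P [measurable_cong]: "sets P = sets Q" by (simp add: P_def)

lemma integral_P: "g \<in> borel_measurable Q \<Longrightarrow> (\<integral>x. g x \<partial>P) = (\<integral>x. \<rho> x * g x \<partial>Q)"
  unfolding P_def using \<rho>_nonneg by (subst integral_density) auto

lemma integrable_P: "g \<in> borel_measurable Q \<Longrightarrow> integrable P g \<longleftrightarrow> integrable Q (\<lambda>x. \<rho> x * g x)"
  unfolding P_def using \<rho>_nonneg by (subst integrable_density) auto

lemma integrable_\<rho> [simp]: "integrable Q \<rho>"
  using integrable_P[of "\<lambda>x. 1"] by simp

lemma integral_\<rho>: "(\<integral>x. \<rho> x \<partial>Q) = 1"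
  using integral_P[of "\<lambda>x. 1"] P.prob_space by simp

definition l1_distance :: real where "l1_distance = (\<integral>x. \<bar>\<rho> x - 1\<bar> \<partial>Q)"

lemma l1_distance_nonneg: "0 \<le> l1_distance" by (simp add: l1_distance_def)

lemma measure_diff:
  assumes "A \<in> sets Q"
  shows "measure P A - measure Q A = (\<integral>x. indicator A x * (\<rho> x - 1) \<partial>Q)"
proof -
  have 1: "measure P A = (\<integral>x. \<rho> x * indicator A x \<partial>Q)"
    using integral_P[of "indicator A"] assms by (simp add: sets_P sets_eq_imp_space_eq[OF sets_P])
  have 2: "measure Q A = (\<integral>x. indicator A x \<partial>Q)" using assms by simp
  have "integrable Q (\<lambda>x. \<rho> x * indicator A x)" using assms integrable_real_mult_indicator[of A Q \<rho>] by simp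
  moreover have "integrable Q (indicator A :: _ \<Rightarrow> real)"
    using assms by (intro integrable_real_indicator) (auto simp: Q.emeasure_finite less_top[symmetric])
  ultimately show ?thesis using assms unfolding 1 2
    by (subst Bochner_Integration.integral_diff[symmetric]) (auto intro!: Bochner_Integration.integral_cong simp: algebra_simps)
qed

text \<open>Bounding the indicator by 1 loses a factor 2 against the exact value
  \<open>l1_distance\<close>; for convergence to 0 this is harmless.\<close>

lemma tv_distance_le: "tv_distance P Q \<le> ereal (2 * l1_distance)"
proof -
  have "ereal \<bar>measure P A - measure Q A\<bar> \<le> ereal l1_distance" if "A \<in> sets P" for A
  proof -
    have A[measurable]: "A \<in> sets Q" using that by (simp add: sets_P)
    have "\<bar>measure P A - measure Q A\<bar> \<le> (\<integral>x. \<bar>indicator A x * (\<rho> x - 1)\<bar> \<partial>Q)"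
      unfolding measure_diff[OF A] by (rule integral_abs_bound)
    also have "\<dots> \<le> l1_distance" unfolding l1_distance_def
      by (rule integral_mono') (auto simp: indicator_def)
    finally show ?thesis by simp
  qed
  then have "(SUP A\<in>sets P. ereal \<bar>measure P A - measure Q A\<bar>) \<le> ereal l1_distance" by (intro SUP_least)
  then have "2 * (SUP A\<in>sets P. ereal \<bar>measure P A - measure Q A\<bar>) \<le> 2 * ereal l1_distance"
    by (intro ereal_mult_left_mono) auto
  then show ?thesis unfolding tv_distance_def by simp
qed

text \<open>The set where \<rho> \<ge> 1 is optimal: |\<rho> - 1| is twice the positive part of
  \<rho> - 1 minus \<rho> - 1, and the latter integrates to 0.\<close>

lemma tv_distance_ge: "ereal l1_distance \<le> tv_distance P Q"
proof -
  let ?A = "{x\<in>space Q. \<rho> x \<ge> 1}"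
  have A[measurable]: "?A \<in> sets Q" by measurable
  have i: "integrable Q (\<lambda>x. indicator ?A x * (\<rho> x - 1))"
    using integrable_real_mult_indicator[OF A, of "\<lambda>x. \<rho> x - 1"] by (simp add: mult.commute)
  have "l1_distance = (\<integral>x. 2 * (indicator ?A x * (\<rho> x - 1)) - (\<rho> x - 1) \<partial>Q)"
    unfolding l1_distance_def by (rule Bochner_Integration.integral_cong) (auto simp: indicator_def)
  also have "\<dots> = 2 * (measure P ?A - measure Q ?A)"
    unfolding measure_diff[OF A] using i integral_\<rho> Q.prob_space by simp
  finally have eq: "l1_distance = 2 * (measure P ?A - measure Q ?A)" .
  have "l1_distance \<le> 2 * \<bar>measure P ?A - measure Q ?A\<bar>"
    unfolding eq by (rule mult_left_mono[OF abs_ge_self]) simp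
  then have "ereal l1_distance \<le> 2 * ereal \<bar>measure P ?A - measure Q ?A\<bar>" by simp
  also have "\<dots> \<le> tv_distance P Q"
    unfolding tv_distance_def by (intro ereal_mult_left_mono SUP_upper) (auto simp: sets_P)
  finally show ?thesis .
qed

lemma absolutely_continuous: "absolutely_continuous Q P"
  unfolding P_def by (rule absolutely_continuousI_density) measurable

lemma AE_entropy_density: "AE x in P. entropy_density (exp 1) Q P x = ln (\<rho> x)"
proof -
  have "AE x in Q. ennreal (\<rho> x) = RN_deriv Q P x"
    unfolding P_def by (rule Q.RN_deriv_unique) auto
  then have "AE x in Q. entropy_density (exp 1) Q P x = ln (\<rho> x)"
  proof eventually_elim
    case (elim x)
    then show ?case using \<rho>_nonneg[of x] by (simp add: entropy_density_def log_def elim[symmetric])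
  qed
  then show ?thesis using absolutely_continuous_AE[OF sets_P absolutely_continuous] by blast
qed

lemma entropy_density_measurable [measurable]: "entropy_density (exp 1) Q P \<in> borel_measurable Q"
  unfolding entropy_density_def by measurable

lemma kl_distance_eq:
  "kl_distance P Q = (if integrable P (\<lambda>x. ln (\<rho> x)) then ereal (\<integral>x. ln (\<rho> x) \<partial>P) else \<infinity>)"
proof -
  have "integrable P (entropy_density (exp 1) Q P) \<longleftrightarrow> integrable P (\<lambda>x. ln (\<rho> x))"
    using AE_entropy_density by (intro integrable_cong_AE) auto
  moreover have "KL_divergence (exp 1) Q P = (\<integral>x. ln (\<rho> x) \<partial>P)"
    unfolding KL_divergence_def using AE_entropy_density by (intro integral_cong_AE) auto
  ultimately show ?thesis unfolding kl_distance_def using absolutely_continuous by simp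
qed

lemma AE_\<rho>_pos: "AE x in P. \<rho> x > 0"
  unfolding P_def by (subst AE_density) auto

text \<open>An upper bound suffices, since \<rho> ln \<rho> \<ge> \<rho> - 1 controls the negative
  part under Q.\<close>

lemma integrable_ln_\<rho>:
  assumes g: "integrable P g" and le: "AE x in P. ln (\<rho> x) \<le> g x"
  shows "integrable P (\<lambda>x. ln (\<rho> x))"
proof -
  have [measurable]: "g \<in> borel_measurable Q" using g by (simp add: sets_P cong: measurable_cong_sets)
  have ig: "integrable Q (\<lambda>x. \<rho> x * \<bar>g x\<bar>)" using integrable_P[of "\<lambda>x. \<bar>g x\<bar>"] g by auto
  have "AE x in Q. \<rho> x > 0 \<longrightarrow> ln (\<rho> x) \<le> g x"
    using le unfolding P_def by (subst (asm) AE_density) auto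
  then have "integrable Q (\<lambda>x. \<rho> x * ln (\<rho> x))"
  proof (intro Bochner_Integration.integrable_bound[where f = "\<lambda>x. \<rho> x * \<bar>g x\<bar> + (\<rho> x + 1)" and g = "\<lambda>x. \<rho> x * ln (\<rho> x)"])
    assume *: "AE x in Q. \<rho> x > 0 \<longrightarrow> ln (\<rho> x) \<le> g x"
    show "AE x in Q. norm (\<rho> x * ln (\<rho> x)) \<le> norm (\<rho> x * \<bar>g x\<bar> + (\<rho> x + 1))"
      using *
    proof eventually_elim
      case (elim x)
      have "\<rho> x * ln (\<rho> x) \<le> \<rho> x * \<bar>g x\<bar>"
      proof (cases "\<rho> x = 0")
        case False
        then have "ln (\<rho> x) \<le> \<bar>g x\<bar>" using elim \<rho>_nonneg[of x] by auto
        then show ?thesis using \<rho>_nonneg[of x] by (intro mult_left_mono)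
      qed simp
      moreover have "\<rho> x - 1 \<le> \<rho> x * ln (\<rho> x)" using \<rho>_nonneg by (rule mult_ln_ge)
      moreover have "0 \<le> \<rho> x * \<bar>g x\<bar>" using \<rho>_nonneg[of x] by simp
      ultimately have "\<bar>\<rho> x * ln (\<rho> x)\<bar> \<le> \<rho> x * \<bar>g x\<bar> + (\<rho> x + 1)"
        using \<rho>_nonneg[of x] unfolding abs_le_iff by linarith
      then show ?case unfolding real_norm_def by (meson abs_ge_self order_trans)
    qed
  qed (use ig in auto)
  then show ?thesis by (subst integrable_P) auto
qed

lemma weak_pinsker:
  assumes i: "integrable P (\<lambda>x. ln (\<rho> x))" and \<eta>: "\<eta> > 0"
  shows "l1_distance \<le> (\<integral>x. ln (\<rho> x) \<partial>P) / (2 * \<eta>) + 2 * \<eta>"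
proof -
  have iQ: "integrable Q (\<lambda>x. \<rho> x * ln (\<rho> x))" using i by (subst (asm) integrable_P) auto
  have "l1_distance \<le> (\<integral>x. (\<rho> x * ln (\<rho> x) - \<rho> x + 1) / (2 * \<eta>) + \<eta> * (\<rho> x + 1) \<partial>Q)"
    unfolding l1_distance_def using iQ \<rho>_nonneg \<eta> by (intro integral_mono abs_diff_one_le_entropy) auto
  also have "\<dots> = (\<integral>x. \<rho> x * ln (\<rho> x) \<partial>Q) / (2 * \<eta>) + 2 * \<eta>"
    using iQ integral_\<rho> Q.prob_space by simp
  also have "(\<integral>x. \<rho> x * ln (\<rho> x) \<partial>Q) = (\<integral>x. ln (\<rho> x) \<partial>P)" by (subst integral_P) auto
  finally show ?thesis .
qed

lemma kl_nonneg:
  assumes i: "integrable P (\<lambda>x. ln (\<rho> x))"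
  shows "0 \<le> (\<integral>x. ln (\<rho> x) \<partial>P)"
proof -
  have iQ: "integrable Q (\<lambda>x. \<rho> x * ln (\<rho> x))" using i by (subst (asm) integrable_P) auto
  have "(\<integral>x. \<rho> x - 1 \<partial>Q) \<le> (\<integral>x. \<rho> x * ln (\<rho> x) \<partial>Q)"
    using iQ \<rho>_nonneg by (intro integral_mono mult_ln_ge) auto
  moreover have "(\<integral>x. \<rho> x - 1 \<partial>Q) = 0" using integral_\<rho> Q.prob_space by simp
  moreover have "(\<integral>x. \<rho> x * ln (\<rho> x) \<partial>Q) = (\<integral>x. ln (\<rho> x) \<partial>P)" by (subst integral_P) auto
  ultimately show ?thesis by simp
qed

lemma kl_distance_ge:
  assumes "\<eta> > 0"
  shows "kl_distance P Q \<ge> ereal (2 * \<eta> * (l1_distance - 2 * \<eta>))"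
proof (cases "integrable P (\<lambda>x. ln (\<rho> x))")
  case True
  have "2 * \<eta> * (l1_distance - 2 * \<eta>) \<le> 2 * \<eta> * ((\<integral>x. ln (\<rho> x) \<partial>P) / (2 * \<eta>))"
    using weak_pinsker[OF True assms] assms by (intro mult_left_mono) auto
  then show ?thesis unfolding kl_distance_eq using True assms by simp
qed (simp add: kl_distance_eq)

text \<open>Only second moments of the test function \<open>U\<close> enter, because
  \<open>\<bar>g\<bar> \<bar>1 - \<rho>\<bar> \<le> \<theta> g\<^sup>2 (1 + \<rho>) + \<bar>1 - \<rho>\<bar> / (4 \<theta>)\<close>.\<close>

lemma l1_distance_ge:
  assumes U[measurable]: "U \<in> borel_measurable Q"
    and iQ: "integrable Q U" "integrable Q (\<lambda>x. (U x)\<^sup>2)" and iP: "integrable P U" "integrable P (\<lambda>x. (U x)\<^sup>2)"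
    and vQ: "(\<integral>x. (U x - (\<integral>x. U x \<partial>Q))\<^sup>2 \<partial>Q) \<le> CQ"
    and vP: "(\<integral>x. (U x - k)\<^sup>2 \<partial>P) \<le> CP"
    and c0: "0 < c0" "c0 \<le> (\<integral>x. U x \<partial>Q) - (\<integral>x. U x \<partial>P)" and c1: "(\<integral>x. U x \<partial>Q) - (\<integral>x. U x \<partial>P) \<le> c1"
    and C: "C = CQ + CP + c1\<^sup>2"
  shows "c0\<^sup>2 / C \<le> l1_distance"
proof -
  define u where "u = (\<integral>x. U x \<partial>Q)"
  define v where "v = (\<integral>x. U x \<partial>P)"
  let ?g = "\<lambda>x. U x - u"
  have sq: "integrable Q (\<lambda>x. (U x - z)\<^sup>2)" "integrable P (\<lambda>x. (U x - z)\<^sup>2)" for z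
    unfolding power2_diff using iQ iP by auto
  \<comment> \<open>The mean v minimises the second moment under P, so the centre k may be replaced
    by v; moving on to u adds (u - v)^2, at most c1^2.\<close>
  have gP: "(\<integral>x. (?g x)\<^sup>2 \<partial>P) \<le> CP + c1\<^sup>2"
  proof -
    have e: "(\<integral>x. (U x - z)\<^sup>2 \<partial>P) = (\<integral>x. (U x)\<^sup>2 \<partial>P) - 2 * z * v + z\<^sup>2" for z
    proof -
      have "(\<integral>x. (U x - z)\<^sup>2 \<partial>P) = (\<integral>x. (U x)\<^sup>2 - (2 * z) * U x + z\<^sup>2 \<partial>P)"
        by (rule Bochner_Integration.integral_cong) (auto simp: power2_diff)
      then show ?thesis using iP P.prob_space by (simp add: v_def)
    qed
    have "(\<integral>x. (U x)\<^sup>2 \<partial>P) - 2 * k * v + k\<^sup>2 \<le> CP" using vP unfolding e .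
    moreover have "(u - v)\<^sup>2 \<le> c1\<^sup>2" using c0 c1 unfolding u_def v_def by (intro power_mono) auto
    then have "u\<^sup>2 + v\<^sup>2 - 2 * u * v \<le> c1\<^sup>2" unfolding power2_diff .
    moreover have "0 \<le> (k - v)\<^sup>2" by simp
    then have "0 \<le> k\<^sup>2 + v\<^sup>2 - 2 * k * v" unfolding power2_diff .
    ultimately show ?thesis unfolding e by linarith
  qed
  have Cpos: "C > 0"
  proof -
    have "0 \<le> CQ" using order_trans[OF _ vQ, of 0] by simp
    moreover have "0 \<le> CP" using order_trans[OF _ vP, of 0] by simp
    moreover have "0 < c1" using c0 c1 by simp
    ultimately show ?thesis unfolding C by (intro add_nonneg_pos) auto
  qed
  \<comment> \<open>With this value the term \<theta> C equals c0 / 2, so half of the gap is left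
    for \<open>l1_distance\<close>.\<close>
  define \<theta> where "\<theta> = c0 / (2 * C)"
  have \<theta>: "\<theta> > 0" using Cpos c0 by (simp add: \<theta>_def)
  have gQ: "integrable Q (\<lambda>x. (?g x)\<^sup>2)" "integrable Q (\<lambda>x. \<rho> x * (?g x)\<^sup>2)"
    using sq integrable_P[of "\<lambda>x. (?g x)\<^sup>2"] by auto
  have i\<rho>U: "integrable Q (\<lambda>x. \<rho> x * U x)" using integrable_P[of U] iP by auto
  have "u - v = (\<integral>x. ?g x * (1 - \<rho> x) \<partial>Q)"
  proof -
    have "(\<integral>x. ?g x * (1 - \<rho> x) \<partial>Q) = (\<integral>x. U x - u - \<rho> x * U x + u * \<rho> x \<partial>Q)"
      by (rule Bochner_Integration.integral_cong) (auto simp: algebra_simps)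
    also have "\<dots> = u - u - (\<integral>x. \<rho> x * U x \<partial>Q) + u"
      using iQ i\<rho>U integral_\<rho> Q.prob_space by (simp add: u_def)
    also have "(\<integral>x. \<rho> x * U x \<partial>Q) = v" unfolding v_def by (subst integral_P) auto
    finally show ?thesis by simp
  qed
  also have "\<dots> \<le> (\<integral>x. \<theta> * ((?g x)\<^sup>2 + \<rho> x * (?g x)\<^sup>2) + \<bar>\<rho> x - 1\<bar> / (4 * \<theta>) \<partial>Q)"
  proof (rule integral_mono)
    have "(\<lambda>x. ?g x * (1 - \<rho> x)) = (\<lambda>x. U x - u - \<rho> x * U x + u * \<rho> x)" by (auto simp: algebra_simps)
    then show "integrable Q (\<lambda>x. ?g x * (1 - \<rho> x))" using iQ i\<rho>U by simp
    show "integrable Q (\<lambda>x. \<theta> * ((?g x)\<^sup>2 + \<rho> x * (?g x)\<^sup>2) + \<bar>\<rho> x - 1\<bar> / (4 * \<theta>))"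
      using gQ by (intro Bochner_Integration.integrable_add integrable_mult_right integrable_divide integrable_abs Bochner_Integration.integrable_diff) auto
    fix x
    have "?g x * (1 - \<rho> x) \<le> \<bar>?g x\<bar> * \<bar>\<rho> x - 1\<bar>"
      by (metis abs_ge_self abs_minus_commute abs_mult)
    also have "\<dots> \<le> (\<theta> * (?g x)\<^sup>2 + 1 / (4 * \<theta>)) * \<bar>\<rho> x - 1\<bar>"
    proof (rule mult_right_mono)
      have "2 * (2 * \<theta> * \<bar>?g x\<bar>) * 1 \<le> (2 * \<theta> * \<bar>?g x\<bar>)\<^sup>2 + 1\<^sup>2" by (rule sum_squares_bound)
      then have "(4 * \<theta>) * \<bar>?g x\<bar> \<le> (4 * \<theta>) * (\<theta> * (?g x)\<^sup>2 + 1 / (4 * \<theta>))"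
      proof -
        have "(2 * \<theta> * \<bar>?g x\<bar>)\<^sup>2 = 4 * \<theta> * (\<theta> * (?g x)\<^sup>2)"
          by (simp add: power_mult_distrib power2_eq_square[of \<theta>])
        moreover have "(4 * \<theta>) * (\<theta> * (?g x)\<^sup>2 + 1 / (4 * \<theta>)) = 4 * \<theta> * (\<theta> * (?g x)\<^sup>2) + 1"
          using \<theta> by (simp add: distrib_left)
        ultimately show ?thesis
          using \<open>2 * (2 * \<theta> * \<bar>?g x\<bar>) * 1 \<le> (2 * \<theta> * \<bar>?g x\<bar>)\<^sup>2 + 1\<^sup>2\<close> by simp
      qed
      then show "\<bar>?g x\<bar> \<le> \<theta> * (?g x)\<^sup>2 + 1 / (4 * \<theta>)" using \<theta> by simp
    qed simp
    also have "\<dots> \<le> \<theta> * ((?g x)\<^sup>2 + \<rho> x * (?g x)\<^sup>2) + \<bar>\<rho> x - 1\<bar> / (4 * \<theta>)"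
    proof -
      have "\<bar>\<rho> x - 1\<bar> \<le> 1 + \<rho> x" using \<rho>_nonneg[of x] by auto
      then have "\<theta> * (?g x)\<^sup>2 * \<bar>\<rho> x - 1\<bar> \<le> \<theta> * (?g x)\<^sup>2 * (1 + \<rho> x)" using \<theta> by (intro mult_left_mono) auto
      then show ?thesis by (simp add: algebra_simps)
    qed
    finally show "?g x * (1 - \<rho> x) \<le> \<theta> * ((?g x)\<^sup>2 + \<rho> x * (?g x)\<^sup>2) + \<bar>\<rho> x - 1\<bar> / (4 * \<theta>)" .
  qed
  also have "\<dots> = \<theta> * ((\<integral>x. (?g x)\<^sup>2 \<partial>Q) + (\<integral>x. (?g x)\<^sup>2 \<partial>P)) + l1_distance / (4 * \<theta>)"
    using gQ by (subst integral_P) (auto simp: l1_distance_def)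
  also have "\<dots> \<le> \<theta> * C + l1_distance / (4 * \<theta>)"
  proof (intro add_right_mono mult_left_mono)
    show "(\<integral>x. (?g x)\<^sup>2 \<partial>Q) + (\<integral>x. (?g x)\<^sup>2 \<partial>P) \<le> C"
      using gP vQ unfolding C u_def by linarith
  qed (use \<theta> in simp)
  finally have "c0 \<le> \<theta> * C + l1_distance / (4 * \<theta>)" using c0 unfolding u_def v_def by linarith
  moreover have "\<theta> * C = c0 / 2" using Cpos by (simp add: \<theta>_def)
  ultimately have "c0 / 2 \<le> l1_distance / (4 * \<theta>)" by linarith
  then have "c0 / 2 * (4 * \<theta>) \<le> l1_distance" using \<theta> by (simp only: pos_le_divide_eq zero_less_mult_iff zero_less_numeral simp_thms)
  then show ?thesis by (simp add: \<theta>_def power2_eq_square)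
qed

end

section \<open>Comparing the two ensembles\<close>

text \<open>The functional equation makes the increment of ln Gamma over [z, z + 1] equal to ln z.
  By the mean value theorem it is a value of Digamma to the right of z, and Digamma
  increases.\<close>

lemma Digamma_le_ln: "Digamma z \<le> ln z" if "0 < z" for z :: real
proof -
  have "\<exists>y>z. y < z + 1 \<and> ln_Gamma (z + 1) - ln_Gamma z = (z + 1 - z) * Digamma y"
    using that by (intro MVT2) (auto intro!: has_field_derivative_ln_Gamma_real)
  then obtain y where y: "y > z" and eq: "ln_Gamma (z + 1) - ln_Gamma z = Digamma y" by auto
  have "Gamma (z + 1) = z * Gamma z" using that by (intro Gamma_plus1) (auto elim!: nonpos_Ints_cases)
  then have "ln_Gamma (z + 1) - ln_Gamma z = ln z"
    using that ln_mult_pos[OF that Gamma_real_pos[OF that]] by (simp add: ln_Gamma_real_pos)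
  then show ?thesis using Digamma_real_mono[OF that, of y] y eq by simp
qed

text \<open>Replace a by a variable x: equality holds at x = b, and right minus left is
  nondecreasing because Digamma (x - \<delta>) \<le> ln (x - \<delta>) \<le> ln x - \<delta> /
  x.\<close>

lemma ln_Gamma_diff_le:
  fixes a b \<delta> :: real
  assumes "0 \<le> \<delta>" "\<delta> < b" "b \<le> a"
  shows "ln (Gamma (a - \<delta>)) - ln (Gamma (b - \<delta>)) \<le> (a - b) * ln a - (a - b) - (b - \<delta>) * ln (b / a)"
proof -
  let ?F = "\<lambda>x. (x - b) * ln x - (x - b) - (b - \<delta>) * (ln b - ln x) - ln_Gamma (x - \<delta>)"
  have "?F b \<le> ?F a"
  proof (rule DERIV_nonneg_imp_nondecreasing[OF assms(3)])
    fix x assume x: "b \<le> x" "x \<le> a"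
    then have pos: "x > 0" "x - \<delta> > 0" using assms by auto
    have "(?F has_real_derivative (ln x + (x - b) * (1 / x) - 1 - (b - \<delta>) * (0 - 1 / x) - Digamma (x - \<delta>))) (at x)"
      using pos by (auto intro!: derivative_eq_intros)
    moreover have "0 \<le> ln x + (x - b) * (1 / x) - 1 - (b - \<delta>) * (0 - 1 / x) - Digamma (x - \<delta>)"
    proof -
      have "Digamma (x - \<delta>) \<le> ln (x - \<delta>)" using pos by (intro Digamma_le_ln) auto
      also have "\<dots> = ln x + ln (1 - \<delta> / x)"
      proof -
        have "1 - \<delta> / x > 0" using pos by (simp add: field_simps)
        then have "ln x + ln (1 - \<delta> / x) = ln (x * (1 - \<delta> / x))" using pos by (simp add: ln_mult)
        also have "x * (1 - \<delta> / x) = x - \<delta>" using pos by (simp add: field_simps)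
        finally show ?thesis ..
      qed
      also have "\<dots> \<le> ln x + (1 - \<delta> / x - 1)" using pos by (intro add_left_mono ln_le_minus_one) (auto simp: field_simps)
      also have "\<dots> = ln x + (x - b) * (1 / x) - 1 - (b - \<delta>) * (0 - 1 / x)" using pos by (simp add: field_simps)
      finally show ?thesis by simp
    qed
    ultimately show "\<exists>y. (?F has_real_derivative y) (at x) \<and> 0 \<le> y" by blast
  qed
  moreover have "ln (b / a) = ln b - ln a" using assms by (simp add: ln_div)
  ultimately show ?thesis using assms by (simp add: ln_Gamma_real_pos)
qed

text \<open>Right minus left vanishes at u = v and has derivative (u - v) (1 / (u v) - 1), which on
  (0, 1] has the sign of u - v. The coefficient 1/2 reflects that the second derivative of ln is at
  most -1 there.\<close>

lemma ln_le_quadratic: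
  fixes u v :: real
  assumes "0 < u" "u \<le> 1" "0 < v" "v \<le> 1"
  shows "ln u \<le> ln v + (u - v) / v - (u - v)\<^sup>2 / 2"
proof -
  let ?h = "\<lambda>u. ln v + (u - v) / v - (u - v)\<^sup>2 / 2 - ln u"
  let ?d = "\<lambda>u. 1 / v - (u - v) - 1 / u"
  have der: "(?h has_real_derivative ?d x) (at x)" if "x > 0" for x
    using that assms by (auto intro!: derivative_eq_intros simp: field_simps)
  have d: "?d x = (x - v) * (1 / (x * v) - 1)" if "x > 0" for x
    using that assms by (simp add: field_simps)
  have f: "0 \<le> 1 / (x * v) - 1" if "x > 0" "x \<le> 1" for x
    using that assms mult_le_one[of x v] by (simp add: field_simps)
  have "?h v \<le> ?h u"
  proof (cases "v \<le> u")
    case True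
    show ?thesis
    proof (rule DERIV_nonneg_imp_nondecreasing[OF True])
      fix x assume x: "v \<le> x" "x \<le> u"
      have "0 \<le> ?d x" using x assms f[of x] by (subst d) auto
      then show "\<exists>y. (?h has_real_derivative y) (at x) \<and> 0 \<le> y" using der[of x] x assms by force
    qed
  next
    case False
    then have vu: "u \<le> v" by simp
    show ?thesis
    proof (rule DERIV_nonpos_imp_nonincreasing[OF vu])
      fix x assume x: "u \<le> x" "x \<le> v"
      have "?d x \<le> 0" using x assms f[of x] by (subst d) (auto intro!: mult_nonpos_nonneg)
      then show "\<exists>y. (?h has_real_derivative y) (at x) \<and> y \<le> 0" using der[of x] x assms by force
    qed
  qed
  then show ?thesis by simp
qed

lemma jacobi_density_eq:
  "jacobi_density \<beta> m a1 a2 = log_gas_density \<beta> m (jacobi_const \<beta> m a1 a2)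
     (\<lambda>x. x powr (a1 - (1 + \<beta> / 2 * (real m - 1))) * (1 - x) powr (a2 - (1 + \<beta> / 2 * (real m - 1)))) {0..1}"
  unfolding jacobi_density_def log_gas_density_def index_pairs_def Let_def by (intro ext) simp

lemma laguerre_density_eq:
  "laguerre_density \<beta> m a1 = log_gas_density \<beta> m (laguerre_const \<beta> m a1)
     (\<lambda>x. x powr (a1 - (1 + \<beta> / 2 * (real m - 1))) * exp (- x / 2)) {0..}"
proof
  fix x :: "nat \<Rightarrow> real"
  have "exp (- (\<Sum>i=1..m. x i) / 2) = (\<Prod>i=1..m. exp (- x i / 2))"
    unfolding sum_negf[symmetric] sum_divide_distrib by (rule exp_sum) simp
  then show "laguerre_density \<beta> m a1 x = log_gas_density \<beta> m (laguerre_const \<beta> m a1)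
     (\<lambda>x. x powr (a1 - (1 + \<beta> / 2 * (real m - 1))) * exp (- x / 2)) {0..} x"
    unfolding laguerre_density_def log_gas_density_def index_pairs_def Let_def by (simp add: prod.distrib mult.assoc)
qed

lemma card_index_pairs: "2 * card (index_pairs m) + m = m * m"
proof -
  have "(\<Sum>i=1..m. \<Sum>j=1..m. (1::real)) = 2 * (\<Sum>(i, j)\<in>index_pairs m. 1) + (\<Sum>i=1..m. 1)"
    by (rule sum_symmetric_index_pairs) simp
  then have "real (m * m) = real (2 * card (index_pairs m) + m)" by (simp add: case_prod_beta)
  then show ?thesis by (simp only: of_nat_eq_iff)
qed

lemma sum_index_shift: "(\<Sum>j=1..m. \<beta> * (real m - real j) / 2) = \<beta> * real m * (real m - 1) / 4"
proof -
  have s: "(\<Sum>j=1..n. real j) = real n * (real n + 1) / 2" for n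
    by (induction n) (auto simp: field_simps)
  have "(\<Sum>j=1..m. \<beta> * (real m - real j) / 2) = \<beta> / 2 * (\<Sum>j=1..m. real m - real j)"
    by (simp add: sum_distrib_left)
  also have "(\<Sum>j=1..m. real m - real j) = real m * (real m - 1) / 2"
    unfolding sum_subtractf s by (simp add: field_simps)
  finally show ?thesis by simp
qed

text \<open>That both densities have mass one is assumed here; the two given ensembles supply it in
  \<open>ensemble_pair_laws\<close>.\<close>

locale ensemble_pair =
  fixes \<beta> :: real and m :: nat and a1 a2 :: real
  assumes \<beta>_pos: "\<beta> > 0" and m_pos: "m \<ge> 1"
    and a1_gt: "a1 > \<beta> / 2 * (real m - 1)" and a2_gt: "a2 > \<beta> / 2 * (real m - 1)"
    and prob_J: "prob_space (density (lborel_vec m) (\<lambda>x. ennreal (jacobi_density \<beta> m a1 a2 x)))"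
    and prob_L: "prob_space (density (lborel_vec m) (\<lambda>x. ennreal (laguerre_density \<beta> m a1 x)))"
begin

abbreviation "PJ \<equiv> density (lborel_vec m) (\<lambda>x. ennreal (jacobi_density \<beta> m a1 a2 x))"
abbreviation "PL \<equiv> density (lborel_vec m) (\<lambda>x. ennreal (laguerre_density \<beta> m a1 x))"

definition shift :: "nat \<Rightarrow> real" where "shift j = \<beta> * (real m - real j) / 2"

lemma shift_bounds: "j \<in> {1..m} \<Longrightarrow> 0 \<le> shift j" "j \<in> {1..m} \<Longrightarrow> shift j < a1" "j \<in> {1..m} \<Longrightarrow> shift j < a2"
proof -
  assume j: "j \<in> {1..m}"
  then show "0 \<le> shift j" using \<beta>_pos by (simp add: shift_def)
  have "\<beta> / 2 * (real m - real j) \<le> \<beta> / 2 * (real m - 1)" using j \<beta>_pos by (intro mult_left_mono) auto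
  then show "shift j < a1" "shift j < a2" using a1_gt a2_gt by (auto simp: shift_def)
qed

lemma a12_pos: "a1 > 0" "a2 > 0"
  using shift_bounds[of m] m_pos by auto

lemma jacobi_const_eq: "jacobi_const \<beta> m a1 a2 =
    (\<Prod>j=1..m. Gamma (1 + \<beta> / 2) * Gamma (a1 + a2 - shift j) / (Gamma (1 + \<beta> * real j / 2) * Gamma (a1 - shift j) * Gamma (a2 - shift j)))"
  by (simp add: jacobi_const_def shift_def)

lemma laguerre_const_eq: "laguerre_const \<beta> m a1 =
    2 powr (- (real m * a1)) * (\<Prod>j=1..m. Gamma (1 + \<beta> / 2) / (Gamma (1 + \<beta> * real j / 2) * Gamma (a1 - shift j)))"
  by (simp add: laguerre_const_def shift_def)

lemma laguerre_const_pos: "laguerre_const \<beta> m a1 > 0"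
  unfolding laguerre_const_eq using shift_bounds \<beta>_pos
  by (intro mult_pos_pos prod_pos divide_pos_pos Gamma_real_pos ballI add_pos_nonneg) (auto simp: shift_def)

lemma jacobi_const_pos: "jacobi_const \<beta> m a1 a2 > 0"
proof -
  have "a1 + a2 - shift j > 0" if "j \<in> {1..m}" for j using shift_bounds[OF that] a12_pos by linarith
  then show ?thesis
    unfolding jacobi_const_eq using shift_bounds \<beta>_pos
    by (intro mult_pos_pos prod_pos divide_pos_pos Gamma_real_pos ballI add_pos_nonneg) auto
qed

sublocale J: jacobi_moments \<beta> m "jacobi_const \<beta> m a1 a2" a1 a2 PJ
proof (intro jacobi_moments.intro jacobi_gas.intro jacobi_moments_axioms.intro)
  show "PJ = density (lborel_vec m) (\<lambda>x. ennreal (log_gas_density \<beta> m (jacobi_const \<beta> m a1 a2)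
     (\<lambda>x. x powr (a1 - (1 + \<beta> / 2 * (real m - 1))) * (1 - x) powr (a2 - (1 + \<beta> / 2 * (real m - 1)))) {0..1} x))"
    by (simp only: jacobi_density_eq)
  show "0 \<le> jacobi_const \<beta> m a1 a2" by (rule less_imp_le[OF jacobi_const_pos])
qed (fact prob_J \<beta>_pos m_pos a1_gt a2_gt)+

sublocale Lg: laguerre_moments \<beta> m "laguerre_const \<beta> m a1" a1 PL
proof (intro laguerre_moments.intro laguerre_gas.intro laguerre_moments_axioms.intro)
  show "PL = density (lborel_vec m) (\<lambda>x. ennreal (log_gas_density \<beta> m (laguerre_const \<beta> m a1)
     (\<lambda>x. x powr (a1 - (1 + \<beta> / 2 * (real m - 1))) * exp (- x / 2)) {0..} x))"
    by (simp only: laguerre_density_eq)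
  show "0 \<le> laguerre_const \<beta> m a1" by (rule less_imp_le[OF laguerre_const_pos])
qed (fact prob_L \<beta>_pos m_pos a1_gt)+

end

section \<open>The rescaled Jacobi law, its likelihood ratio and the entropy bound\<close>

context ensemble_pair
begin

abbreviation "a \<equiv> J.a"

abbreviation "b \<equiv> a2 - (1 + \<beta> / 2 * (real m - 1))"

abbreviation "dilate \<equiv> scale_vec m (2 * a)"

definition ratio_const :: real where
  "ratio_const = jacobi_const \<beta> m a1 a2 / (laguerre_const \<beta> m a1 * (2 * a) powr (real m * a1))"

text \<open>The condition \<open>y i \<le> 2 * a\<close> marks the image of the unit cube from
  above; the lower boundary is left to the Laguerre density, which vanishes off the orthant. The
  exponential undoes the one in that density.\<close>

definition ratio :: "(nat \<Rightarrow> real) \<Rightarrow> real" where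
  "ratio y = (if \<forall>i\<in>{1..m}. y i \<le> 2 * a
     then ratio_const * (\<Prod>i=1..m. (1 - y i / (2 * a)) powr b) * exp ((\<Sum>i=1..m. y i) / 2) else 0)"

definition PS :: "(nat \<Rightarrow> real) measure" where
  "PS = distr PJ (lborel_vec m) dilate"

lemma a_pos: "a > 0" by (rule J.a_pos)

lemma ratio_const_pos: "ratio_const > 0"
  unfolding ratio_const_def using laguerre_const_pos jacobi_const_pos a_pos by simp

lemma ratio_nonneg: "0 \<le> ratio y"
  unfolding ratio_def using ratio_const_pos by (auto intro!: mult_nonneg_nonneg prod_nonneg)

lemma ratio_measurable [measurable]: "ratio \<in> borel_measurable (lborel_vec m)"
  unfolding ratio_def by measurable

lemma dilate_measurable [measurable]: "dilate \<in> measurable (lborel_vec m) (lborel_vec m)"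
  unfolding scale_vec_def by measurable

lemma density_measurable [measurable]:
  "jacobi_density \<beta> m a1 a2 \<in> borel_measurable (lborel_vec m)"
  "laguerre_density \<beta> m a1 \<in> borel_measurable (lborel_vec m)"
  unfolding jacobi_density_eq laguerre_density_eq by (rule J.density_measurable Lg.density_measurable)+

lemma dilated_density:
  assumes x: "\<forall>i\<in>{1..m}. x i \<in> {0..1}"
  shows "laguerre_density \<beta> m a1 (dilate x) * ratio (dilate x) * (2 * a) ^ m = jacobi_density \<beta> m a1 a2 x"
proof -
  let ?\<alpha> = "a1 - (1 + \<beta> / 2 * (real m - 1))"
  let ?V = "\<Prod>(i, j)\<in>index_pairs m. \<bar>x i - x j\<bar> powr \<beta>"
  have a2_pos: "2 * a > 0" using a_pos by simp
  have T: "dilate x i = 2 * a * x i" if "i \<in> {1..m}" for i using that by (simp add: scale_vec_def)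
  have nonneg: "\<forall>i\<in>{1..m}. dilate x i \<in> {0..}" using x a_pos T by auto
  have le: "\<forall>i\<in>{1..m}. dilate x i \<le> 2 * a" using x a_pos T by (auto intro: mult_left_le)
  have "laguerre_density \<beta> m a1 (dilate x) = laguerre_const \<beta> m a1 *
     (\<Prod>(i, j)\<in>index_pairs m. \<bar>dilate x i - dilate x j\<bar> powr \<beta>) * (\<Prod>i=1..m. dilate x i powr ?\<alpha> * exp (- dilate x i / 2))"
    unfolding laguerre_density_eq log_gas_density_def by (rule if_P[OF nonneg])
  also have "(\<Prod>(i, j)\<in>index_pairs m. \<bar>dilate x i - dilate x j\<bar> powr \<beta>) =
      (\<Prod>(i, j)\<in>index_pairs m. (2 * a) powr \<beta> * \<bar>x i - x j\<bar> powr \<beta>)"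
  proof (rule prod.cong[OF refl], clarify)
    fix i j assume "(i, j) \<in> index_pairs m"
    then have ij: "i \<in> {1..m}" "j \<in> {1..m}" by (auto simp: index_pairs_def)
    have "\<bar>dilate x i - dilate x j\<bar> = 2 * a * \<bar>x i - x j\<bar>"
      unfolding T[OF ij(1)] T[OF ij(2)] right_diff_distrib[symmetric] abs_mult using a2_pos by simp
    then show "\<bar>dilate x i - dilate x j\<bar> powr \<beta> = (2 * a) powr \<beta> * \<bar>x i - x j\<bar> powr \<beta>"
      by (simp only: powr_mult)
  qed
  also have "\<dots> = ((2 * a) powr \<beta>) ^ card (index_pairs m) * ?V"
    by (simp add: prod.distrib case_prod_beta)
  also have "(\<Prod>i=1..m. dilate x i powr ?\<alpha> * exp (- dilate x i / 2)) = (\<Prod>i=1..m. (2 * a) powr ?\<alpha> * (x i powr ?\<alpha> * exp (- (a * x i))))"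
  proof (rule prod.cong[OF refl])
    fix i assume i: "i \<in> {1..m}"
    have "- (2 * a * x i) / 2 = - (a * x i)" by simp
    then show "dilate x i powr ?\<alpha> * exp (- dilate x i / 2) = (2 * a) powr ?\<alpha> * (x i powr ?\<alpha> * exp (- (a * x i)))"
      unfolding T[OF i] by (simp only: powr_mult mult.assoc)
  qed
  also have "\<dots> = ((2 * a) powr ?\<alpha>) ^ m * ((\<Prod>i=1..m. x i powr ?\<alpha>) * exp (- (a * (\<Sum>i=1..m. x i))))"
    by (simp add: prod.distrib exp_sum[symmetric] sum_negf sum_distrib_left)
  finally have L: "laguerre_density \<beta> m a1 (dilate x) = laguerre_const \<beta> m a1 * (((2 * a) powr \<beta>) ^ card (index_pairs m) * ?V) *
      (((2 * a) powr ?\<alpha>) ^ m * ((\<Prod>i=1..m. x i powr ?\<alpha>) * exp (- (a * (\<Sum>i=1..m. x i)))))" .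
  have "ratio (dilate x) = ratio_const * (\<Prod>i=1..m. (1 - dilate x i / (2 * a)) powr b) * exp ((\<Sum>i=1..m. dilate x i) / 2)"
    unfolding ratio_def by (rule if_P[OF le])
  also have "(\<Prod>i=1..m. (1 - dilate x i / (2 * a)) powr b) = (\<Prod>i=1..m. (1 - x i) powr b)"
    using T a_pos by (intro prod.cong) auto
  also have "(\<Sum>i=1..m. dilate x i) = 2 * (a * (\<Sum>i=1..m. x i))"
    unfolding sum_distrib_left using T by (intro sum.cong) auto
  finally have R: "ratio (dilate x) = ratio_const * (\<Prod>i=1..m. (1 - x i) powr b) * exp (a * (\<Sum>i=1..m. x i))"
    by simp
  \<comment> \<open>Degree count: \<beta> for each of the m (m - 1) / 2 pairs, the exponent of x for
    each coordinate, and m for the Jacobian add up to m a1, the power in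
    \<open>ratio_const\<close>.\<close>
  have pw: "((2 * a) powr \<beta>) ^ card (index_pairs m) * ((2 * a) powr ?\<alpha>) ^ m * (2 * a) ^ m = (2 * a) powr (real m * a1)"
  proof -
    have "real (2 * card (index_pairs m) + m) = real (m * m)" by (simp only: card_index_pairs)
    then have c: "real (card (index_pairs m)) = (real m * real m - real m) / 2" by simp
    have "((2 * a) powr \<beta>) ^ card (index_pairs m) * ((2 * a) powr ?\<alpha>) ^ m * (2 * a) ^ m
        = (2 * a) powr (\<beta> * real (card (index_pairs m)) + ?\<alpha> * real m + real m)"
      using a2_pos by (simp add: powr_add powr_powr[symmetric] powr_realpow)
    also have "\<beta> * real (card (index_pairs m)) + ?\<alpha> * real m + real m = real m * a1"
      unfolding c by (simp add: field_simps)
    finally show ?thesis .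
  qed
  have e: "exp (- (a * (\<Sum>i=1..m. x i))) * exp (a * (\<Sum>i=1..m. x i)) = 1"
    by (simp add: mult_exp_exp)
  have "laguerre_density \<beta> m a1 (dilate x) * ratio (dilate x) * (2 * a) ^ m =
     (ratio_const * laguerre_const \<beta> m a1 * (((2 * a) powr \<beta>) ^ card (index_pairs m) * ((2 * a) powr ?\<alpha>) ^ m * (2 * a) ^ m)) * ?V
      * ((\<Prod>i=1..m. x i powr ?\<alpha>) * (\<Prod>i=1..m. (1 - x i) powr b)) * (exp (- (a * (\<Sum>i=1..m. x i))) * exp (a * (\<Sum>i=1..m. x i)))"
    unfolding L R by (simp only: ac_simps)
  also have "\<dots> = jacobi_const \<beta> m a1 a2 * ?V * (\<Prod>i=1..m. x i powr ?\<alpha> * (1 - x i) powr b)"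
    unfolding pw e ratio_const_def prod.distrib using laguerre_const_pos a2_pos by simp
  also have "\<dots> = jacobi_density \<beta> m a1 a2 x"
    unfolding jacobi_density_eq log_gas_density_def by (rule if_P[OF x, symmetric])
  finally show ?thesis .
qed

lemma PS_eq: "PS = density PL (\<lambda>y. ennreal (ratio y))"
proof (rule measure_eqI)
  fix A assume "A \<in> sets PS"
  then have [measurable]: "A \<in> sets (lborel_vec m)" by (simp add: PS_def)
  let ?L = "lborel_vec m"
  let ?fL = "laguerre_density \<beta> m a1"
  have key: "ennreal (?fL (dilate x)) * ennreal (ratio (dilate x)) * indicator A (dilate x) * (\<Prod>i\<in>{1..m}. ennreal (2 * a) * indicator {0..1} (x i)) =
     ennreal (jacobi_density \<beta> m a1 a2 x) * indicator A (dilate x)" for x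
  proof (cases "\<forall>i\<in>{1..m}. x i \<in> {0..1}")
    case True
    have "(\<Prod>i\<in>{1..m}. ennreal (2 * a) * indicator {0..1} (x i)) = (\<Prod>i\<in>{1..m}. ennreal (2 * a))"
      using True by (intro prod.cong) auto
    also have "\<dots> = ennreal (2 * a) ^ m" by simp
    also have "\<dots> = ennreal ((2 * a) ^ m)" using a_pos by (intro ennreal_power) auto
    finally have "ennreal (?fL (dilate x)) * ennreal (ratio (dilate x)) * (\<Prod>i\<in>{1..m}. ennreal (2 * a) * indicator {0..1} (x i))
      = ennreal (?fL (dilate x) * ratio (dilate x) * (2 * a) ^ m)"
      using ratio_nonneg a_pos by (simp add: ennreal_mult''[symmetric])
    then show ?thesis unfolding dilated_density[OF True] by (simp only: ac_simps)
  next
    case False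
    then obtain i where "i \<in> {1..m}" "x i \<notin> {0..1}" by auto
    then have "(\<Prod>i\<in>{1..m}. ennreal (2 * a) * indicator {0..1} (x i)) = 0"
      by (intro prod_zero bexI[of _ i]) auto
    moreover have "jacobi_density \<beta> m a1 a2 x = 0"
      unfolding jacobi_density_eq log_gas_density_def by (rule if_not_P[OF False])
    ultimately show ?thesis by simp
  qed
  have one: "(\<integral>\<^sup>+x. ennreal (2 * a) * indicator {0..1} x * indicator A (2 * a * x) \<partial>lborel) = (\<integral>\<^sup>+y. indicator {0..2 * a} y * indicator A y \<partial>lborel)"
    if "A \<in> sets borel" for A :: "real set"
  proof -
    have "(\<integral>\<^sup>+x. ennreal (2 * a) * indicator {0..1} x * indicator A (2 * a * x) \<partial>lborel) = (\<integral>\<^sup>+y. indicator {2 * a * 0..2 * a * 1} y * indicator A y \<partial>lborel)"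
      using that a_pos by (intro nn_integral_subst_Icc) (auto intro!: derivative_eq_intros)
    then show ?thesis by simp
  qed
  have [measurable]: "(\<lambda>y. ennreal (?fL y) * ennreal (ratio y) * indicator A y) \<in> borel_measurable ?L"
    by measurable
  have I: "ennreal (?fL y) * ennreal (ratio y) * (\<Prod>i\<in>{1..m}. indicator {0..2 * a} (y i)) = ennreal (?fL y) * ennreal (ratio y)" for y
  proof (cases "\<forall>i\<in>{1..m}. y i \<in> {0..2 * a}")
    case True
    then show ?thesis by (simp add: prod.neutral)
  next
    case False
    then have "(\<not> (\<forall>i\<in>{1..m}. y i \<in> {0..})) \<or> \<not> (\<forall>i\<in>{1..m}. y i \<le> 2 * a)" by auto
    then have "?fL y = 0 \<or> ratio y = 0"
      unfolding laguerre_density_eq log_gas_density_def ratio_def by metis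
    then show ?thesis by auto
  qed
  have "emeasure (density PL (\<lambda>y. ennreal (ratio y))) A = (\<integral>\<^sup>+y. ennreal (?fL y) * ennreal (ratio y) * indicator A y \<partial>?L)"
    by (subst density_density_eq) (auto simp: emeasure_density)
  also have "\<dots> = (\<integral>\<^sup>+y. (ennreal (?fL y) * ennreal (ratio y) * indicator A y) * (\<Prod>i\<in>{1..m}. indicator {0..2 * a} (y i)) \<partial>?L)"
  proof (rule nn_integral_cong)
    fix y
    show "ennreal (?fL y) * ennreal (ratio y) * indicator A y = (ennreal (?fL y) * ennreal (ratio y) * indicator A y) * (\<Prod>i\<in>{1..m}. indicator {0..2 * a} (y i))"
      by (subst I[symmetric]) (simp only: ac_simps)
  qed
  also have "\<dots> = (\<integral>\<^sup>+x. (ennreal (?fL (\<lambda>i\<in>{1..m}. 2 * a * x i)) * ennreal (ratio (\<lambda>i\<in>{1..m}. 2 * a * x i)) * indicator A (\<lambda>i\<in>{1..m}. 2 * a * x i))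
      * (\<Prod>i\<in>{1..m}. ennreal (2 * a) * indicator {0..1} (x i)) \<partial>?L)"
    by (rule nn_integral_PiM_lborel_subst[OF _ _ _ _ _ _ one]) auto
  also have "\<dots> = (\<integral>\<^sup>+x. ennreal (jacobi_density \<beta> m a1 a2 x) * indicator A (dilate x) \<partial>?L)"
    unfolding key[symmetric] by (simp only: scale_vec_def)
  also have "\<dots> = (\<integral>\<^sup>+x. indicator A (dilate x) \<partial>PJ)"
    by (subst nn_integral_density) auto
  also have "\<dots> = (\<integral>\<^sup>+y. indicator A y \<partial>PS)"
    unfolding PS_def by (subst nn_integral_distr) auto
  also have "\<dots> = emeasure PS A"
    by (subst nn_integral_indicator) (auto simp: PS_def)
  finally show "emeasure PS A = emeasure (density PL (\<lambda>y. ennreal (ratio y))) A" ..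
qed (simp add: PS_def)

lemma prob_PS: "prob_space PS"
  unfolding PS_def by (rule J.prob_space_distr) (simp cong: measurable_cong_sets)

sublocale LR: likelihood_ratio PL ratio PS
proof (intro likelihood_ratio.intro likelihood_ratio_axioms.intro)
  show "ratio \<in> borel_measurable PL" by (simp cong: measurable_cong_sets)
qed (fact prob_L PS_eq ratio_nonneg prob_PS)+

lemma integral_PS:
  fixes g :: "(nat \<Rightarrow> real) \<Rightarrow> real"
  shows "g \<in> borel_measurable (lborel_vec m) \<Longrightarrow> (\<integral>y. g y \<partial>PS) = (\<integral>x. g (dilate x) \<partial>PJ)"
  unfolding PS_def by (subst integral_distr) (simp_all cong: measurable_cong_sets)

lemma integrable_PS:
  fixes g :: "(nat \<Rightarrow> real) \<Rightarrow> real"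
  shows "g \<in> borel_measurable (lborel_vec m) \<Longrightarrow> integrable PS g \<longleftrightarrow> integrable PJ (\<lambda>x. g (dilate x))"
  unfolding PS_def by (subst integrable_distr_eq) (simp_all cong: measurable_cong_sets)

text \<open>All factors without \<open>a2\<close> cancel, and so do the powers of 2. What remains is
  the product of Gamma (a - s_j) / Gamma (a2 - s_j) over the shifts s_j, times a^(- m a1).
  \<open>ln_Gamma_diff_le\<close> bounds each quotient, and its terms a1 ln a cancel the power of
  a.\<close>

lemma ln_ratio_const: "ln ratio_const \<le> - (real m * a1) - (real m * a2 - \<beta> * real m * (real m - 1) / 4) * ln (a2 / a)"
proof -
  let ?G = "\<lambda>j. Gamma (a - shift j) / Gamma (a2 - shift j)"
  have pos: "0 < Gamma (a - shift j)" "0 < Gamma (a2 - shift j)" "0 < Gamma (a1 - shift j)" "0 < Gamma (1 + \<beta> * real j / 2)" if "j \<in> {1..m}" for j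
    using shift_bounds[OF that] a12_pos \<beta>_pos by (auto intro!: Gamma_real_pos add_pos_nonneg simp: J.a_def)
  have "0 < Gamma (1 + \<beta> / 2)" using \<beta>_pos by (intro Gamma_real_pos) auto
  then have "jacobi_const \<beta> m a1 a2 / (\<Prod>j=1..m. Gamma (1 + \<beta> / 2) / (Gamma (1 + \<beta> * real j / 2) * Gamma (a1 - shift j))) = (\<Prod>j=1..m. ?G j)"
    unfolding jacobi_const_eq J.a_def[symmetric] prod_dividef[symmetric]
    using pos by (intro prod.cong refl) (simp add: less_imp_neq[THEN not_sym])
  then have rc: "ratio_const = (\<Prod>j=1..m. ?G j) * a powr (- (real m * a1))"
    unfolding ratio_const_def laguerre_const_eq using a_pos
    by (simp add: powr_mult powr_minus field_simps)
  have "ln ratio_const = (\<Sum>j=1..m. ln (?G j)) - real m * a1 * ln a"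
  proof -
    have "(\<Prod>j=1..m. ?G j) > 0" using pos by (intro prod_pos) auto
    then have "ln ratio_const = ln (\<Prod>j=1..m. ?G j) + ln (a powr (- (real m * a1)))"
      unfolding rc using a_pos by (intro ln_mult_pos) auto
    also have "ln (\<Prod>j=1..m. ?G j) = (\<Sum>j=1..m. ln (?G j))" using pos by (intro ln_prod) force+
    finally show ?thesis using a_pos by (simp add: ln_powr)
  qed
  also have "(\<Sum>j=1..m. ln (?G j)) \<le> (\<Sum>j=1..m. a1 * ln a - a1 - (a2 - shift j) * ln (a2 / a))"
  proof (rule sum_mono)
    fix j assume j: "j \<in> {1..m}"
    have "ln (?G j) = ln (Gamma (a - shift j)) - ln (Gamma (a2 - shift j))"
      using pos[OF j] by (intro ln_divide_pos) auto
    also have "\<dots> \<le> (a - a2) * ln a - (a - a2) - (a2 - shift j) * ln (a2 / a)"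
      using shift_bounds[OF j] a12_pos by (intro ln_Gamma_diff_le) (auto simp: J.a_def)
    finally show "ln (?G j) \<le> a1 * ln a - a1 - (a2 - shift j) * ln (a2 / a)" by (simp add: J.a_def)
  qed
  also have "(\<Sum>j=1..m. a1 * ln a - a1 - (a2 - shift j) * ln (a2 / a)) =
     real m * (a1 * ln a - a1) - (real m * a2 - (\<Sum>j=1..m. shift j)) * ln (a2 / a)"
    by (simp add: sum_subtractf sum_distrib_right[symmetric])
  also have "(\<Sum>j=1..m. shift j) = \<beta> * real m * (real m - 1) / 4"
    unfolding shift_def by (rule sum_index_shift)
  finally show ?thesis by (simp add: algebra_simps)
qed

text \<open>The logarithm of \<open>ratio\<close> with each ln (1 - x_i) replaced by the right-hand
  side of \<open>ln_le_quadratic\<close> at v = 1 - p = a2 / a.\<close>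

definition log_bound :: "(nat \<Rightarrow> real) \<Rightarrow> real" where
  "log_bound y = ln ratio_const + real m * b * ln (a2 / a)
     + (\<Sum>i=1..m. - b * (y i / (2 * a) - J.p) * (a / a2) - b * (y i / (2 * a) - J.p)\<^sup>2 / 2 + y i / 2)"

lemma log_bound_measurable [measurable]: "log_bound \<in> borel_measurable (lborel_vec m)"
  unfolding log_bound_def by measurable

lemma log_bound_dilate: "log_bound (dilate x) = ln ratio_const + real m * b * ln (a2 / a)
    + (- b * (a / a2) * (J.S 1 x - real m * J.p) - b / 2 * J.Y x + a * J.S 1 x)"
proof -
  have "(\<Sum>i=1..m. - b * (dilate x i / (2 * a) - J.p) * (a / a2) - b * (dilate x i / (2 * a) - J.p)\<^sup>2 / 2 + dilate x i / 2)
    = (\<Sum>i=1..m. - b * (a / a2) * (x i ^ 1 - J.p) - b / 2 * (x i - J.p)\<^sup>2 + a * x i ^ 1)"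
    using a_pos by (intro sum.cong refl) (simp add: scale_vec_def)
  also have "\<dots> = - b * (a / a2) * (J.S 1 x - real m * J.p) - b / 2 * J.Y x + a * J.S 1 x"
    unfolding J.Y_eq power_sum_def sum.distrib sum_subtractf sum_distrib_left[symmetric] by simp
  finally show ?thesis unfolding log_bound_def by (simp only:)
qed

lemma ln_ratio_le:
  assumes b: "b \<ge> 0" and x: "x \<in> J.supp" and pos: "ratio (dilate x) > 0"
  shows "ln (ratio (dilate x)) \<le> log_bound (dilate x)"
proof -
  have x01: "x i \<in> {0..1}" if "i \<in> {1..m}" for i using J.supp_I[OF x that] .
  have T: "dilate x i = 2 * a * x i" if "i \<in> {1..m}" for i using that by (simp add: scale_vec_def)
  have "\<forall>i\<in>{1..m}. dilate x i \<le> 2 * a" using pos unfolding ratio_def by (auto split: if_splits)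
  then have R: "ratio (dilate x) = ratio_const * (\<Prod>i=1..m. (1 - dilate x i / (2 * a)) powr b) * exp ((\<Sum>i=1..m. dilate x i) / 2)"
    unfolding ratio_def by (rule if_P)
  have "(\<Prod>i=1..m. (1 - dilate x i / (2 * a)) powr b) = (\<Prod>i=1..m. (1 - x i) powr b)"
    using T a_pos by (intro prod.cong) auto
  note R = R[unfolded this]
  \<comment> \<open>Since \<open>0 powr b = 0\<close> even for b = 0, positivity of the ratio
    excludes x_i = 1, and the logarithms below are taken of positive numbers.\<close>
  have prod: "(\<Prod>i=1..m. (1 - x i) powr b) \<noteq> 0" using pos unfolding R by (metis less_irrefl mult_zero_left mult_zero_right)
  have ne: "(1 - x i) powr b \<noteq> 0" if "i \<in> {1..m}" for i
    using prod that by (auto simp: prod_zero_iff)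
  then have lt: "0 < 1 - x i" if "i \<in> {1..m}" for i using x01[OF that] ne[OF that] by (cases "x i = 1") auto
  have pp: "(\<Prod>i=1..m. (1 - x i) powr b) > 0" using lt by (intro prod_pos) force
  have distr: "B * (X - Y * q - Z / 2) = B * X - B * Y * q - B * Z / 2" for B X Y Z q :: real
    by (simp add: algebra_simps)
  have s0: "ln (ratio (dilate x)) = ln ratio_const + ln (\<Prod>i=1..m. (1 - x i) powr b) + (\<Sum>i=1..m. dilate x i) / 2"
    unfolding R using pp ratio_const_pos by (simp add: ln_mult_pos)
  have s1: "ln (\<Prod>i=1..m. (1 - x i) powr b) = (\<Sum>i=1..m. ln ((1 - x i) powr b))"
    using ne lt by (intro ln_prod) force+
  have s2: "(\<Sum>i=1..m. ln ((1 - x i) powr b)) \<le> (\<Sum>i=1..m. b * ln (a2 / a) - b * (x i - J.p) * (a / a2) - b * (x i - J.p)\<^sup>2 / 2)"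
  proof (rule sum_mono)
    fix i assume i: "i \<in> {1..m}"
    have p1: "1 - J.p = a2 / a" using a_pos by (simp add: J.p_def J.a_def field_simps)
    have "ln (1 - x i) \<le> ln (1 - J.p) + ((1 - x i) - (1 - J.p)) / (1 - J.p) - ((1 - x i) - (1 - J.p))\<^sup>2 / 2"
      using lt[OF i] x01[OF i] J.p_bounds by (intro ln_le_quadratic) auto
    also have "\<dots> = ln (a2 / a) - (x i - J.p) * (a / a2) - (x i - J.p)\<^sup>2 / 2"
    proof -
      have d: "(1 - x i) - (1 - J.p) = - (x i - J.p)" by simp
      show ?thesis unfolding d unfolding power2_minus p1 by (simp del: minus_diff_eq)
    qed
    finally have "b * ln (1 - x i) \<le> b * (ln (a2 / a) - (x i - J.p) * (a / a2) - (x i - J.p)\<^sup>2 / 2)" using b by (intro mult_left_mono)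
    moreover have "ln ((1 - x i) powr b) = b * ln (1 - x i)" using lt[OF i] by (simp add: ln_powr)
    ultimately show "ln ((1 - x i) powr b) \<le> b * ln (a2 / a) - b * (x i - J.p) * (a / a2) - b * (x i - J.p)\<^sup>2 / 2"
      by (simp only: distr)
  qed
  have s3: "(\<Sum>i=1..m. b * ln (a2 / a) - b * (x i - J.p) * (a / a2) - b * (x i - J.p)\<^sup>2 / 2) =
     real m * b * ln (a2 / a) + (\<Sum>i=1..m. - b * (dilate x i / (2 * a) - J.p) * (a / a2) - b * (dilate x i / (2 * a) - J.p)\<^sup>2 / 2)"
  proof -
    have "(\<Sum>i=1..m. - b * (dilate x i / (2 * a) - J.p) * (a / a2) - b * (dilate x i / (2 * a) - J.p)\<^sup>2 / 2) =
      (\<Sum>i=1..m. - b * (x i - J.p) * (a / a2) - b * (x i - J.p)\<^sup>2 / 2)"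
      using T a_pos by (intro sum.cong) auto
    moreover have "(\<Sum>i=1..m. b * ln (a2 / a) - b * (x i - J.p) * (a / a2) - b * (x i - J.p)\<^sup>2 / 2) =
      (\<Sum>i=1..m. b * ln (a2 / a)) + (\<Sum>i=1..m. - b * (x i - J.p) * (a / a2) - b * (x i - J.p)\<^sup>2 / 2)"
      unfolding sum.distrib[symmetric] by (simp only: mult_minus_left diff_conv_add_uminus add.assoc)
    moreover have "(\<Sum>i=1..m. b * ln (a2 / a)) = real m * b * ln (a2 / a)"
      by (simp only: sum_constant card_atLeastAtMost diff_Suc_1 mult.assoc add_diff_cancel_right' Suc_eq_plus1)
    ultimately show ?thesis by (simp only:)
  qed
  have "ln (ratio (dilate x)) \<le> ln ratio_const + (real m * b * ln (a2 / a) +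
     (\<Sum>i=1..m. - b * (dilate x i / (2 * a) - J.p) * (a / a2) - b * (dilate x i / (2 * a) - J.p)\<^sup>2 / 2)) + (\<Sum>i=1..m. dilate x i) / 2"
    using s2 unfolding s0 s1 s3 by simp
  also have "\<dots> = log_bound (dilate x)" unfolding log_bound_def by (simp add: sum.distrib sum_divide_distrib)
  finally show ?thesis .
qed

lemma integrable_log_bound: "integrable PS log_bound"
  and integral_log_bound: "(\<integral>y. log_bound y \<partial>PS) = ln ratio_const + real m * b * ln (a2 / a) - b / 2 * (\<integral>x. J.Y x \<partial>PJ) + real m * a1"
proof -
  have i: "integrable PJ (\<lambda>x. J.S 1 x - real m * J.p)" by simp
  show "integrable PS log_bound"
    by (subst integrable_PS) (auto simp: log_bound_dilate)
  have "(\<integral>y. log_bound y \<partial>PS) = (\<integral>x. ln ratio_const + real m * b * ln (a2 / a)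
      + (- b * (a / a2) * (J.S 1 x - real m * J.p) - b / 2 * J.Y x + a * J.S 1 x) \<partial>PJ)"
    unfolding log_bound_dilate[symmetric] by (rule integral_PS[OF log_bound_measurable])
  also have "\<dots> = ln ratio_const + real m * b * ln (a2 / a)
      + (- b * (a / a2) * (\<integral>x. J.S 1 x - real m * J.p \<partial>PJ) - b / 2 * (\<integral>x. J.Y x \<partial>PJ) + a * (\<integral>x. J.S 1 x \<partial>PJ))"
    using i J.integrable_Y J.integrable_power_sum(1) J.prob_space
    by (simp only: Bochner_Integration.integral_add Bochner_Integration.integral_diff Bochner_Integration.integrable_add
        Bochner_Integration.integrable_diff integrable_mult_right integral_mult_right_zero J.integrable_const
        lebesgue_integral_const scaleR_one mult_1)
  also have "\<dots> = ln ratio_const + real m * b * ln (a2 / a) - b / 2 * (\<integral>x. J.Y x \<partial>PJ) + real m * a1"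
    unfolding J.mean_S1_centred J.mean_S1 J.a_mp by simp
  finally show "(\<integral>y. log_bound y \<partial>PS) = ln ratio_const + real m * b * ln (a2 / a) - b / 2 * (\<integral>x. J.Y x \<partial>PJ) + real m * a1" .
qed

lemma AE_ln_ratio_le:
  assumes "b \<ge> 0" shows "AE y in PS. ln (ratio y) \<le> log_bound y"
proof -
  have "AE x in PJ. ratio (dilate x) > 0"
    using LR.AE_\<rho>_pos unfolding PS_def by (subst (asm) AE_distr_iff) (auto cong: measurable_cong_sets)
  then have "AE x in PJ. ln (ratio (dilate x)) \<le> log_bound (dilate x)"
    using J.AE_supp by eventually_elim (rule ln_ratio_le[OF assms])
  then show ?thesis unfolding PS_def by (subst AE_distr_iff) (auto cong: measurable_cong_sets)
qed

lemma kl_upper: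
  assumes b: "b \<ge> 0"
  obtains k where "kl_distance PS PL = ereal k" "0 \<le> k"
    "k \<le> ln ratio_const + real m * b * ln (a2 / a) - b / 2 * (\<integral>x. J.Y x \<partial>PJ) + real m * a1"
    "\<And>\<eta>. \<eta> > 0 \<Longrightarrow> LR.l1_distance \<le> k / (2 * \<eta>) + 2 * \<eta>"
proof -
  have i: "integrable PS (\<lambda>y. ln (ratio y))"
    by (rule LR.integrable_ln_\<rho>[OF integrable_log_bound AE_ln_ratio_le[OF b]])
  show ?thesis
  proof (rule that[of "\<integral>y. ln (ratio y) \<partial>PS"])
    show "kl_distance PS PL = ereal (\<integral>y. ln (ratio y) \<partial>PS)" using i by (simp add: LR.kl_distance_eq)
    show "0 \<le> (\<integral>y. ln (ratio y) \<partial>PS)" by (rule LR.kl_nonneg[OF i])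
    show "(\<integral>y. ln (ratio y) \<partial>PS) \<le> ln ratio_const + real m * b * ln (a2 / a) - b / 2 * (\<integral>x. J.Y x \<partial>PJ) + real m * a1"
      unfolding integral_log_bound[symmetric] by (rule integral_mono_AE[OF i integrable_log_bound AE_ln_ratio_le[OF b]])
    show "LR.l1_distance \<le> (\<integral>y. ln (ratio y) \<partial>PS) / (2 * \<eta>) + 2 * \<eta>" if "\<eta> > 0" for \<eta>
      by (rule LR.weak_pinsker[OF i that])
  qed
qed

end

section \<open>Two-sided bounds on both distances\<close>

context ensemble_pair
begin

lemma a_eq: "a = a1 + a2" by (simp add: J.a_def)

text \<open>The constraint a1 > \<beta>/2 (m - 1) turns a bound on m a1 into one on m (m -
  1).\<close>

lemma m_square_le:
  assumes R: "real m * a1 \<le> R * a2" "R \<ge> 0" and a: "a \<ge> 1"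
  shows "(real m)\<^sup>2 \<le> (1 + 4 * R / \<beta>) * a"
proof -
  have "real m * (\<beta> / 2 * (real m - 1)) \<le> real m * a1" using a1_gt by (intro mult_left_mono) auto
  also have "\<dots> \<le> R * a" using R mult_left_mono[of a2 a R] a12_pos by (simp add: a_eq)
  finally have "4 / \<beta> * (real m * (\<beta> / 2 * (real m - 1))) \<le> 4 / \<beta> * (R * a)" using \<beta>_pos by (intro mult_left_mono) auto
  moreover have "4 / \<beta> * (real m * (\<beta> / 2 * (real m - 1))) = 2 * (real m * (real m - 1))"
    using \<beta>_pos by simp
  moreover have "real m * (real m - 1) = (real m)\<^sup>2 - real m" by (simp add: power2_eq_square algebra_simps)
  ultimately have "2 * ((real m)\<^sup>2 - real m) \<le> 4 * R / \<beta> * a" by (simp only:) simp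
  \<comment> \<open>Hence 2 (m^2 - m) is at least m^2 - 1, and the 1 is absorbed by a \<ge>
    1.\<close>
  moreover have "0 \<le> (real m - 1)\<^sup>2" by simp
  then have "2 * real m \<le> (real m)\<^sup>2 + 1" by (simp add: power2_diff)
  moreover define X where "X = 4 * R / \<beta> * a"
  moreover define M2 where "M2 = (real m)\<^sup>2"
  ultimately have "M2 \<le> 1 * a + X" using a by (simp add: algebra_simps)
  then show ?thesis unfolding distrib_right X_def M2_def .
qed

lemma \<delta>_le: "J.\<delta> \<le> (1 + \<beta>) * real m"
proof -
  have "0 \<le> \<beta> / 2 * real m" using \<beta>_pos by simp
  then show ?thesis using J.\<delta>_bounds(2) unfolding distrib_right by linarith
qed

text \<open>The bound for 1 + \<delta> (1 - q) + q e in \<open>kl_bracket\<close>, with 1 + 4 /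
  \<beta> as the constant of \<open>m_square_le\<close> for R = 1.\<close>

definition kl_const :: real where
  "kl_const = 1 + 2 * (1 + \<beta>) * (2 + (1 + 4 / \<beta>) + (1 + \<beta>) * (1 + 4 / \<beta>)) + 2 * (1 + \<beta>)"

lemma kl_const_pos: "kl_const > 0"
  unfolding kl_const_def using \<beta>_pos by (intro add_pos_pos mult_pos_pos) auto

text \<open>The terms of order \<open>\<delta>\<close> in \<open>ln ratio_const\<close> and in \<open>E Y\<close> cancel up to the factor \<open>1 - q\<close>.\<close>

lemma kl_bracket:
  assumes small: "real m * a1 \<le> a2" and a: "a \<ge> 2 * (1 + \<beta>)" and b0: "b \<ge> 0"
  shows "ln ratio_const + real m * b * ln (a2 / a) - b / 2 * (\<integral>x. J.Y x \<partial>PJ) + real m * a1 \<le>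
     real m * a1 / a2 * (kl_const / 2)"
proof -
  define K where "K = 1 + 4 / \<beta>"
  define \<epsilon> where "\<epsilon> = real m * a1 / a2"
  define y where "y = (\<integral>x. J.Y x \<partial>PJ)"
  \<comment> \<open>\<open>Dy\<close> will say D E Y \<ge> m p (\<delta> - e), so \<open>e\<close>
    collects the corrections to the leading value \<delta>. As m p = \<epsilon> a2 / a, the factor
    \<open>q\<close> is what turns this into b E Y \<ge> \<epsilon> q (\<delta> - e).\<close>
  define e where "e = J.p * (1 - \<beta> / 2) + \<beta> * (real m * a1 + 1) / (2 * a)"
  define q where "q = a2 * b / (a * J.D)"
  have a0: "a > 0" by (rule a_pos)
  have "2 + 2 * \<beta> \<le> a" using a by (simp add: algebra_simps)
  then have a1': "a \<ge> 1" and D: "J.D \<ge> a / 2" "J.D > 0" "J.D \<le> a + 1"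
    using \<beta>_pos a0 by (auto simp: J.D_def)
  have m2: "(real m)\<^sup>2 \<le> K * a" using m_square_le[of 1] small a1' by (simp add: K_def)
  have m1: "1 \<le> real m" using m_pos by simp
  have "real m * 1 \<le> real m * real m" using m1 by (intro mult_left_mono) auto
  then have mK: "real m \<le> K * a" using m2 by (simp add: power2_eq_square)
  have \<delta>: "b = a2 - J.\<delta>" "1 \<le> J.\<delta>" "J.\<delta> \<le> (1 + \<beta>) * real m"
    using J.\<delta>_bounds(1) \<delta>_le by (simp_all add: J.\<delta>_def)
  have \<epsilon>: "0 \<le> \<epsilon>" using a12_pos by (simp add: \<epsilon>_def)
  have mp: "real m * J.p = \<epsilon> * (a2 / a)" using a12_pos a0 by (simp add: \<epsilon>_def J.p_def)
  have L: "- ln (a2 / a) \<le> a1 / a2"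
  proof -
    have "- ln (a2 / a) = ln (a / a2)" using a0 a12_pos by (simp add: ln_divide_pos)
    also have "\<dots> \<le> a / a2 - 1" using a0 a12_pos by (intro ln_le_minus_one) auto
    also have "\<dots> = a1 / a2" using a12_pos by (simp add: a_eq field_simps)
    finally show ?thesis .
  qed
  have 1: "ln ratio_const + real m * b * ln (a2 / a) + real m * a1 \<le> \<epsilon> / 2 * (1 + J.\<delta>)"
  proof -
    have "ln ratio_const + real m * b * ln (a2 / a) + real m * a1 \<le>
       real m * b * ln (a2 / a) - (real m * a2 - \<beta> * real m * (real m - 1) / 4) * ln (a2 / a)"
      using ln_ratio_const by linarith
    \<comment> \<open>With \<beta>/2 (m - 1) = \<delta> - 1 and b = a2 - \<delta> the terms m a2
      cancel and the coefficient of ln (a2 / a) collapses to - m (1 + \<delta>) / 2.\<close>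
    also have "\<dots> = real m * (1 + J.\<delta>) / 2 * (- ln (a2 / a))"
      unfolding J.\<delta>_def by (simp add: field_simps)
    also have "\<dots> \<le> real m * (1 + J.\<delta>) / 2 * (a1 / a2)" using L \<delta> by (intro mult_left_mono) auto
    also have "\<dots> = \<epsilon> / 2 * (1 + J.\<delta>)" by (simp add: \<epsilon>_def ac_simps)
    finally show ?thesis .
  qed
  have Dy: "real m * J.p * (J.\<delta> - e) \<le> J.D * y"
  proof -
    have "\<beta> / 2 * (\<integral>x. (J.S 1 x)\<^sup>2 \<partial>PJ) \<le> \<beta> / 2 * ((real m * a1 + 1) * (real m * J.p) / a)"
      using J.mean_S1_square_le a0 \<beta>_pos by (intro mult_left_mono) (auto simp: pos_le_divide_eq mult.commute)
    then have "real m * J.p * (J.\<delta> - J.p * (1 - \<beta> / 2)) - \<beta> / 2 * ((real m * a1 + 1) * (real m * J.p) / a) \<le> J.D * y"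
      unfolding y_def J.mean_Y_eq by linarith
    moreover have "real m * J.p * (J.\<delta> - J.p * (1 - \<beta> / 2)) - \<beta> / 2 * ((real m * a1 + 1) * (real m * J.p) / a) =
      real m * J.p * (J.\<delta> - e)" unfolding e_def using a0 by (simp add: field_simps)
    ultimately show ?thesis by simp
  qed
  have 2: "\<epsilon> * (q * (J.\<delta> - e)) \<le> b * y"
  proof -
    have "b / J.D * (real m * J.p * (J.\<delta> - e)) \<le> b / J.D * (J.D * y)" using Dy b0 D by (intro mult_left_mono) auto
    moreover have "b / J.D * (J.D * y) = b * y" using D by simp
    moreover have "b / J.D * (real m * J.p * (J.\<delta> - e)) = \<epsilon> * (q * (J.\<delta> - e))"
      unfolding mp q_def using D a0 by (simp add: field_simps)
    ultimately show ?thesis by simp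
  qed
  have aD: "a * J.D > 0" using a0 D by simp
  \<comment> \<open>Here 1 - q is O((a1 + 1 + \<delta>) / a). Multiplication by \<delta> = O(m)
    gives m a1 / a, m / a and m^2 / a, all bounded in this regime.\<close>
  have 3: "J.\<delta> * (1 - q) \<le> 2 * (1 + \<beta>) * (2 + K + (1 + \<beta>) * K)"
  proof -
    have "a * J.D - a2 * b \<le> a * (2 * a1 + 1 + J.\<delta>)"
    proof -
      have "a * J.D \<le> a * (a + 1)" using D a0 by (intro mult_left_mono) auto
      moreover have "a2 * b = a2 * a2 - a2 * J.\<delta>" unfolding \<delta>(1) by (simp add: algebra_simps)
      moreover have "a2 * J.\<delta> \<le> a * J.\<delta>" using a12_pos \<delta> by (intro mult_right_mono) (auto simp: a_eq)
      moreover have "a * a - a2 * a2 \<le> 2 * a * a1" using a12_pos by (simp add: a_eq algebra_simps)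
      ultimately show ?thesis by (simp add: algebra_simps)
    qed
    then have "(a * J.D - a2 * b) / (a * J.D) \<le> a * (2 * a1 + 1 + J.\<delta>) / (a * J.D)" using aD by (intro divide_right_mono) auto
    also have "(a * J.D - a2 * b) / (a * J.D) = 1 - q" using a0 D unfolding q_def diff_divide_distrib by simp
    also have "a * (2 * a1 + 1 + J.\<delta>) / (a * J.D) = (2 * a1 + 1 + J.\<delta>) / J.D" using a0 by simp
    also have "\<dots> \<le> (2 * a1 + 1 + J.\<delta>) / (a / 2)" using D a0 a12_pos \<delta> by (intro divide_left_mono) auto
    finally have "J.\<delta> * (1 - q) \<le> J.\<delta> * ((2 * a1 + 1 + J.\<delta>) / (a / 2))" using \<delta> by (intro mult_left_mono) auto
    also have "\<dots> \<le> ((1 + \<beta>) * real m) * ((2 * a1 + 1 + (1 + \<beta>) * real m) / (a / 2))"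
      using \<delta> a0 a12_pos \<beta>_pos by (intro mult_mono divide_right_mono) auto
    also have "\<dots> = 2 * (1 + \<beta>) * ((2 * (real m * a1) + real m + (1 + \<beta>) * (real m)\<^sup>2) / a)"
      using a0 by (simp add: field_simps power2_eq_square)
    also have "\<dots> \<le> 2 * (1 + \<beta>) * ((2 * a + K * a + (1 + \<beta>) * (K * a)) / a)"
      using a0 a12_pos \<beta>_pos small mK m2 by (intro mult_left_mono divide_right_mono add_mono) (auto simp: a_eq)
    also have "\<dots> = 2 * (1 + \<beta>) * (2 + K + (1 + \<beta>) * K)" using a0 by (simp add: field_simps)
    finally show ?thesis .
  qed
  have 4: "q * e \<le> 2 * (1 + \<beta>)"
  proof -
    have q: "0 \<le> q" "q \<le> 2"
    proof -
      show "0 \<le> q" unfolding q_def using b0 a12_pos a0 D by simp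
      have "a2 * b \<le> a * a" using b0 \<delta> a12_pos by (intro mult_mono) (auto simp: a_eq)
      also have "a * a \<le> 2 * (a * J.D)" using D a0 mult_left_mono[OF D(1), of a] by simp
      finally show "q \<le> 2" unfolding q_def using aD by (simp add: pos_divide_le_eq)
    qed
    have "\<beta> * (real m * a1 + 1) / (2 * a) \<le> \<beta> * (a + a) / (2 * a)"
      using small a1' a12_pos \<beta>_pos a0 by (intro divide_right_mono mult_left_mono add_mono) (auto simp: a_eq)
    also have "\<dots> = \<beta>" using a0 by simp
    moreover have "J.p * (1 - \<beta> / 2) \<le> 1 * 1"
    proof -
      have "J.p * (1 - \<beta> / 2) \<le> J.p * 1" using J.p_bounds \<beta>_pos by (intro mult_left_mono) auto
      then show ?thesis using J.p_bounds by linarith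
    qed
    ultimately have "e \<le> 1 + \<beta>" unfolding e_def by simp
    then have "q * e \<le> q * (1 + \<beta>)" using q by (intro mult_left_mono)
    also have "\<dots> \<le> 2 * (1 + \<beta>)" using q \<beta>_pos by (intro mult_right_mono) auto
    finally show ?thesis .
  qed
  have "ln ratio_const + real m * b * ln (a2 / a) - b / 2 * y + real m * a1 \<le> \<epsilon> / 2 * (1 + J.\<delta>) - \<epsilon> * (q * (J.\<delta> - e)) / 2"
    using 1 2 by simp
  also have "\<dots> = \<epsilon> / 2 * (1 + J.\<delta> * (1 - q) + q * e)" by (simp add: field_simps)
  also have "\<dots> \<le> \<epsilon> / 2 * kl_const"
    using 3 4 \<epsilon> unfolding kl_const_def K_def[symmetric] by (intro mult_left_mono) auto
  finally show ?thesis unfolding y_def \<epsilon>_def by simp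
qed

text \<open>With z the bound on the divergence, \<eta> = sqrt z in the weak Pinsker inequality gives
  5/2 sqrt z, which \<open>tv_distance_le\<close> doubles. The second threshold on \<open>a2\<close>
  yields (1 + \<beta>) m \<le> a2 and thereby b \<ge> 0, so that the upper bound on ln (1 - x) can
  be multiplied by b.\<close>

lemma distances_le:
  assumes small: "real m * a1 \<le> a2" and a2: "a2 \<ge> 2 * (1 + \<beta>)" "a2 \<ge> 2 * (1 + 4 / \<beta>) * (1 + \<beta>)\<^sup>2"
    and d: "d \<in> {tv_distance, kl_distance}"
  shows "0 \<le> d PS PL" "d PS PL \<le> ereal (real m * a1 / a2 * (kl_const / 2) + 5 * sqrt (real m * a1 / a2 * (kl_const / 2)))"
proof -
  define z where "z = real m * a1 / a2 * (kl_const / 2)"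
  have z: "z > 0" unfolding z_def using a12_pos m_pos kl_const_pos by simp
  have a: "a \<ge> 2 * (1 + \<beta>)" using a2 a12_pos by (simp add: a_eq)
  have "2 + 2 * \<beta> \<le> a" using a by (simp add: algebra_simps)
  then have a1': "a \<ge> 1" using \<beta>_pos by linarith
  have b0: "b \<ge> 0"
  proof -
    have "1 * a1 \<le> real m * a1" using m_pos a12_pos by (intro mult_right_mono) auto
    then have "a \<le> 2 * a2" using small by (simp add: a_eq)
    then have "(1 + 4 / \<beta>) * a \<le> (1 + 4 / \<beta>) * (2 * a2)" using \<beta>_pos by (intro mult_left_mono) auto
    then have "(real m)\<^sup>2 \<le> (1 + 4 / \<beta>) * (2 * a2)" using m_square_le[of 1] small a1' by simp
    then have "(1 + \<beta>)\<^sup>2 * (real m)\<^sup>2 \<le> (1 + \<beta>)\<^sup>2 * ((1 + 4 / \<beta>) * (2 * a2))" by (intro mult_left_mono) auto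
    also have "\<dots> = 2 * (1 + 4 / \<beta>) * (1 + \<beta>)\<^sup>2 * a2" by (simp only: ac_simps)
    also have "\<dots> \<le> a2 * a2" using a2 a12_pos by (intro mult_right_mono) auto
    finally have "((1 + \<beta>) * real m)\<^sup>2 \<le> a2\<^sup>2"
      unfolding power_mult_distrib power2_eq_square[of a2] .
    then have "(1 + \<beta>) * real m \<le> a2"
      by (rule power2_le_imp_le[OF _ less_imp_le[OF a12_pos(2)]])
    moreover have "J.\<delta> \<le> (1 + \<beta>) * real m" by (rule \<delta>_le)
    ultimately show ?thesis by (simp add: J.\<delta>_def)
  qed
  obtain k where k: "kl_distance PS PL = ereal k" "0 \<le> k"
      "k \<le> ln ratio_const + real m * b * ln (a2 / a) - b / 2 * (\<integral>x. J.Y x \<partial>PJ) + real m * a1"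
      "\<And>\<eta>. \<eta> > 0 \<Longrightarrow> LR.l1_distance \<le> k / (2 * \<eta>) + 2 * \<eta>"
    using kl_upper[OF b0] by blast
  have kz: "k \<le> z" using k(3) kl_bracket[OF small a b0] unfolding z_def by linarith
  have "LR.l1_distance \<le> k / (2 * sqrt z) + 2 * sqrt z" using z by (intro k(4)) auto
  also have "k / (2 * sqrt z) \<le> z / (2 * sqrt z)" using kz z by (intro divide_right_mono) auto
  also have "z / (2 * sqrt z) = sqrt z / 2" using z by (simp add: real_div_sqrt)
  finally have l: "2 * LR.l1_distance \<le> 5 * sqrt z" by simp
  have tv: "0 \<le> tv_distance PS PL"
    using LR.tv_distance_ge LR.l1_distance_nonneg by (meson ereal_less_eq(5) order_trans)
  have tv': "tv_distance PS PL \<le> ereal (5 * sqrt z)"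
    using LR.tv_distance_le l by (meson ereal_less_eq(3) order_trans)
  show "0 \<le> d PS PL" using d tv k by auto
  have "d PS PL \<le> ereal (max (5 * sqrt z) z)" using d tv' k kz by (auto simp: le_max_iff_disj intro: order_trans)
  also have "\<dots> \<le> ereal (z + 5 * sqrt z)" using z by simp
  finally show "d PS PL \<le> ereal (real m * a1 / a2 * (kl_const / 2) + 5 * sqrt (real m * a1 / a2 * (kl_const / 2)))"
    unfolding z_def .
qed

text \<open>The value of \<open>CQ + CP + c1\<^sup>2\<close> in \<open>l1_distance_ge\<close>: the
  Laguerre variance, the second moment under the rescaled Jacobi law, and the squared upper bound
  for the gap of the means. It involves \<beta> and K only.\<close>

definition l1_const :: "real \<Rightarrow> real" where
  "l1_const K = (K * (16 * (1 + \<beta>)\<^sup>2 * K + 8 * (1 + \<beta>) * (1 + (1 + \<beta>) * K)) + 8 * \<beta> * K\<^sup>2) / 4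
     + (8 * J.C_B K + 6 * \<beta>\<^sup>2 * K\<^sup>2) + (2 * (K\<^sup>2 * (1 + \<beta>)\<^sup>2 + K + \<beta> / 2 * ((K + 1) * K)))\<^sup>2"

lemma l1_const_pos:
  assumes K1: "K \<ge> 1" and a: "a \<ge> 2 * (1 + \<beta>)" and mp_le: "real m * J.p \<le> K" and m_le: "(real m)\<^sup>2 \<le> K * a"
  shows "l1_const K > 0"
proof -
  obtain k where k: "(\<integral>x. (a * J.Y x - k)\<^sup>2 \<partial>PJ) \<le> 8 * J.C_B K + 6 * \<beta>\<^sup>2 * K\<^sup>2"
    using J.second_moment_Y_bound[OF K1 a mp_le m_le] by blast
  have "0 \<le> (\<integral>x. (a * J.Y x - k)\<^sup>2 \<partial>PJ)" by simp
  then have "0 \<le> 8 * J.C_B K + 6 * \<beta>\<^sup>2 * K\<^sup>2" using k by linarith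
  moreover have "0 \<le> (K * (16 * (1 + \<beta>)\<^sup>2 * K + 8 * (1 + \<beta>) * (1 + (1 + \<beta>) * K)) + 8 * \<beta> * K\<^sup>2) / 4"
    using K1 \<beta>_pos by simp
  moreover have "0 < 2 * (K\<^sup>2 * (1 + \<beta>)\<^sup>2 + K + \<beta> / 2 * ((K + 1) * K))"
    using K1 \<beta>_pos by (intro mult_pos_pos add_nonneg_pos add_pos_nonneg) auto
  then have "0 < (2 * (K\<^sup>2 * (1 + \<beta>)\<^sup>2 + K + \<beta> / 2 * ((K + 1) * K)))\<^sup>2" by simp
  ultimately show ?thesis unfolding l1_const_def by linarith
qed

text \<open>The mean of U is m p \<delta> under the Laguerre law and a E Y under the rescaled Jacobi
  law. D times their difference is m p \<delta> (1 - \<beta>/2) + a X. The first term may be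
  negative but is O(m), and \<open>large\<close> makes it at most half of the lower bound min 1
  (\<beta>/2) \<kappa>^2 a for the second.\<close>

lemma l1_distance_lower:
  assumes K1: "K \<ge> 1" and a: "a \<ge> 2 * (1 + \<beta>)" and mp_le: "real m * J.p \<le> K" and m_le: "(real m)\<^sup>2 \<le> K * a"
    and \<kappa>: "0 < \<kappa>" "\<kappa> \<le> real m * J.p" and large: "2 * (K * (1 + \<beta>)\<^sup>2) * real m \<le> min 1 (\<beta> / 2) * \<kappa>\<^sup>2 * a"
  shows "(min 1 (\<beta> / 2) * \<kappa>\<^sup>2 / 4)\<^sup>2 / l1_const K \<le> LR.l1_distance"
proof -
  let ?U = "\<lambda>y. Lg.W y / (4 * a)"
  let ?c = "min 1 (\<beta> / 2)"
  define y where "y = (\<integral>x. J.Y x \<partial>PJ)"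
  define v where "v = (\<integral>x. (J.S 1 x)\<^sup>2 \<partial>PJ)"
  define X where "X = real m * J.p * J.p * (1 - \<beta> / 2) + \<beta> / 2 * v"
  define \<Delta> where "\<Delta> = real m * J.p * J.\<delta> - a * y"
  have a0: "a > 0" by (rule a_pos)
  have D: "a / 2 \<le> J.D" "J.D \<le> 2 * a" "0 < J.D" using J.D_bounds[OF K1 a mp_le m_le] by auto
  have a1': "a \<ge> 1" by (rule J.a_ge_1[OF K1 a mp_le m_le])
  have m1: "1 \<le> real m" using m_pos by simp
  have Ma: "Lg.M = a * (real m * J.p)" unfolding Lg.M_def J.a_mp ..
  have \<delta>_eq: "Lg.\<delta> = J.\<delta>" by (simp add: Lg.\<delta>_def J.\<delta>_def)
  have U_dilate: "?U (dilate x) = a * J.Y x" for x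
  proof -
    have "Lg.W (dilate x) = (\<Sum>i=1..m. 4 * a\<^sup>2 * (x i - J.p)\<^sup>2)"
      unfolding Lg.W_eq
    proof (rule sum.cong[OF refl])
      fix i assume "i \<in> {1..m}"
      then have "dilate x i - 2 * a1 = 2 * a * (x i - J.p)"
        using J.a_p by (simp add: scale_vec_def right_diff_distrib)
      then show "(dilate x i - 2 * a1)\<^sup>2 = 4 * a\<^sup>2 * (x i - J.p)\<^sup>2" by (simp only: power_mult_distrib) simp
    qed
    then show ?thesis unfolding J.Y_eq using a0 by (simp add: sum_distrib_left[symmetric] power2_eq_square)
  qed
  have Um: "?U \<in> borel_measurable (lborel_vec m)" by measurable
  have U2m: "(\<lambda>y. (?U y - k)\<^sup>2) \<in> borel_measurable (lborel_vec m)" "(\<lambda>y. (?U y)\<^sup>2) \<in> borel_measurable (lborel_vec m)" for k by measurable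
  have meanQ: "(\<integral>y. ?U y \<partial>PL) = real m * J.p * J.\<delta>"
    using Lg.mean_W a0 unfolding Ma \<delta>_eq by simp
  have meanP: "(\<integral>y. ?U y \<partial>PS) = a * y"
    unfolding integral_PS[OF Um] U_dilate y_def by simp
  have mpp: "0 < real m * J.p" using \<kappa> by linarith
  have M_le: "Lg.M \<le> K * a" unfolding Ma using mp_le a0 by (simp add: mult.commute)
  have vQ: "(\<integral>y. (?U y - (\<integral>y. ?U y \<partial>PL))\<^sup>2 \<partial>PL) \<le> (K * (16 * (1 + \<beta>)\<^sup>2 * K + 8 * (1 + \<beta>) * (1 + (1 + \<beta>) * K)) + 8 * \<beta> * K\<^sup>2) / 4"
  proof -
    have "(?U y - (\<integral>y. ?U y \<partial>PL))\<^sup>2 = (Lg.W y - 4 * Lg.M * Lg.\<delta>)\<^sup>2 / (16 * a\<^sup>2)" for y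
    proof -
      have "?U y - (\<integral>y. ?U y \<partial>PL) = (Lg.W y - 4 * Lg.M * Lg.\<delta>) / (4 * a)"
        unfolding meanQ Ma \<delta>_eq diff_divide_distrib using a0 by simp
      then show ?thesis by (simp only: power_divide power_mult_distrib) simp
    qed
    then have "(\<integral>y. (?U y - (\<integral>y. ?U y \<partial>PL))\<^sup>2 \<partial>PL) = (\<integral>y. (Lg.W y - 4 * Lg.M * Lg.\<delta>)\<^sup>2 \<partial>PL) / (16 * a\<^sup>2)" by (simp only: integral_divide_zero)
    also have "\<dots> \<le> (4 * (K * (16 * (1 + \<beta>)\<^sup>2 * K + 8 * (1 + \<beta>) * (1 + (1 + \<beta>) * K)) + 8 * \<beta> * K\<^sup>2) * a\<^sup>2) / (16 * a\<^sup>2)"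
      using Lg.variance_W_le[OF K1 a1' _ M_le m_le] a12_pos by (intro divide_right_mono) (auto simp: a_eq)
    also have "\<dots> = (K * (16 * (1 + \<beta>)\<^sup>2 * K + 8 * (1 + \<beta>) * (1 + (1 + \<beta>) * K)) + 8 * \<beta> * K\<^sup>2) / 4"
      using a0 by simp
    finally show ?thesis .
  qed
  obtain k where k: "(\<integral>x. (a * J.Y x - k)\<^sup>2 \<partial>PJ) \<le> 8 * J.C_B K + 6 * \<beta>\<^sup>2 * K\<^sup>2"
    using J.second_moment_Y_bound[OF K1 a mp_le m_le] by blast
  have vP: "(\<integral>y. (?U y - k)\<^sup>2 \<partial>PS) \<le> 8 * J.C_B K + 6 * \<beta>\<^sup>2 * K\<^sup>2"
    unfolding integral_PS[OF U2m(1)] U_dilate by (rule k)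
  have Dy: "J.D * y = real m * J.p * J.\<delta> - X"
    unfolding y_def J.mean_Y_eq X_def v_def by (simp add: algebra_simps)
  have \<Delta>D: "\<Delta> * J.D = real m * J.p * J.\<delta> * (1 - \<beta> / 2) + a * X"
  proof -
    have "\<Delta> * J.D = real m * J.p * J.\<delta> * J.D - a * (J.D * y)" by (simp add: \<Delta>_def algebra_simps)
    moreover have "real m * J.p * J.\<delta> * J.D = real m * J.p * J.\<delta> * a + real m * J.p * J.\<delta> * (1 - \<beta> / 2)"
      by (simp add: J.D_def algebra_simps)
    ultimately show ?thesis unfolding Dy by (simp add: algebra_simps)
  qed
  have err: "\<bar>real m * J.p * J.\<delta> * (1 - \<beta> / 2)\<bar> \<le> K * (1 + \<beta>)\<^sup>2 * real m"
  proof -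
    have "J.\<delta> \<le> (1 + \<beta>) * real m" by (rule \<delta>_le)
    then have "\<bar>real m * J.p * J.\<delta> * (1 - \<beta> / 2)\<bar> \<le> K * ((1 + \<beta>) * real m) * (1 + \<beta>)"
      unfolding abs_mult[of "real m * J.p * J.\<delta>"]
      using mp_le mpp J.\<delta>_bounds \<beta>_pos K1 by (intro mult_mono) (auto simp: abs_mult intro!: mult_mono)
    then show ?thesis by (simp add: power2_eq_square algebra_simps)
  qed
  \<comment> \<open>Jensen's inequality E ((S 1)^2) \<ge> (m p)^2 gives X \<ge> m p^2 \<delta>, and
    \<delta> \<ge> min 1 (\<beta>/2) m turns this into a multiple of (m p)^2, whether m is bounded
    or not.\<close>
  have X_ge: "?c * \<kappa>\<^sup>2 \<le> X"
  proof -
    have "\<beta> / 2 * (real m * J.p)\<^sup>2 \<le> \<beta> / 2 * v" unfolding v_def using J.mean_S1_square_ge \<beta>_pos by (intro mult_left_mono) auto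
    then have "real m * J.p * J.p * (1 - \<beta> / 2) + \<beta> / 2 * (real m * J.p)\<^sup>2 \<le> X" by (simp add: X_def)
    moreover have "real m * J.p * J.p * (1 - \<beta> / 2) + \<beta> / 2 * (real m * J.p)\<^sup>2 = real m * J.p * J.p * J.\<delta>"
      by (simp add: J.\<delta>_def power2_eq_square field_simps)
    moreover have "?c * real m \<le> J.\<delta>"
    proof -
      have "?c * (real m - 1) \<le> \<beta> / 2 * (real m - 1)" using m1 by (intro mult_right_mono) auto
      then show ?thesis unfolding J.\<delta>_def right_diff_distrib by linarith
    qed
    then have "real m * J.p * J.p * (?c * real m) \<le> real m * J.p * J.p * J.\<delta>"
      using J.p_bounds by (intro mult_left_mono) auto
    moreover have "?c * \<kappa>\<^sup>2 \<le> ?c * (real m * J.p)\<^sup>2" using \<kappa> \<beta>_pos by (intro mult_left_mono power_mono) auto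
    ultimately show ?thesis by (simp add: power2_eq_square algebra_simps)
  qed
  have c0: "0 < ?c * \<kappa>\<^sup>2 / 4" using \<kappa> \<beta>_pos by simp
  have low: "?c * \<kappa>\<^sup>2 / 4 \<le> \<Delta>"
  proof -
    have "a * (?c * \<kappa>\<^sup>2) \<le> a * X" using X_ge a0 by (intro mult_left_mono) auto
    then have "?c * \<kappa>\<^sup>2 / 2 * a \<le> \<Delta> * J.D"
      unfolding \<Delta>D using err large by (simp add: abs_le_iff mult.commute)
    moreover have "?c * \<kappa>\<^sup>2 / 4 * J.D \<le> ?c * \<kappa>\<^sup>2 / 4 * (2 * a)" using D c0 by (intro mult_left_mono) auto
    ultimately have "?c * \<kappa>\<^sup>2 / 4 * J.D \<le> \<Delta> * J.D" by (simp add: ac_simps)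
    then show ?thesis using D(3) by (simp only: mult_le_cancel_right_pos)
  qed
  have up: "\<Delta> \<le> 2 * (K\<^sup>2 * (1 + \<beta>)\<^sup>2 + K + \<beta> / 2 * ((K + 1) * K))"
  proof -
    have "real m * J.p * J.p * (1 - \<beta> / 2) \<le> K * 1 * 1"
    proof -
      have "real m * J.p * J.p * (1 - \<beta> / 2) \<le> real m * J.p * J.p * 1" using J.p_bounds \<beta>_pos by (intro mult_left_mono) auto
      also have "\<dots> \<le> K * 1 * 1" using J.p_bounds mp_le K1 by (intro mult_mono) auto
      finally show ?thesis .
    qed
    moreover have "\<beta> / 2 * v \<le> \<beta> / 2 * ((K + 1) * K)"
      unfolding v_def using J.mean_S1_square_bound[OF K1 a mp_le m_le] \<beta>_pos by (intro mult_left_mono) auto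
    ultimately have "a * X \<le> a * (K + \<beta> / 2 * ((K + 1) * K))" using a0 unfolding X_def by (intro mult_left_mono) auto
    moreover have "K * (1 + \<beta>)\<^sup>2 * real m \<le> K * (1 + \<beta>)\<^sup>2 * (K * a)"
      using J.m_le_K_a[OF K1 a mp_le m_le] K1 by (intro mult_left_mono) auto
    ultimately have "\<Delta> * J.D \<le> (K\<^sup>2 * (1 + \<beta>)\<^sup>2 + K + \<beta> / 2 * ((K + 1) * K)) * a"
      unfolding \<Delta>D using err by (simp add: abs_le_iff power2_eq_square algebra_simps)
    moreover have "\<Delta> * (a / 2) \<le> \<Delta> * J.D" using D low c0 by (intro mult_left_mono) auto
    moreover have "\<Delta> * a \<le> 2 * z * a" if "x \<le> z * a" "\<Delta> * (a / 2) \<le> x" for x z :: real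
      using that by simp
    ultimately have "\<Delta> * a \<le> (2 * (K\<^sup>2 * (1 + \<beta>)\<^sup>2 + K + \<beta> / 2 * ((K + 1) * K))) * a" by blast
    then show ?thesis using a0 by (simp only: mult_le_cancel_right_pos)
  qed
  have iP: "integrable PS ?U" "integrable PS (\<lambda>y. (?U y)\<^sup>2)"
  proof -
    show "integrable PS ?U" unfolding integrable_PS[OF Um] U_dilate by simp
    have "integrable PJ (\<lambda>x. (a * J.Y x)\<^sup>2)"
      by (intro J.integrable_subexp J.subexp_intros J.Y_subexp) measurable
    then show "integrable PS (\<lambda>y. (?U y)\<^sup>2)" unfolding integrable_PS[OF U2m(2)] U_dilate .
  qed
  have iQ: "integrable PL ?U" "integrable PL (\<lambda>y. (?U y)\<^sup>2)"
  proof -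
    have s: "Lg.subexp ?U" unfolding divide_inverse by (intro Lg.subexp_intros Lg.W_subexp)
    show "integrable PL ?U" by (intro Lg.integrable_subexp s Um)
    show "integrable PL (\<lambda>y. (?U y)\<^sup>2)" by (intro Lg.integrable_subexp Lg.subexp_power s U2m)
  qed
  show ?thesis
  proof (rule LR.l1_distance_ge[OF _ iQ iP vQ vP c0])
    show "?U \<in> borel_measurable PL" using Um by (simp cong: measurable_cong_sets)
    show "?c * \<kappa>\<^sup>2 / 4 \<le> (\<integral>y. ?U y \<partial>PL) - (\<integral>y. ?U y \<partial>PS)" unfolding meanQ meanP \<Delta>_def[symmetric] by (rule low)
    show "(\<integral>y. ?U y \<partial>PL) - (\<integral>y. ?U y \<partial>PS) \<le> 2 * (K\<^sup>2 * (1 + \<beta>)\<^sup>2 + K + \<beta> / 2 * ((K + 1) * K))"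
      unfolding meanQ meanP \<Delta>_def[symmetric] by (rule up)
  qed (simp add: l1_const_def)
qed

text \<open>For the divergence, \<eta> = l / 4 maximises 2 \<eta> (l - 2 \<eta>), with value l^2 /
  4.\<close>

lemma distance_ge:
  assumes "d \<in> {tv_distance, kl_distance}" "0 < l" "l \<le> LR.l1_distance"
  shows "ereal (min l (l\<^sup>2 / 4)) \<le> d PS PL"
proof -
  have "ereal l \<le> tv_distance PS PL"
    using LR.tv_distance_ge assms(3) by (meson ereal_less_eq(3) order_trans)
  moreover have "ereal (l\<^sup>2 / 4) \<le> kl_distance PS PL"
  proof -
    have "l\<^sup>2 / 4 = 2 * (l / 4) * (l - 2 * (l / 4))" by (simp add: power2_eq_square)
    also have "\<dots> \<le> 2 * (l / 4) * (LR.l1_distance - 2 * (l / 4))" using assms by (intro mult_left_mono) auto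
    finally show ?thesis using LR.kl_distance_ge[of "l / 4"] assms by (meson ereal_less_eq(3) order_trans zero_less_divide_iff zero_less_numeral)
  qed
  ultimately have "ereal (min l (l\<^sup>2 / 4)) \<le> tv_distance PS PL" "ereal (min l (l\<^sup>2 / 4)) \<le> kl_distance PS PL"
    by (auto intro: order_trans[rotated] simp flip: ereal_min)
  then show ?thesis using assms(1) by auto
qed

end

section \<open>From random vectors to laws, and the limit statements\<close>

lemma jacobi_ensembleD:
  assumes "jacobi_ensemble \<beta> m a1 a2 M X"
  shows "prob_space (density (lborel_vec m) (\<lambda>x. ennreal (jacobi_density \<beta> m a1 a2 x)))"
    "law m M (\<lambda>\<omega>. scale_vec m s (X \<omega>)) =
       distr (density (lborel_vec m) (\<lambda>x. ennreal (jacobi_density \<beta> m a1 a2 x))) (lborel_vec m) (scale_vec m s)"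
proof -
  have M: "prob_space M" and X: "distributed M (lborel_vec m) X (\<lambda>x. ennreal (jacobi_density \<beta> m a1 a2 x))"
    using assms by (auto simp: jacobi_ensemble_def)
  have [measurable]: "X \<in> measurable M (lborel_vec m)" using X by (rule distributed_measurable)
  have [measurable]: "scale_vec m s \<in> measurable (lborel_vec m) (lborel_vec m)"
    unfolding scale_vec_def by measurable
  note eq = distributed_distr_eq_density[OF X]
  show "prob_space (density (lborel_vec m) (\<lambda>x. ennreal (jacobi_density \<beta> m a1 a2 x)))"
    unfolding eq[symmetric] by (rule prob_space.prob_space_distr[OF M]) measurable
  show "law m M (\<lambda>\<omega>. scale_vec m s (X \<omega>)) =
       distr (density (lborel_vec m) (\<lambda>x. ennreal (jacobi_density \<beta> m a1 a2 x))) (lborel_vec m) (scale_vec m s)"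
    unfolding eq[symmetric] law_def by (subst distr_distr) (auto simp: comp_def)
qed

lemma laguerre_ensembleD:
  assumes "laguerre_ensemble \<beta> m a1 M X"
  shows "prob_space (density (lborel_vec m) (\<lambda>x. ennreal (laguerre_density \<beta> m a1 x)))"
    "law m M X = density (lborel_vec m) (\<lambda>x. ennreal (laguerre_density \<beta> m a1 x))"
proof -
  have M: "prob_space M" and X: "distributed M (lborel_vec m) X (\<lambda>x. ennreal (laguerre_density \<beta> m a1 x))"
    using assms by (auto simp: laguerre_ensemble_def)
  have [measurable]: "X \<in> measurable M (lborel_vec m)" using X by (rule distributed_measurable)
  note eq = distributed_distr_eq_density[OF X]
  show "prob_space (density (lborel_vec m) (\<lambda>x. ennreal (laguerre_density \<beta> m a1 x)))"
    unfolding eq[symmetric] by (rule prob_space.prob_space_distr[OF M]) measurable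
  show "law m M X = density (lborel_vec m) (\<lambda>x. ennreal (laguerre_density \<beta> m a1 x))"
    unfolding law_def by (rule eq)
qed

lemma ensemble_pair_laws:
  assumes "\<beta> > 0" "m \<ge> 1" "a1 > \<beta> / 2 * (real m - 1)" "a2 > \<beta> / 2 * (real m - 1)"
    and J: "jacobi_ensemble \<beta> m a1 a2 M X" and L: "laguerre_ensemble \<beta> m a1 N Z"
  shows "ensemble_pair \<beta> m a1 a2"
    "law m M (\<lambda>\<omega>. scale_vec m (2 * (a1 + a2)) (X \<omega>)) = ensemble_pair.PS \<beta> m a1 a2"
    "law m N Z = density (lborel_vec m) (\<lambda>x. ennreal (laguerre_density \<beta> m a1 x))"
proof -
  show E: "ensemble_pair \<beta> m a1 a2"
    by (rule ensemble_pair.intro[OF assms(1-4) jacobi_ensembleD(1)[OF J] laguerre_ensembleD(1)[OF L]])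
  show "law m M (\<lambda>\<omega>. scale_vec m (2 * (a1 + a2)) (X \<omega>)) = ensemble_pair.PS \<beta> m a1 a2"
    unfolding jacobi_ensembleD(2)[OF J] ensemble_pair.PS_def[OF E] ensemble_pair.a_eq[OF E] ..
  show "law m N Z = density (lborel_vec m) (\<lambda>x. ennreal (laguerre_density \<beta> m a1 x))"
    by (rule laguerre_ensembleD(2)[OF L])
qed

theorem theorem1:
  fixes \<beta> :: real and m :: "real \<Rightarrow> nat" and a1 :: "real \<Rightarrow> real"
    and M :: "real \<Rightarrow> 'p measure" and lam :: "real \<Rightarrow> 'p \<Rightarrow> nat \<Rightarrow> real"
    and N :: "real \<Rightarrow> 'q measure" and \<mu> :: "real \<Rightarrow> 'q \<Rightarrow> nat \<Rightarrow> real"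
    and d :: "(nat \<Rightarrow> real) measure \<Rightarrow> (nat \<Rightarrow> real) measure \<Rightarrow> ereal"
  assumes "\<beta> > 0"
    and "\<forall>\<^sub>F a2 in at_top. m a2 \<ge> 1
           \<and> a1 a2 > \<beta> / 2 * (real (m a2) - 1) \<and> a2 > \<beta> / 2 * (real (m a2) - 1)"
    and "\<forall>\<^sub>F a2 in at_top. jacobi_ensemble \<beta> (m a2) (a1 a2) a2 (M a2) (lam a2)"
    and "\<forall>\<^sub>F a2 in at_top. laguerre_ensemble \<beta> (m a2) (a1 a2) (N a2) (\<mu> a2)"
    and "d \<in> {tv_distance, kl_distance}"
  shows "let a = (\<lambda>a2. a1 a2 + a2);
             D = (\<lambda>a2. d (law (m a2) (M a2) (\<lambda>\<omega>. scale_vec (m a2) (2 * a a2) (lam a2 \<omega>)))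
                         (law (m a2) (N a2) (\<mu> a2)))
         in ((\<lambda>a2. a1 a2 * real (m a2)) \<in> o[at_top](\<lambda>a2. a2) \<longrightarrow> (D \<longlongrightarrow> 0) at_top)
          \<and> (\<forall>\<sigma>>0. ((\<lambda>a2. a1 a2 * real (m a2) / a2) \<longlongrightarrow> \<sigma>) at_top \<longrightarrow> Liminf at_top D > 0)"
proof -
  define D where "D a2 = d (law (m a2) (M a2) (\<lambda>\<omega>. scale_vec (m a2) (2 * (a1 a2 + a2)) (lam a2 \<omega>)))
                         (law (m a2) (N a2) (\<mu> a2))" for a2
  define PL where "PL a2 = density (lborel_vec (m a2)) (\<lambda>x. ennreal (laguerre_density \<beta> (m a2) (a1 a2) x))" for a2
  have ev: "\<forall>\<^sub>F a2 in at_top. ensemble_pair \<beta> (m a2) (a1 a2) a2 \<and> D a2 = d (ensemble_pair.PS \<beta> (m a2) (a1 a2) a2) (PL a2)"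
    using assms(2-4)
  proof eventually_elim
    case (elim a2)
    then show ?case
      using ensemble_pair_laws[OF assms(1), of "m a2" "a1 a2" a2 "M a2" "lam a2" "N a2" "\<mu> a2"]
      by (simp add: D_def PL_def)
  qed
  have part1: "(D \<longlongrightarrow> 0) at_top" if o: "(\<lambda>a2. a1 a2 * real (m a2)) \<in> o[at_top](\<lambda>a2. a2)"
  proof -
    define C where "C = ensemble_pair.kl_const \<beta> / 2"
    define \<epsilon> where "\<epsilon> a2 = real (m a2) * a1 a2 / a2" for a2
    have \<epsilon>0: "(\<epsilon> \<longlongrightarrow> 0) at_top"
      using smalloD_tendsto[OF o] unfolding \<epsilon>_def by (simp add: mult.commute)
    have "((\<lambda>a2. \<epsilon> a2 * C + 5 * sqrt (\<epsilon> a2 * C)) \<longlongrightarrow> 0 * C + 5 * sqrt (0 * C)) at_top"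
      by (intro tendsto_intros \<epsilon>0)
    then have lim: "((\<lambda>a2. ereal (\<epsilon> a2 * C + 5 * sqrt (\<epsilon> a2 * C))) \<longlongrightarrow> 0) at_top"
      unfolding zero_ereal_def by (intro tendsto_ereal) simp
    have "\<forall>\<^sub>F a2 in at_top. \<epsilon> a2 < 1" using \<epsilon>0 by (rule order_tendstoD) simp
    then have "\<forall>\<^sub>F a2 in at_top. 0 \<le> D a2 \<and> D a2 \<le> ereal (\<epsilon> a2 * C + 5 * sqrt (\<epsilon> a2 * C))"
      using ev eventually_ge_at_top[of "2 * (1 + \<beta>)"] eventually_ge_at_top[of "2 * (1 + 4 / \<beta>) * (1 + \<beta>)\<^sup>2"]
    proof eventually_elim
      case (elim a2)
      interpret ensemble_pair \<beta> "m a2" "a1 a2" a2 using elim by simp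
      have "real (m a2) * a1 a2 \<le> a2" using elim(1) a12_pos by (simp add: \<epsilon>_def)
      from distances_le[OF this elim(3,4) assms(5)] show ?case
        using elim(2) unfolding PL_def C_def \<epsilon>_def by simp
    qed
    then show ?thesis
      by (intro tendsto_sandwich[OF _ _ tendsto_const lim]) (auto elim: eventually_mono)
  qed
  have part2: "Liminf at_top D > 0" if \<sigma>: "\<sigma> > 0" and lim: "((\<lambda>a2. a1 a2 * real (m a2) / a2) \<longlongrightarrow> \<sigma>) at_top" for \<sigma>
  proof -
    \<comment> \<open>Dominates both the bound 2 \<sigma> for m p and the constant 1 + 4 (2
      \<sigma>) / \<beta> of \<open>m_square_le\<close> for R = 2 \<sigma>.\<close>
    define K where "K = 1 + 2 * \<sigma> + 8 * \<sigma> / \<beta>"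
    \<comment> \<open>Lower bound for m p = m a1 / a: eventually m a1 \<ge> \<sigma>/2 a2, while m
      \<ge> 1 gives a \<le> (1 + 2 \<sigma>) a2.\<close>
    define \<kappa> where "\<kappa> = \<sigma> / 2 / (1 + 2 * \<sigma>)"
    define c where "c = min 1 (\<beta> / 2)"
    \<comment> \<open>Chosen so that m \<le> \<tau> a is the condition \<open>large\<close>; since
      m^2 \<le> K a, it holds once a \<ge> K / \<tau>^2.\<close>
    define \<tau> where "\<tau> = c * \<kappa>\<^sup>2 / (2 * (K * (1 + \<beta>)\<^sup>2))"
    \<comment> \<open>Fixed before any admissible parameters are at hand, so its positivity is
      proved inside the eventual statement, where \<open>l1_const_pos\<close> applies, and extracted
      from there at the end.\<close>
    define l where "l = min 1 ((c * \<kappa>\<^sup>2 / 4)\<^sup>2 / \<bar>ensemble_pair.l1_const \<beta> K\<bar>)"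
    have K1: "K \<ge> 1" unfolding K_def using \<sigma> assms(1) by simp
    have \<kappa>: "\<kappa> > 0" using \<sigma> by (simp add: \<kappa>_def)
    have c: "c > 0" using assms(1) by (simp add: c_def)
    have \<tau>: "\<tau> > 0" unfolding \<tau>_def using c \<kappa> K1 assms(1) by simp
    have bounds: "\<forall>\<^sub>F a2 in at_top. \<sigma> / 2 < a1 a2 * real (m a2) / a2 \<and> a1 a2 * real (m a2) / a2 < 2 * \<sigma>"
      using order_tendstoD[OF lim, of "\<sigma> / 2"] order_tendstoD[OF lim, of "2 * \<sigma>"] \<sigma>
      by (auto intro: eventually_conj)
    have *: "\<forall>\<^sub>F a2 in at_top. 0 < l \<and> ereal (min l (l\<^sup>2 / 4)) \<le> D a2"
      using bounds ev eventually_ge_at_top[of "2 * (1 + \<beta>)"] eventually_ge_at_top[of "K / \<tau>\<^sup>2"]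
    proof eventually_elim
      case (elim a2)
      interpret ensemble_pair \<beta> "m a2" "a1 a2" a2 using elim by simp
      let ?m = "real (m a2)"
      have a2: "a2 > 0" "a1 a2 > 0" by (rule a12_pos)+
      have R: "?m * a1 a2 \<le> 2 * \<sigma> * a2" "\<sigma> / 2 * a2 \<le> ?m * a1 a2"
        using elim(1) a2 by (simp_all add: field_simps)
      have a: "a \<ge> 2 * (1 + \<beta>)" "a \<ge> K / \<tau>\<^sup>2" using elim a2 by (simp_all add: a_eq)
      have a0: "a > 0" by (rule a_pos)
      have a1': "a \<ge> 1" using a \<beta>_pos by simp
      have mp: "?m * J.p = ?m * a1 a2 / a" by (simp add: J.p_def)
      have mp_le: "?m * J.p \<le> K"
      proof -
        have "2 * \<sigma> * a2 \<le> 2 * \<sigma> * a" using \<sigma> a2 by (intro mult_left_mono) (auto simp: a_eq)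
        then have "?m * a1 a2 \<le> 2 * \<sigma> * a" using R(1) by linarith
        then have "?m * J.p \<le> 2 * \<sigma>" unfolding mp using a0 by (simp add: pos_divide_le_eq)
        then show ?thesis unfolding K_def using \<sigma> \<beta>_pos by (simp add: add_increasing2)
      qed
      have m_le: "?m\<^sup>2 \<le> K * a"
      proof -
        have "?m\<^sup>2 \<le> (1 + 4 * (2 * \<sigma>) / \<beta>) * a" using R(1) \<sigma> a1' by (intro m_square_le) auto
        also have "\<dots> \<le> K * a" using \<sigma> a0 by (intro mult_right_mono) (auto simp: K_def)
        finally show ?thesis .
      qed
      have \<kappa>_le: "\<kappa> \<le> ?m * J.p"
      proof -
        have "1 * a1 a2 \<le> ?m * a1 a2" using m_pos a2 by (intro mult_right_mono) auto
        then have "a \<le> (1 + 2 * \<sigma>) * a2" using R(1) by (simp add: a_eq algebra_simps)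
        then have "\<kappa> * a \<le> \<kappa> * ((1 + 2 * \<sigma>) * a2)" using \<kappa> by (intro mult_left_mono) auto
        also have "\<kappa> * ((1 + 2 * \<sigma>) * a2) = \<sigma> / 2 * a2"
        proof -
          have n: "1 + 2 * \<sigma> \<noteq> 0" using \<sigma> by simp
          have "\<kappa> * (1 + 2 * \<sigma>) = \<sigma> / 2"
            unfolding \<kappa>_def by (rule nonzero_eq_divide_eq[THEN iffD1, OF n refl])
          then show ?thesis by (simp only: mult.assoc[symmetric])
        qed
        also have "\<dots> \<le> ?m * a1 a2" by (rule R)
        finally show ?thesis unfolding mp using a0 by (simp add: pos_le_divide_eq)
      qed
      have large: "2 * (K * (1 + \<beta>)\<^sup>2) * ?m \<le> min 1 (\<beta> / 2) * \<kappa>\<^sup>2 * a"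
      proof -
        have "K \<le> \<tau>\<^sup>2 * a" using a(2) \<tau> by (simp add: pos_divide_le_eq mult.commute)
        then have "K * a \<le> \<tau>\<^sup>2 * a * a" using a0 by (intro mult_right_mono) auto
        then have "?m\<^sup>2 \<le> (\<tau> * a)\<^sup>2" using m_le by (simp add: power2_eq_square ac_simps)
        then have "?m \<le> \<tau> * a" by (rule power2_le_imp_le) (use \<tau> a0 in simp)
        then have "2 * (K * (1 + \<beta>)\<^sup>2) * ?m \<le> 2 * (K * (1 + \<beta>)\<^sup>2) * (\<tau> * a)" using K1 by (intro mult_left_mono) auto
        also have "\<dots> = c * \<kappa>\<^sup>2 * a" using K1 \<beta>_pos by (simp add: \<tau>_def)
        finally show ?thesis by (simp add: c_def)
      qed
      have lower: "(c * \<kappa>\<^sup>2 / 4)\<^sup>2 / l1_const K \<le> LR.l1_distance"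
        unfolding c_def by (rule l1_distance_lower[OF K1 a(1) mp_le m_le \<kappa> \<kappa>_le large])
      have Cpos: "l1_const K > 0" by (rule l1_const_pos[OF K1 a(1) mp_le m_le])
      have l: "0 < l" "l \<le> LR.l1_distance"
        using lower Cpos c \<kappa> unfolding l_def by (auto simp: min_le_iff_disj)
      show ?case using distance_ge[OF assms(5) l] l(1) elim(2) unfolding PL_def by simp
    qed
    then have ev2: "\<forall>\<^sub>F a2 in at_top. ereal (min l (l\<^sup>2 / 4)) \<le> D a2" by (auto elim: eventually_mono)
    have l: "0 < l" using eventually_happens'[OF trivial_limit_at_top_linorder *] by blast
    have "0 < ereal (min l (l\<^sup>2 / 4))" using l by simp
    also have "\<dots> \<le> Liminf at_top D" using ev2 by (rule Liminf_bounded)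
    finally show ?thesis .
  qed
  show ?thesis using part1 part2 unfolding Let_def D_def[abs_def] by blast
qed

end
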